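(* Let $\mathfrak g$ be a complex simple Lie algebra of type $A_\ell$ with $\ell$ odd, $D_\ell$ ($\ell\ge4$), $E_6$, $E_7$ or $E_8$, with (even) Coxeter number $h$, $g=h/2$, highest root $\psi$, and with $i_*$, $\alpha_{i_*}$, $\beta_{i_*}$, $\Pi_1,\Pi_2,\tau_1,\tau_2$ and $\sigma$ as in the context. Then $\psi$ and $\beta_{i_*}$ lie in the same $\sigma$-orbit. More precisely, if $g$ is odd then $$\sigma^{\frac{g-1}{2}}(\psi)=\beta_{i_*}=\alpha_{i_*},$$ and if $g$ is even then $$\sigma^{\frac g2}(\psi)=\beta_{i_*}=-\alpha_{i_*}.$$ Furthermore $\sigma^g$ commutes with $\tau_1$ and $\tau_2$, one has $\sigma^g(\Pi_k)=-\Pi_k$ for $k\in\{1,2\}$, and $\sigma^g(\alpha_{i_*})=-\alpha_{i_*}$; so in any case $\psi$ and $\alpha_{i_*}$ lie in the same $\sigma$-orbit.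
   Context: Let $\ell$ be the rank of $\mathfrak g$, $I=\{1,\dots,\ell\}$, $\Delta$ the roots of $\mathfrak g$ with respect to a Cartan subalgebra, $\Delta_+$ a choice of positive roots, $\Pi=\{\alpha_i\mid i\in I\}$ the simple roots, $W$ the Weyl group, and $h$ the Coxeter number (so $\ell(h+1)=\dim\mathfrak g$). The special index $i_*\in I$ is such that $\alpha_{i_*}$ is the branch node of the Coxeter-Dynkin diagram for types $D,E$, and the middle node for type $A_\ell$ ($\ell$ odd). There is a unique partition $\Pi=\Pi_1\cup\Pi_2$, with $\Pi_k=\{\alpha_i\mid i\in I_k\}$ and $I=I_1\sqcup I_2$, such that distinct roots in the same $\Pi_k$ are orthogonal and all roots in $\Pi_2$ are orthogonal to $\psi$ ($\Pi_2$ may be empty, for $A_1$). Let $s_i\in W$ be the reflection in $\alpha_i$, $\tau_k=\prod_{i\in I_k}s_i$ for $k=1,2$, and $\sigma=\tau_2\tau_1$ (a Coxeter element); $\sigma$-orbits are orbits in $\Delta$ of the cyclic group generated by $\sigma$. Put $\beta_i=\alpha_i$ if $i\in I_1$ and $\beta_i=-\alpha_i$ if $i\in I_2$. *)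

theory Defs
  imports "HOL-Analysis.Analysis"
begin

text \<open>Complex Lie algebras. The carrier is the whole type \<open>'g\<close>; the structure consists of the
  scalar multiplication and the bracket.\<close>

record 'g lie_structure =
  smul :: "complex \<Rightarrow> 'g \<Rightarrow> 'g"
  brk :: "'g \<Rightarrow> 'g \<Rightarrow> 'g"

definition fd_lie_algebra :: "'g::ab_group_add lie_structure \<Rightarrow> bool" where
  "fd_lie_algebra L \<longleftrightarrow>
     vector_space (smul L) \<and>
     (\<exists>B. finite B \<and> module.span (smul L) B = UNIV) \<and>
     (\<forall>x. Vector_Spaces.linear (smul L) (smul L) (\<lambda>y. brk L x y)) \<and>
     (\<forall>y. Vector_Spaces.linear (smul L) (smul L) (\<lambda>x. brk L x y)) \<and>
     (\<forall>x. brk L x x = 0) \<and>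
     (\<forall>x y z. brk L x (brk L y z) + brk L y (brk L z x) + brk L z (brk L x y) = 0)"

definition lie_ideal :: "'g::ab_group_add lie_structure \<Rightarrow> 'g set \<Rightarrow> bool" where
  "lie_ideal L J \<longleftrightarrow> module.subspace (smul L) J \<and> (\<forall>x. \<forall>y\<in>J. brk L x y \<in> J)"

definition simple_lie_algebra :: "'g::ab_group_add lie_structure \<Rightarrow> bool" where
  "simple_lie_algebra L \<longleftrightarrow>
     fd_lie_algebra L \<and> (\<exists>x y. brk L x y \<noteq> 0) \<and>
     (\<forall>J. lie_ideal L J \<longrightarrow> J = {0} \<or> J = UNIV)"

definition abelian_subalgebra :: "'g::ab_group_add lie_structure \<Rightarrow> 'g set \<Rightarrow> bool" where
  "abelian_subalgebra L K \<longleftrightarrow>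
     module.subspace (smul L) K \<and> (\<forall>x\<in>K. \<forall>y\<in>K. brk L x y = 0)"

text \<open>Cartan subalgebras in the form usual for semisimple Lie algebras: a maximal abelian
  subalgebra all of whose elements act semisimply (over the complex numbers: diagonalizably)
  in the adjoint representation.\<close>

definition cartan_subalgebra :: "'g::ab_group_add lie_structure \<Rightarrow> 'g set \<Rightarrow> bool" where
  "cartan_subalgebra L H \<longleftrightarrow>
     abelian_subalgebra L H \<and>
     (\<forall>K. abelian_subalgebra L K \<and> H \<subseteq> K \<longrightarrow> K = H) \<and>
     (\<forall>h\<in>H. module.span (smul L) {x. \<exists>c. brk L h x = smul L c x} = UNIV)"

text \<open>The dual space of \<open>H\<close>. A functional on \<open>H\<close> is represented by the function on \<open>'g\<close> which
  vanishes outside \<open>H\<close>, so that equality of functionals is equality of functions.\<close>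

definition cartan_dual :: "'g::ab_group_add lie_structure \<Rightarrow> 'g set \<Rightarrow> ('g \<Rightarrow> complex) set" where
  "cartan_dual L H = {\<mu>.
     (\<forall>x\<in>H. \<forall>y\<in>H. \<mu> (x + y) = \<mu> x + \<mu> y) \<and>
     (\<forall>c. \<forall>x\<in>H. \<mu> (smul L c x) = c * \<mu> x) \<and>
     (\<forall>x. x \<notin> H \<longrightarrow> \<mu> x = 0)}"

definition root_space :: "'g::ab_group_add lie_structure \<Rightarrow> 'g set \<Rightarrow> ('g \<Rightarrow> complex) \<Rightarrow> 'g set" where
  "root_space L H \<mu> = {x. \<forall>h\<in>H. brk L h x = smul L (\<mu> h) x}"

definition roots :: "'g::ab_group_add lie_structure \<Rightarrow> 'g set \<Rightarrow> ('g \<Rightarrow> complex) set" where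
  "roots L H = {\<alpha> \<in> cartan_dual L H. \<alpha> \<noteq> (\<lambda>_. 0) \<and> root_space L H \<alpha> \<noteq> {0}}"

text \<open>The trace of an endomorphism, computed in an arbitrarily chosen basis.\<close>

definition endo_trace :: "'g::ab_group_add lie_structure \<Rightarrow> ('g \<Rightarrow> 'g) \<Rightarrow> complex" where
  "endo_trace L f =
     (let B = (SOME B. \<not> module.dependent (smul L) B \<and> module.span (smul L) B = UNIV)
      in \<Sum>b\<in>B. module.representation (smul L) B (f b) b)"

definition killing :: "'g::ab_group_add lie_structure \<Rightarrow> 'g \<Rightarrow> 'g \<Rightarrow> complex" where
  "killing L x y = endo_trace L (\<lambda>z. brk L x (brk L y z))"

text \<open>The bilinear form on the dual of \<open>H\<close> induced by the Killing form, through the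
  identification of a functional \<open>\<mu>\<close> with the \<open>t\<close> in \<open>H\<close> such that \<open>killing L t h = \<mu> h\<close>.\<close>

definition killing_dual_vec ::
    "'g::ab_group_add lie_structure \<Rightarrow> 'g set \<Rightarrow> ('g \<Rightarrow> complex) \<Rightarrow> 'g" where
  "killing_dual_vec L H \<mu> = (THE t. t \<in> H \<and> (\<forall>h\<in>H. killing L t h = \<mu> h))"

definition form ::
    "'g::ab_group_add lie_structure \<Rightarrow> 'g set \<Rightarrow> ('g \<Rightarrow> complex) \<Rightarrow> ('g \<Rightarrow> complex) \<Rightarrow> complex" where
  "form L H \<mu> \<nu> = killing L (killing_dual_vec L H \<mu>) (killing_dual_vec L H \<nu>)"

definition reflection ::
    "'g::ab_group_add lie_structure \<Rightarrow> 'g set \<Rightarrow> ('g \<Rightarrow> complex) \<Rightarrow> ('g \<Rightarrow> complex) \<Rightarrow> ('g \<Rightarrow> complex)"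
  where
  "reflection L H \<alpha> \<mu> = (\<lambda>h. \<mu> h - 2 * form L H \<mu> \<alpha> / form L H \<alpha> \<alpha> * \<alpha> h)"

text \<open>The choice of positive roots is recorded by the simple roots \<open>\<alpha> 1, \<dots>, \<alpha> l\<close>: they form a basis
  of the dual of \<open>H\<close> (linearly independent, and as many as the rank), and each root is a
  combination of them with integer coefficients which are all \<open>\<ge> 0\<close> (the positive roots) or
  all \<open>\<le> 0\<close> (the negative roots).\<close>

definition nonneg_comb :: "nat \<Rightarrow> (nat \<Rightarrow> 'g \<Rightarrow> complex) \<Rightarrow> ('g \<Rightarrow> complex) \<Rightarrow> bool" where
  "nonneg_comb l \<alpha> \<mu> \<longleftrightarrow> (\<exists>c::nat \<Rightarrow> nat. \<mu> = (\<lambda>h. \<Sum>i\<in>{1..l}. of_nat (c i) * \<alpha> i h))"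

definition simple_roots ::
    "'g::ab_group_add lie_structure \<Rightarrow> 'g set \<Rightarrow> nat \<Rightarrow> (nat \<Rightarrow> 'g \<Rightarrow> complex) \<Rightarrow> bool" where
  "simple_roots L H l \<alpha> \<longleftrightarrow>
     vector_space.dim (smul L) H = l \<and>
     (\<forall>i\<in>{1..l}. \<alpha> i \<in> roots L H) \<and>
     (\<forall>c::nat \<Rightarrow> complex. (\<forall>h. (\<Sum>i\<in>{1..l}. c i * \<alpha> i h) = 0) \<longrightarrow> (\<forall>i\<in>{1..l}. c i = 0)) \<and>
     (\<forall>\<beta>\<in>roots L H. nonneg_comb l \<alpha> \<beta> \<or> nonneg_comb l \<alpha> (- \<beta>))"

definition highest_root ::
    "'g::ab_group_add lie_structure \<Rightarrow> 'g set \<Rightarrow> nat \<Rightarrow> (nat \<Rightarrow> 'g \<Rightarrow> complex) \<Rightarrow> ('g \<Rightarrow> complex) \<Rightarrow> bool"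
  where
  "highest_root L H l \<alpha> \<psi> \<longleftrightarrow>
     \<psi> \<in> roots L H \<and> (\<forall>\<beta>\<in>roots L H. nonneg_comb l \<alpha> (\<psi> - \<beta>))"

text \<open>Simply laced Dynkin diagrams on the nodes \<open>1, \<dots>, l\<close> in Bourbaki's labelling: \<open>TypeA l\<close> is the
  path; \<open>TypeD l\<close> is the path on \<open>1, \<dots>, l-1\<close> with \<open>l\<close> attached to \<open>l-2\<close>; \<open>TypeE l\<close> is the path
  \<open>1,3,4,\<dots>,l\<close> with \<open>2\<close> attached to \<open>4\<close>.\<close>

datatype dynkin_type = TypeA nat | TypeD nat | TypeE nat

fun type_rank :: "dynkin_type \<Rightarrow> nat" where
  "type_rank (TypeA l) = l"
| "type_rank (TypeD l) = l"
| "type_rank (TypeE l) = l"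

fun admissible_type :: "dynkin_type \<Rightarrow> bool" where
  "admissible_type (TypeA l) \<longleftrightarrow> odd l"
| "admissible_type (TypeD l) \<longleftrightarrow> 4 \<le> l"
| "admissible_type (TypeE l) \<longleftrightarrow> l \<in> {6, 7, 8}"

text \<open>The edges \<open>i - j\<close> with \<open>i < j\<close>.\<close>

fun dynkin_edge :: "dynkin_type \<Rightarrow> nat \<Rightarrow> nat \<Rightarrow> bool" where
  "dynkin_edge (TypeA l) i j \<longleftrightarrow> 1 \<le> i \<and> j = i + 1 \<and> j \<le> l"
| "dynkin_edge (TypeD l) i j \<longleftrightarrow> (1 \<le> i \<and> j = i + 1 \<and> j \<le> l - 1) \<or> (i = l - 2 \<and> j = l)"
| "dynkin_edge (TypeE l) i j \<longleftrightarrow>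
     (i = 1 \<and> j = 3) \<or> (i = 2 \<and> j = 4) \<or> (3 \<le> i \<and> j = i + 1 \<and> j \<le> l)"

definition dynkin_adjacent :: "dynkin_type \<Rightarrow> nat \<Rightarrow> nat \<Rightarrow> bool" where
  "dynkin_adjacent X i j \<longleftrightarrow> dynkin_edge X i j \<or> dynkin_edge X j i"

text \<open>The Cartan matrix of the simple roots is the one given by the diagram.\<close>

definition has_dynkin_type ::
    "'g::ab_group_add lie_structure \<Rightarrow> 'g set \<Rightarrow> (nat \<Rightarrow> 'g \<Rightarrow> complex) \<Rightarrow> dynkin_type \<Rightarrow> bool" where
  "has_dynkin_type L H \<alpha> X \<longleftrightarrow>
     (\<forall>i\<in>{1..type_rank X}. \<forall>j\<in>{1..type_rank X}.
        2 * form L H (\<alpha> i) (\<alpha> j) / form L H (\<alpha> j) (\<alpha> j)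
          = (if i = j then 2 else if dynkin_adjacent X i j then - 1 else 0))"

text \<open>The special index: the middle node of \<open>TypeA l\<close>, the branch node otherwise.\<close>

definition special_node :: "dynkin_type \<Rightarrow> nat \<Rightarrow> bool" where
  "special_node X i \<longleftrightarrow> i \<in> {1..type_rank X} \<and>
     (case X of TypeA l \<Rightarrow> 2 * i = l + 1
      | _ \<Rightarrow> card {j \<in> {1..type_rank X}. dynkin_adjacent X i j} = 3)"

definition root_partition ::
    "'g::ab_group_add lie_structure \<Rightarrow> 'g set \<Rightarrow> nat \<Rightarrow> (nat \<Rightarrow> 'g \<Rightarrow> complex) \<Rightarrow> ('g \<Rightarrow> complex)
      \<Rightarrow> nat set \<Rightarrow> nat set \<Rightarrow> bool" where
  "root_partition L H l \<alpha> \<psi> I1 I2 \<longleftrightarrow>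
     I1 \<union> I2 = {1..l} \<and> I1 \<inter> I2 = {} \<and>
     (\<forall>i\<in>I1. \<forall>j\<in>I1. i \<noteq> j \<longrightarrow> form L H (\<alpha> i) (\<alpha> j) = 0) \<and>
     (\<forall>i\<in>I2. \<forall>j\<in>I2. i \<noteq> j \<longrightarrow> form L H (\<alpha> i) (\<alpha> j) = 0) \<and>
     (\<forall>i\<in>I2. form L H (\<alpha> i) \<psi> = 0)"

text \<open>The product of the reflections \<open>s\<^sub>i\<close>, \<open>i \<in> J\<close>. It is taken in increasing order of the indices;
  the order is immaterial when the \<open>\<alpha> i\<close> are pairwise orthogonal.\<close>

definition refl_prod ::
    "'g::ab_group_add lie_structure \<Rightarrow> 'g set \<Rightarrow> (nat \<Rightarrow> 'g \<Rightarrow> complex) \<Rightarrow> nat set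
      \<Rightarrow> ('g \<Rightarrow> complex) \<Rightarrow> ('g \<Rightarrow> complex)" where
  "refl_prod L H \<alpha> J = foldr (\<lambda>i w. reflection L H (\<alpha> i) \<circ> w) (sorted_list_of_set J) id"

definition coxeter_element ::
    "'g::ab_group_add lie_structure \<Rightarrow> 'g set \<Rightarrow> (nat \<Rightarrow> 'g \<Rightarrow> complex) \<Rightarrow> nat set \<Rightarrow> nat set
      \<Rightarrow> ('g \<Rightarrow> complex) \<Rightarrow> ('g \<Rightarrow> complex)" where
  "coxeter_element L H \<alpha> I1 I2 = refl_prod L H \<alpha> I2 \<circ> refl_prod L H \<alpha> I1"

text \<open>The Coxeter number is the order of a Coxeter element in the Weyl group; Weyl group elements
  are compared as transformations of the dual of \<open>H\<close>.\<close>

definition coxeter_number ::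
    "'g::ab_group_add lie_structure \<Rightarrow> 'g set \<Rightarrow> (nat \<Rightarrow> 'g \<Rightarrow> complex) \<Rightarrow> nat set \<Rightarrow> nat set \<Rightarrow> nat" where
  "coxeter_number L H \<alpha> I1 I2 =
     (LEAST n. 0 < n \<and> (\<forall>\<mu>\<in>cartan_dual L H. (coxeter_element L H \<alpha> I1 I2 ^^ n) \<mu> = \<mu>))"

text \<open>Two roots lie in the same orbit of the cyclic group generated by \<open>w\<close>: one is obtained from
  the other by a power of \<open>w\<close>, with a positive or a negative exponent.\<close>

definition same_orbit ::
    "'g::ab_group_add lie_structure \<Rightarrow> 'g set \<Rightarrow> (('g \<Rightarrow> complex) \<Rightarrow> ('g \<Rightarrow> complex))
      \<Rightarrow> ('g \<Rightarrow> complex) \<Rightarrow> ('g \<Rightarrow> complex) \<Rightarrow> bool" where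
  "same_orbit L H w \<mu> \<nu> \<longleftrightarrow>
     \<mu> \<in> roots L H \<and> \<nu> \<in> roots L H \<and> (\<exists>n::nat. (w ^^ n) \<mu> = \<nu> \<or> (w ^^ n) \<nu> = \<mu>)"

definition signed_simple_root ::
    "(nat \<Rightarrow> 'g \<Rightarrow> complex) \<Rightarrow> nat set \<Rightarrow> nat \<Rightarrow> ('g \<Rightarrow> complex)" where
  "signed_simple_root \<alpha> I1 i = (if i \<in> I1 then \<alpha> i else - \<alpha> i)"

end

(*
On the Cartan subalgebra the Killing form is the sum over all weights mu of mu(h) mu(k), and the
weights are integral combinations of the simple roots; evaluation at h and its conjugate shows that
the form is nondegenerate there and, by simplicity, on the whole algebra, without Cartan's
criterion. Vanishing of the trace of [x, y] on subspaces stable under an sl2 triple shows that root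
spaces are one-dimensional and that the simple reflections permute the roots.

Starting from the root theta that will turn out to be the highest one and applying tau1, tau2, tau1,
... alternately, one reaches the simple root at the special node after g - 1 steps. Read backwards
this shows that theta is a root, and theta is the highest root psi because both have norm 2 and
(psi, theta) >= (theta, theta). The next step changes the sign, so from there on the sequence runs
backwards with the opposite sign and arrives at -psi after 2g steps without meeting psi; since
sigma^g maps the simple roots to negatives of simple roots, the Coxeter number is 2g. In coordinates
the alternating steps are a discrete wave equation on the Dynkin diagram. For type A the half period
comes from reflection at the ends of a strip, type D folds onto a longer path, and type E is a
finite calculation.
*)

theory Submission
  imports Defs
begin

section \<open>Linear algebra\<close>

text \<open>The traces in the Killing form use a basis fixed by choice, and the Dynkin type is given
  only as a Cartan matrix, so lengths and reflections of roots have to be earned. Integrality is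
  free, as \<open>simple_roots\<close> gives roots integer coefficients. Positivity comes from
  comparing two expressions: on integral vectors the form is \<kappa> times an integral form and
  also \<kappa>^2 times a sum of integer squares, and evaluation on one simple root fixes the sign
  of \<kappa> for all types at once. Until then the nonvanishing of root norms is carried along as a
  hypothesis.

  The facts that depend on the type are collected in \<open>coxeter_data\<close>. The steps act on
  coordinates over any commutative ring: integers serve for signs and calculation, complex numbers
  for arbitrary functionals. The Coxeter number is an order, so proper divisors d of 2g have to be
  excluded; they satisfy 2d \<le> 2g, hence 2g steps of the sequence are enough. Commutation of
  \<sigma>^g with \<tau>1 and \<tau>2 comes from the dihedral relation \<sigma>^n \<tau> \<sigma>^n
  = \<tau> together with \<sigma>^(2g) = 1.\<close>

locale linear_space = vector_space scale
  for scale :: "'a::field \<Rightarrow> 'b::ab_group_add \<Rightarrow> 'b" (infixr "\<odot>" 75)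
begin

text \<open>\<open>B\<close> need not span: traces on subspaces stable under f are covered too,
  which is how the sl2 arguments use it. Vectors outside \<open>span B\<close> have coordinates
  0.\<close>

definition trace_on :: "'b set \<Rightarrow> ('b \<Rightarrow> 'b) \<Rightarrow> 'a" where
  "trace_on B f = (\<Sum>b\<in>B. representation B (f b) b)"

lemma endo_sum:
  assumes "Vector_Spaces.linear scale scale f"
  shows "f (\<Sum>a\<in>A. c a \<odot> x a) = (\<Sum>a\<in>A. c a \<odot> f (x a))"
proof -
  interpret f: module_hom scale scale f
    using assms by (simp add: module_hom_iff_linear)
  show ?thesis by (simp add: f.sum f.scale)
qed

lemma representation_lincomb:
  assumes "independent B" "\<And>a. a \<in> A \<Longrightarrow> x a \<in> span B"
  shows "representation B (\<Sum>a\<in>A. c a \<odot> x a) b = (\<Sum>a\<in>A. c a * representation B (x a) b)"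
  using assms by (simp add: representation_sum span_scale representation_scale)

text \<open>Both orders give the same double sum over coordinates. This one fact yields symmetry and
  invariance of the Killing form and the vanishing of commutator traces.\<close>

lemma trace_on_commute:
  assumes B: "independent B" "finite B"
    and lin: "Vector_Spaces.linear scale scale f" "Vector_Spaces.linear scale scale k"
    and st: "\<And>b. b \<in> B \<Longrightarrow> f b \<in> span B" "\<And>b. b \<in> B \<Longrightarrow> k b \<in> span B"
  shows "trace_on B (\<lambda>x. f (k x)) = trace_on B (\<lambda>x. k (f x))"
proof -
  have *: "representation B (f' (k' b)) b = (\<Sum>c\<in>B. representation B (k' b) c * representation B (f' c) b)"
    if "b \<in> B" "Vector_Spaces.linear scale scale f'"
      "\<And>b. b \<in> B \<Longrightarrow> f' b \<in> span B" "\<And>b. b \<in> B \<Longrightarrow> k' b \<in> span B" for f' k' b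
  proof -
    have "k' b = (\<Sum>c\<in>B. representation B (k' b) c \<odot> c)"
      using sum_representation_eq[OF B(1) that(4)[OF that(1)] B(2)] by simp
    then have "f' (k' b) = (\<Sum>c\<in>B. representation B (k' b) c \<odot> f' c)"
      using endo_sum[OF that(2), of "\<lambda>c. representation B (k' b) c" "\<lambda>c. c" B] by simp
    then show ?thesis
      using representation_lincomb[OF B(1), of B f'] that(3) by simp
  qed
  have "trace_on B (\<lambda>x. f (k x)) = (\<Sum>b\<in>B. \<Sum>c\<in>B. representation B (k b) c * representation B (f c) b)"
    unfolding trace_on_def by (intro sum.cong refl *[OF _ lin(1) st])
  also have "\<dots> = (\<Sum>c\<in>B. \<Sum>b\<in>B. representation B (f c) b * representation B (k b) c)"
    by (subst sum.swap) (simp add: mult.commute)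
  also have "\<dots> = trace_on B (\<lambda>x. k (f x))"
    unfolding trace_on_def by (intro sum.cong refl *[OF _ lin(2) st(2,1), symmetric])
  finally show ?thesis .
qed

text \<open>Expand each b in C, swap the sums, and reassemble f c from its B-coordinates. It is
  needed because \<open>endo_trace\<close> fixes its basis by \<open>SOME\<close>, while
  calculations take place in a basis of weight vectors.\<close>

lemma trace_on_basis_indep:
  assumes B: "independent B" "finite B" "span B = UNIV"
    and C: "independent C" "finite C" "span C = UNIV"
    and lin: "Vector_Spaces.linear scale scale f"
  shows "trace_on B f = trace_on C f"
proof -
  have exp: "representation D' (f d) d' = (\<Sum>c\<in>D. representation D d c * representation D' (f c) d')"
    if "independent D" "finite D" "span D = UNIV" "independent D'" "span D' = UNIV" for d D D' d'
  proof -
    have "d = (\<Sum>c\<in>D. representation D d c \<odot> c)"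
      using sum_representation_eq[of D d D] that by simp
    then have "f d = (\<Sum>c\<in>D. representation D d c \<odot> f c)"
      using endo_sum[OF lin, of "\<lambda>c. representation D d c" "\<lambda>c. c" D] by simp
    then show ?thesis
      using representation_lincomb[OF that(4), of D f] that(5) by simp
  qed
  have "trace_on B f = (\<Sum>b\<in>B. \<Sum>c\<in>C. representation C b c * representation B (f c) b)"
    unfolding trace_on_def by (intro sum.cong refl exp) (use B C in auto)
  also have "\<dots> = (\<Sum>c\<in>C. \<Sum>b\<in>B. representation B (f c) b * representation C b c)"
    by (subst sum.swap) (simp add: mult.commute)
  also have "\<dots> = trace_on C f"
    unfolding trace_on_def
  proof (intro sum.cong refl)
    fix c
    have "f c = (\<Sum>b\<in>B. representation B (f c) b \<odot> b)"
      using sum_representation_eq[of B "f c" B] B by simp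
    then show "(\<Sum>b\<in>B. representation B (f c) b * representation C b c) = representation C (f c) c"
      using representation_lincomb[OF C(1), of B "\<lambda>b. b" "representation B (f c)" c] C(3) by simp
  qed
  finally show ?thesis .
qed

text \<open>Applying f - a to the sum removes the a-component and multiplies every other one by c -
  a, which is nonzero.\<close>

lemma eigenvectors_sum_zero:
  assumes lin: "Vector_Spaces.linear scale scale f"
    and "finite C" "\<And>c. c \<in> C \<Longrightarrow> f (x c) = c \<odot> x c" "(\<Sum>c\<in>C. x c) = 0"
  shows "\<forall>c\<in>C. x c = 0"
  using assms(2-)
proof (induction C arbitrary: x)
  case empty
  then show ?case by simp
next
  case (insert a C)
  interpret f: module_hom scale scale f
    using lin by (simp add: module_hom_iff_linear)
  define x' where "x' c = (c - a) \<odot> x c" for c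
  have "0 = f (\<Sum>c\<in>insert a C. x c) - a \<odot> (\<Sum>c\<in>insert a C. x c)"
    by (simp add: insert.prems)
  also have "\<dots> = (\<Sum>c\<in>insert a C. c \<odot> x c) - (\<Sum>c\<in>insert a C. a \<odot> x c)"
    using insert.prems(1) by (simp add: f.sum scale_sum_right del: sum.insert)
  also have "\<dots> = (\<Sum>c\<in>C. x' c)"
    using insert.hyps by (simp add: x'_def scale_left_diff_distrib sum_subtractf)
  finally have "(\<Sum>c\<in>C. x' c) = 0" by simp
  moreover have "f (x' c) = c \<odot> x' c" if "c \<in> C" for c
    using that insert.prems(1) by (simp add: x'_def f.scale mult.commute)
  ultimately have "\<forall>c\<in>C. x' c = 0" by (intro insert.IH) auto
  then have C: "\<forall>c\<in>C. x c = 0"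
    using insert.hyps by (auto simp: x'_def)
  then have "x a = 0" using insert.prems(2) insert.hyps by simp
  with C show ?case by simp
qed

text \<open>The components are indexed by their eigenvalues, with vectors of equal eigenvalue
  merged, so that \<open>eigenvectors_sum_zero\<close> can be applied to them.\<close>

lemma span_eigenvectors_decomposition:
  assumes lin: "Vector_Spaces.linear scale scale f"
    and "v \<in> span {x. \<exists>c. f x = c \<odot> x}"
  shows "\<exists>C x. finite C \<and> (\<forall>c. f (x c) = c \<odot> x c) \<and> (\<forall>c. c \<notin> C \<longrightarrow> x c = 0) \<and> v = (\<Sum>c\<in>C. x c)"
  using assms(2)
proof (induction rule: span_induct_alt)
  interpret f: module_hom scale scale f
    using lin by (simp add: module_hom_iff_linear)
  case base
  show ?case
    by (intro exI[of _ "{}"] exI[of _ "\<lambda>_. 0"]) (simp add: f.zero)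
next
  interpret f: module_hom scale scale f
    using lin by (simp add: module_hom_iff_linear)
  case (step a u v)
  then obtain C x where C: "finite C" "\<forall>c. f (x c) = c \<odot> x c" "\<forall>c. c \<notin> C \<longrightarrow> x c = 0"
      "v = (\<Sum>c\<in>C. x c)"
    by auto
  from step obtain e where e: "f u = e \<odot> u" by auto
  define x' where "x' = x(e := x e + a \<odot> u)"
  have "(\<Sum>c\<in>insert e C. x' c) = x' e + (\<Sum>c\<in>C - {e}. x c)"
    using C by (simp add: sum.insert_remove x'_def)
  also have "\<dots> = a \<odot> u + (x e + (\<Sum>c\<in>C - {e}. x c))" by (simp add: x'_def algebra_simps)
  also have "x e + (\<Sum>c\<in>C - {e}. x c) = (\<Sum>c\<in>insert e C. x c)"
    using C by (simp add: sum.insert_remove)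
  also have "\<dots> = v" using C by (cases "e \<in> C") (simp_all add: insert_absorb)
  finally have "a \<odot> u + v = (\<Sum>c\<in>insert e C. x' c)" by simp
  moreover have "\<forall>c. f (x' c) = c \<odot> x' c"
    using C e by (simp add: x'_def f.add f.scale scale_right_distrib mult.commute)
  moreover have "\<forall>c. c \<notin> insert e C \<longrightarrow> x' c = 0" using C by (simp add: x'_def)
  ultimately show ?case using C(1) by blast
qed

text \<open>If \<open>\<phi>\<^sub>n\<close> vanishes on the common kernel of the others, it is a combination of them.\<close>

lemma dual_vectors_exist:
  assumes "subspace V" "finite A"
    and "\<And>i x y. i \<in> A \<Longrightarrow> x \<in> V \<Longrightarrow> y \<in> V \<Longrightarrow> \<phi> i (x + y) = \<phi> i x + \<phi> i y"
    and "\<And>i c x. i \<in> A \<Longrightarrow> x \<in> V \<Longrightarrow> \<phi> i (c \<odot> x) = c * \<phi> i x"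
    and "\<And>c i. (\<forall>v\<in>V. (\<Sum>i\<in>A. c i * \<phi> i v) = 0) \<Longrightarrow> i \<in> A \<Longrightarrow> c i = 0"
  shows "\<exists>e. \<forall>i\<in>A. e i \<in> V \<and> (\<forall>j\<in>A. \<phi> j (e i) = (if i = j then 1 else 0))"
  using assms(2-)
proof (induction A)
  case empty
  then show ?case by simp
next
  case (insert n A)
  have lin_sum: "\<phi> i (\<Sum>j\<in>B. c j \<odot> x j) = (\<Sum>j\<in>B. c j * \<phi> i (x j))"
    if "finite B" "i \<in> insert n A" "\<And>j. j \<in> B \<Longrightarrow> x j \<in> V" for i B c x
    using that(1,3)
  proof (induction B)
    case empty
    then show ?case
      using insert.prems(2)[OF that(2) subspace_0[OF assms(1)], of 0] by simp
  next
    case (insert a B)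
    have "(\<Sum>j\<in>B. c j \<odot> x j) \<in> V"
      using insert.prems by (intro subspace_sum[OF assms(1)] subspace_scale[OF assms(1)]) auto
    then show ?case
      using insert \<open>i \<in> insert n A\<close> \<open>\<And>i x y. i \<in> insert n A \<Longrightarrow> x \<in> V \<Longrightarrow> y \<in> V \<Longrightarrow> \<phi> i (x + y) = \<phi> i x + \<phi> i y\<close>
        \<open>\<And>i c x. i \<in> insert n A \<Longrightarrow> x \<in> V \<Longrightarrow> \<phi> i (c \<odot> x) = c * \<phi> i x\<close>
      by (simp add: subspace_scale[OF assms(1)])
  qed
  have "\<exists>e. \<forall>i\<in>A. e i \<in> V \<and> (\<forall>j\<in>A. \<phi> j (e i) = (if i = j then 1 else 0))"
  proof (rule insert.IH)
    fix c i assume c: "\<forall>v\<in>V. (\<Sum>i\<in>A. c i * \<phi> i v) = 0" and "i \<in> A"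
    have "(\<Sum>i\<in>A. (c(n:=0)) i * \<phi> i v) = (\<Sum>i\<in>A. c i * \<phi> i v)" for v
      using insert.hyps by (intro sum.cong) auto
    then have "\<forall>v\<in>V. (\<Sum>i\<in>insert n A. (c(n:=0)) i * \<phi> i v) = 0"
      using c insert.hyps by simp
    from insert.prems(3)[OF this, of i] show "c i = 0" using \<open>i \<in> A\<close> insert.hyps by (auto split: if_splits)
  qed (use insert.prems in auto)
  then obtain e where e: "\<And>i. i \<in> A \<Longrightarrow> e i \<in> V"
      "\<And>i j. i \<in> A \<Longrightarrow> j \<in> A \<Longrightarrow> \<phi> j (e i) = (if i = j then 1 else 0)"
    by auto
  have "\<exists>v\<in>V. (\<forall>i\<in>A. \<phi> i v = 0) \<and> \<phi> n v \<noteq> 0"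
  proof (rule ccontr)
    assume "\<not> ?thesis"
    then have ker: "\<phi> n v = 0" if "v \<in> V" "\<forall>i\<in>A. \<phi> i v = 0" for v using that by blast
    \<comment> \<open>The coefficients of that combination are the values \<phi> n (e i), since v -
      w below lies in the common kernel; the entry - 1 makes the relation nontrivial.\<close>
    define c where "c i = (if i = n then - 1 else \<phi> n (e i))" for i
    have "(\<Sum>i\<in>insert n A. c i * \<phi> i v) = 0" if v: "v \<in> V" for v
    proof -
      define w where "w = (\<Sum>i\<in>A. \<phi> i v \<odot> e i)"
      have wV: "w \<in> V"
        using e unfolding w_def by (intro subspace_sum[OF assms(1)] subspace_scale[OF assms(1)]) auto
      have \<phi>w: "\<phi> j w = \<phi> j v" if "j \<in> A" for j
      proof -
        have "\<phi> j w = (\<Sum>i\<in>A. \<phi> i v * \<phi> j (e i))"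
          unfolding w_def using e that insert.hyps by (intro lin_sum) auto
        also have "\<dots> = (\<Sum>i\<in>A. if i = j then \<phi> i v else 0)"
          using e that by (intro sum.cong) auto
        finally show ?thesis using that insert.hyps by simp
      qed
      have diff: "\<phi> i (v - w) = \<phi> i v - \<phi> i w" if "i \<in> insert n A" for i
        using insert.prems(1)[OF that subspace_diff[OF assms(1) v wV] wV] by simp
      have "\<phi> n (v - w) = 0"
        using diff \<phi>w by (intro ker subspace_diff assms(1) v wV) auto
      then have "\<phi> n v = \<phi> n w" using diff by simp
      also have "\<dots> = (\<Sum>i\<in>A. \<phi> i v * \<phi> n (e i))"
        unfolding w_def using e insert.hyps by (intro lin_sum) auto
      finally have "\<phi> n v = (\<Sum>i\<in>A. c i * \<phi> i v)"
        using insert.hyps by (auto simp: c_def mult.commute intro!: sum.cong)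
      then show ?thesis using insert.hyps by (simp add: c_def)
    qed
    then have "c n = 0" using insert.prems(3) by blast
    then show False by (simp add: c_def)
  qed
  then obtain v0 where v0: "v0 \<in> V" "\<forall>i\<in>A. \<phi> i v0 = 0" "\<phi> n v0 \<noteq> 0" by auto
  define v where "v = (1 / \<phi> n v0) \<odot> v0"
  have v: "v \<in> V" "\<phi> n v = 1" "\<And>i. i \<in> A \<Longrightarrow> \<phi> i v = 0"
    using v0 insert.prems(2) by (auto simp: v_def subspace_scale[OF assms(1)])
  define e' where "e' i = (if i = n then v else e i - \<phi> n (e i) \<odot> v)" for i
  have diff: "\<phi> j (e i - c \<odot> v) = \<phi> j (e i) - c * \<phi> j v" if "j \<in> insert n A" "i \<in> A" for i j c
    using insert.prems(1)[OF that(1) subspace_diff[OF assms(1) e(1)[OF that(2)]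
      subspace_scale[OF assms(1) v(1), of c]] subspace_scale[OF assms(1) v(1), of c]]
      insert.prems(2)[OF that(1) v(1)] by simp
  have "\<forall>i\<in>insert n A. e' i \<in> V \<and> (\<forall>j\<in>insert n A. \<phi> j (e' i) = (if i = j then 1 else 0))"
    using e v diff insert.hyps
    by (auto simp: e'_def intro!: subspace_diff[OF assms(1)] subspace_scale[OF assms(1)])
  then show ?case by blast
qed

end

section \<open>Root space decomposition\<close>

locale lie_cartan =
  fixes L :: "'g::ab_group_add lie_structure" and H :: "'g set"
  assumes simple: "simple_lie_algebra L" and cartan: "cartan_subalgebra L H"

sublocale lie_cartan \<subseteq> linear_space "smul L"
  using simple by (simp add: linear_space_def simple_lie_algebra_def fd_lie_algebra_def)

context lie_cartan
begin

abbreviation sc (infixr "\<odot>" 75) where "sc \<equiv> smul L"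
abbreviation br where "br \<equiv> brk L"

lemma ad_linear: "Vector_Spaces.linear sc sc (br x)"
  and br_linear_left: "Vector_Spaces.linear sc sc (\<lambda>x. br x y)"
  using simple by (auto simp: simple_lie_algebra_def fd_lie_algebra_def)

lemma br_add: "br x (y + z) = br x y + br x z" "br (x + y) z = br x z + br y z"
  and br_scale: "br x (c \<odot> y) = c \<odot> br x y" "br (c \<odot> x) y = c \<odot> br x y"
  using ad_linear br_linear_left by (auto simp: Vector_Spaces.linear_iff)

lemma br_self: "br x x = 0"
  and br_cyclic: "br x (br y z) + br y (br z x) + br z (br x y) = 0"
  using simple by (auto simp: simple_lie_algebra_def fd_lie_algebra_def)

lemma br_zero: "br x 0 = 0" "br 0 x = 0"
  using br_scale(1)[of x 0 0] br_scale(2)[of 0 0 x] by simp_all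

lemma br_minus: "br x (- y) = - br x y" "br (- x) y = - br x y"
  using br_scale(1)[of x "-1" y] br_scale(2)[of "-1" x y] by (simp_all add: scale_minus_left)

lemma br_diff: "br x (y - z) = br x y - br x z" "br (x - y) z = br x z - br y z"
  using br_add(1)[of x "y - z" z] br_add(2)[of "x - y" y z] by simp_all

lemma br_anticomm: "br x y = - br y x"
proof -
  have "0 = br (x + y) (x + y)" by (simp add: br_self)
  also have "\<dots> = br x y + br y x" unfolding br_add by (simp add: br_self)
  finally show ?thesis using eq_neg_iff_add_eq_0 by metis
qed

lemma br_jacobi: "br (br x y) z = br x (br y z) - br y (br x z)"
proof -
  have "br (br x y) z = - br z (br x y)" by (rule br_anticomm)
  moreover have "br y (br z x) = - br y (br x z)"
    unfolding br_anticomm[of z x] br_minus ..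
  moreover have "br z (br x y) = - (br x (br y z) + br y (br z x))"
    using br_cyclic[of x y z] by (metis add.commute eq_neg_iff_add_eq_0)
  ultimately show ?thesis by simp
qed

lemma H_subspace: "subspace H"
  and H_abelian: "x \<in> H \<Longrightarrow> y \<in> H \<Longrightarrow> br x y = 0"
  and H_diagonalizable: "x \<in> H \<Longrightarrow> span {y. \<exists>c. br x y = c \<odot> y} = UNIV"
  using cartan by (auto simp: cartan_subalgebra_def abelian_subalgebra_def)

text \<open>H and x together span an abelian subalgebra, so maximality of H absorbs x. This makes H
  the whole zero weight space.\<close>

lemma H_self_centralizing:
  assumes "\<And>h. h \<in> H \<Longrightarrow> br h x = 0"
  shows "x \<in> H"
proof -
  define K where "K = span (insert x H)"
  have K: "\<exists>c h. h \<in> H \<and> y = c \<odot> x + h" if y: "y \<in> K" for y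
  proof -
    obtain c where "y - c \<odot> x \<in> span H"
      using y unfolding K_def span_breakdown_eq by blast
    then have "y - c \<odot> x \<in> H" using span_eq_iff[THEN iffD2, OF H_subspace] by simp
    moreover have "y = c \<odot> x + (y - c \<odot> x)" by simp
    ultimately show ?thesis by blast
  qed
  have "br y z = 0" if yz: "y \<in> K" "z \<in> K" for y z
  proof -
    obtain c h d k where *: "h \<in> H" "y = c \<odot> x + h" "k \<in> H" "z = d \<odot> x + k"
      using K[OF yz(1)] K[OF yz(2)] by blast
    have "br x k = 0" using assms[OF *(3)] br_anticomm[of x k] by simp
    then show ?thesis
      using * assms H_abelian by (simp add: br_add br_scale br_self)
  qed
  then have "abelian_subalgebra L K"
    by (simp add: abelian_subalgebra_def K_def)
  moreover have "H \<subseteq> K" by (auto simp: K_def intro: span_base)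
  ultimately have "K = H" using cartan by (auto simp: cartan_subalgebra_def)
  then show ?thesis by (auto simp: K_def intro: span_base)
qed

lemma finite_independent: "independent B \<Longrightarrow> finite B"
proof -
  assume B: "independent B"
  obtain T where T: "finite T" "span T = UNIV"
    using simple by (auto simp: simple_lie_algebra_def fd_lie_algebra_def)
  show "finite B" using independent_span_bound[OF T(1) B] T(2) by simp
qed

text \<open>Split a common eigenvector of A into eigenvectors of h. As H is abelian, h' - d maps
  each component to an eigenvector of h for the same eigenvalue; the images add up to 0, so each is
  0, and the components remain eigenvectors for all of A.\<close>

lemma simultaneous_eigenvectors_span:
  assumes "finite A" "A \<subseteq> H"
  shows "span {x. \<forall>h\<in>A. \<exists>c. br h x = c \<odot> x} = UNIV"
  using assms
proof (induction A)
  case empty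
  then show ?case by simp
next
  case (insert h A)
  let ?E = "{x. \<forall>h\<in>A. \<exists>c. br h x = c \<odot> x}"
  let ?E' = "{x. \<forall>h\<in>insert h A. \<exists>c. br h x = c \<odot> x}"
  have "x \<in> span ?E'" if x: "x \<in> ?E" for x
  proof -
    have "x \<in> span {y. \<exists>c. br h y = c \<odot> y}" using insert.prems H_diagonalizable[of h] by simp
    then obtain C X where C: "finite C" "\<forall>c. br h (X c) = c \<odot> X c" "x = (\<Sum>c\<in>C. X c)"
      using span_eigenvectors_decomposition[OF ad_linear, of x h] by blast
    have "X c \<in> ?E'" if "c \<in> C" for c
    proof -
      have "\<exists>d. br h' (X c) = d \<odot> X c" if h': "h' \<in> A" for h'
      proof -
        obtain d where d: "br h' x = d \<odot> x" using x h' by blast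
        define Y where "Y c = br h' (X c) - d \<odot> X c" for c
        have hh': "br h h' = 0" using insert.prems h' by (intro H_abelian) auto
        have comm: "br h (br h' z) = br h' (br h z)" for z
          using br_jacobi[of h h' z] hh' by (simp add: br_zero)
        have "br h (Y c) = c \<odot> Y c" for c
          by (simp add: Y_def br_diff br_scale comm C(2)[rule_format] scale_right_diff_distrib mult.commute)
        moreover have "(\<Sum>c\<in>C. Y c) = 0"
          using d C(3) endo_sum[OF ad_linear, of h' "\<lambda>_. 1" X C]
          by (simp add: Y_def sum_subtractf scale_sum_right)
        ultimately have "Y c = 0"
          using eigenvectors_sum_zero[OF ad_linear C(1), of h Y] \<open>c \<in> C\<close> by blast
        then show ?thesis by (auto simp: Y_def)
      qed
      then show ?thesis using C(2) by auto
    qed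
    then show ?thesis unfolding C(3) by (intro span_sum) (rule span_base)
  qed
  then have "span ?E \<subseteq> span ?E'" by (intro span_minimal) auto
  then show ?case using insert.IH insert.prems by blast
qed

text \<open>A finite basis of H suffices, because an eigenvector of two maps is one of their
  combinations. The eigenvalue depends linearly on h since the eigenvector is nonzero.\<close>

lemma weight_basis_exists:
  "\<exists>B. independent B \<and> span B = UNIV \<and> (\<forall>b\<in>B. \<exists>\<mu>\<in>cartan_dual L H. b \<in> root_space L H \<mu>)"
proof -
  obtain A where A: "A \<subseteq> H" "independent A" "H \<subseteq> span A" by (rule maximal_independent_subset)
  let ?E = "{x. \<forall>h\<in>A. \<exists>c. br h x = c \<odot> x}"
  have E: "\<exists>c. br h x = c \<odot> x" if hx: "h \<in> H" "x \<in> ?E" for h x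
  proof -
    have "h \<in> span A" using that A by auto
    then show ?thesis
    proof (induction rule: span_induct_alt)
      case base
      have "br 0 x = 0 \<odot> x" by (simp add: br_zero)
      then show ?case by blast
    next
      case (step a u v)
      then obtain c where c: "br v x = c \<odot> x" by blast
      obtain d where "br u x = d \<odot> x" using step(1) hx by blast
      with c have "br (a \<odot> u + v) x = (a * d + c) \<odot> x"
        by (simp add: br_add br_scale scale_left_distrib)
      then show ?case by blast
    qed
  qed
  obtain B where B: "B \<subseteq> ?E" "independent B" "?E \<subseteq> span B" by (rule maximal_independent_subset)
  have "span ?E \<subseteq> span B" using B(3) by (intro span_minimal) auto
  then have "span B = UNIV"
    using simultaneous_eigenvectors_span[OF finite_independent[OF A(2)] A(1)] by auto
  moreover have "\<exists>\<mu>\<in>cartan_dual L H. b \<in> root_space L H \<mu>" if b: "b \<in> B" for b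
  proof -
    have "b \<noteq> 0" using b B(2) dependent_zero by auto
    then have cancel: "c = d" if "c \<odot> b = d \<odot> b" for c d using that by (simp add: scale_cancel_right)
    define \<mu> where "\<mu> h = (if h \<in> H then SOME c. br h b = c \<odot> b else 0)" for h
    have \<mu>: "br h b = \<mu> h \<odot> b" if "h \<in> H" for h
      using someI_ex[OF E[OF that subsetD[OF B(1) b]]] that by (simp add: \<mu>_def)
    have "\<mu> (x + y) = \<mu> x + \<mu> y" if "x \<in> H" "y \<in> H" for x y
    proof (rule cancel)
      have "\<mu> (x + y) \<odot> b = br (x + y) b"
        using \<mu> that subspace_add[OF H_subspace] by simp
      also have "\<dots> = (\<mu> x + \<mu> y) \<odot> b" using \<mu> that by (simp add: br_add scale_left_distrib)
      finally show "\<mu> (x + y) \<odot> b = (\<mu> x + \<mu> y) \<odot> b" .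
    qed
    moreover have "\<mu> (c \<odot> x) = c * \<mu> x" if "x \<in> H" for c x
    proof (rule cancel)
      have "\<mu> (c \<odot> x) \<odot> b = br (c \<odot> x) b"
        using \<mu> that subspace_scale[OF H_subspace] by simp
      also have "\<dots> = (c * \<mu> x) \<odot> b" using \<mu> that by (simp add: br_scale)
      finally show "\<mu> (c \<odot> x) \<odot> b = (c * \<mu> x) \<odot> b" .
    qed
    ultimately have "\<mu> \<in> cartan_dual L H" by (auto simp: cartan_dual_def \<mu>_def)
    then show ?thesis using \<mu> by (auto simp: root_space_def)
  qed
  ultimately show ?thesis using B(2) by blast
qed

text \<open>One fixed basis of weight vectors of the whole algebra. Its members of weight 0 lie in
  H, and sums over \<open>wb\<close> run over the weights with multiplicity.\<close>

definition wb :: "'g set" where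
  "wb = (SOME B. independent B \<and> span B = UNIV \<and> (\<forall>b\<in>B. \<exists>\<mu>\<in>cartan_dual L H. b \<in> root_space L H \<mu>))"

definition wt :: "'g \<Rightarrow> 'g \<Rightarrow> complex" where
  "wt b = (SOME \<mu>. \<mu> \<in> cartan_dual L H \<and> b \<in> root_space L H \<mu>)"

lemma wb_independent: "independent wb"
  and wb_span: "span wb = UNIV"
  and wb_weight: "b \<in> wb \<Longrightarrow> \<exists>\<mu>. \<mu> \<in> cartan_dual L H \<and> b \<in> root_space L H \<mu>"
  using someI_ex[OF weight_basis_exists] unfolding wb_def[symmetric] by blast+

lemma wb_finite: "finite wb"
  by (rule finite_independent[OF wb_independent])

lemma wt_dual: "b \<in> wb \<Longrightarrow> wt b \<in> cartan_dual L H"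
  and wt_root_space: "b \<in> wb \<Longrightarrow> b \<in> root_space L H (wt b)"
  using someI_ex[OF wb_weight] unfolding wt_def[symmetric] by blast+

lemma wt_eigen: "b \<in> wb \<Longrightarrow> h \<in> H \<Longrightarrow> br h b = wt b h \<odot> b"
  using wt_root_space by (auto simp: root_space_def)

lemma wb_nonzero: "b \<in> wb \<Longrightarrow> b \<noteq> 0"
  using wb_independent dependent_zero by auto

section \<open>Coordinates in the weight basis\<close>

abbreviation rep where "rep \<equiv> representation wb"

lemma rep_expand: "x = (\<Sum>b\<in>wb. rep x b \<odot> b)"
  using sum_representation_eq[OF wb_independent _ wb_finite, of x] wb_span by simp

lemma rep_br_H: "h \<in> H \<Longrightarrow> b \<in> wb \<Longrightarrow> rep (br h x) b = rep x b * wt b h"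
proof -
  assume h: "h \<in> H" and b: "b \<in> wb"
  have "br h x = br h (\<Sum>b\<in>wb. rep x b \<odot> b)" using rep_expand[of x] by simp
  also have "\<dots> = (\<Sum>b\<in>wb. rep x b \<odot> br h b)" by (rule endo_sum[OF ad_linear])
  also have "\<dots> = (\<Sum>b\<in>wb. (rep x b * wt b h) \<odot> b)"
    using h by (intro sum.cong) (simp_all add: wt_eigen)
  finally have "br h x = (\<Sum>b\<in>wb. (rep x b * wt b h) \<odot> b)" .
  then have "rep (br h x) b = (\<Sum>c\<in>wb. (rep x c * wt c h) * rep c b)"
    using representation_lincomb[OF wb_independent, of wb "\<lambda>b. b"] wb_span by simp
  also have "\<dots> = (\<Sum>c\<in>wb. if c = b then rep x c * wt c h else 0)"
    using wb_independent by (intro sum.cong) (auto simp: representation_basis)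
  finally show ?thesis using b wb_finite by simp
qed

lemma dual_eqI:
  assumes "\<mu> \<in> cartan_dual L H" "\<nu> \<in> cartan_dual L H" "\<And>h. h \<in> H \<Longrightarrow> \<mu> h = \<nu> h"
  shows "\<mu> = \<nu>"
proof
  fix h show "\<mu> h = \<nu> h" using assms by (cases "h \<in> H") (auto simp: cartan_dual_def)
qed

text \<open>Comparing b-coordinates in [h, x] = \<mu>(h) x forces \<open>wt b h\<close> = \<mu>(h)
  for every b that occurs in x.\<close>

lemma rep_root_space:
  assumes "x \<in> root_space L H \<mu>" "\<mu> \<in> cartan_dual L H" "rep x b \<noteq> 0"
  shows "b \<in> wb \<and> wt b = \<mu>"
proof -
  have b: "b \<in> wb" using assms(3) representation_ne_zero by blast
  have "wt b h = \<mu> h" if "h \<in> H" for h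
  proof -
    have "rep x b * wt b h = rep (br h x) b" using b that by (simp add: rep_br_H)
    also have "\<dots> = \<mu> h * rep x b"
      using assms(1) that wb_independent wb_span by (simp add: root_space_def representation_scale)
    finally show ?thesis using assms(3) by simp
  qed
  then show ?thesis using b dual_eqI wt_dual assms(2) by blast
qed

lemma root_space_weight:
  assumes "x \<in> root_space L H \<mu>" "\<mu> \<in> cartan_dual L H" "x \<noteq> 0"
  shows "\<exists>b\<in>wb. wt b = \<mu>"
proof -
  have "\<exists>b\<in>wb. rep x b \<noteq> 0"
  proof (rule ccontr)
    assume "\<not> ?thesis"
    then have "(\<Sum>b\<in>wb. rep x b \<odot> b) = 0" by (intro sum.neutral) auto
    then show False using rep_expand[of x] assms(3) by simp
  qed
  then show ?thesis using rep_root_space[OF assms(1,2)] by blast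
qed

lemma root_space_span:
  assumes "x \<in> root_space L H \<mu>" "\<mu> \<in> cartan_dual L H"
  shows "x \<in> span {b \<in> wb. wt b = \<mu>}"
proof -
  have "(\<Sum>b\<in>wb. rep x b \<odot> b) \<in> span {b \<in> wb. wt b = \<mu>}"
  proof (rule span_sum)
    fix b assume b: "b \<in> wb"
    show "rep x b \<odot> b \<in> span {b \<in> wb. wt b = \<mu>}"
      using rep_root_space[OF assms, of b] b
      by (cases "rep x b = 0") (auto intro: span_zero span_scale span_base)
  qed
  then show ?thesis using rep_expand[of x] by simp
qed

lemma root_space_weight_mem:
  assumes "b \<in> wb" "wt b \<noteq> (\<lambda>_. 0)"
  shows "wt b \<in> roots L H"
  using assms wt_dual wt_root_space wb_nonzero by (auto simp: roots_def)

lemma roots_eq: "roots L H = {wt b |b. b \<in> wb \<and> wt b \<noteq> (\<lambda>_. 0)}"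
proof
  show "roots L H \<subseteq> {wt b |b. b \<in> wb \<and> wt b \<noteq> (\<lambda>_. 0)}"
  proof
    fix \<mu> assume \<mu>: "\<mu> \<in> roots L H"
    have "0 \<in> root_space L H \<mu>" by (simp add: root_space_def br_zero)
    then obtain x where "x \<in> root_space L H \<mu>" "x \<noteq> 0" using \<mu> by (auto simp: roots_def)
    then show "\<mu> \<in> {wt b |b. b \<in> wb \<and> wt b \<noteq> (\<lambda>_. 0)}"
      using root_space_weight[of x \<mu>] \<mu> by (auto simp: roots_def)
  qed
qed (use root_space_weight_mem in auto)

lemma root_dual: "\<mu> \<in> roots L H \<Longrightarrow> \<mu> \<in> cartan_dual L H"
  and root_nonzero: "\<mu> \<in> roots L H \<Longrightarrow> \<mu> \<noteq> (\<lambda>_. 0)"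
  by (auto simp: roots_def)

lemma br_root_space:
  assumes "x \<in> root_space L H \<mu>" "y \<in> root_space L H \<nu>"
  shows "br x y \<in> root_space L H (\<lambda>h. \<mu> h + \<nu> h)"
proof -
  have "br h (br x y) = (\<mu> h + \<nu> h) \<odot> br x y" if "h \<in> H" for h
  proof -
    have "br h (br x y) = br (br h x) y + br x (br h y)" using br_jacobi[of h x y] by simp
    also have "\<dots> = (\<mu> h + \<nu> h) \<odot> br x y"
      using assms that by (simp add: root_space_def br_scale scale_left_distrib)
    finally show ?thesis .
  qed
  then show ?thesis by (simp add: root_space_def)
qed

lemma root_space_0: "root_space L H (\<lambda>_. 0) = H"
  using H_self_centralizing H_abelian by (auto simp: root_space_def)

lemma dual_add: "\<mu> \<in> cartan_dual L H \<Longrightarrow> x \<in> H \<Longrightarrow> y \<in> H \<Longrightarrow> \<mu> (x + y) = \<mu> x + \<mu> y"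
  and dual_scale: "\<mu> \<in> cartan_dual L H \<Longrightarrow> x \<in> H \<Longrightarrow> \<mu> (c \<odot> x) = c * \<mu> x"
  and dual_outside: "\<mu> \<in> cartan_dual L H \<Longrightarrow> x \<notin> H \<Longrightarrow> \<mu> x = 0"
  by (auto simp: cartan_dual_def)

lemma dual_sum:
  assumes "\<mu> \<in> cartan_dual L H" "finite A" "\<And>i. i \<in> A \<Longrightarrow> x i \<in> H"
  shows "\<mu> (\<Sum>i\<in>A. c i \<odot> x i) = (\<Sum>i\<in>A. c i * \<mu> (x i))"
  using assms(2,3)
proof (induction A)
  case empty
  show ?case using dual_scale[OF assms(1) subspace_0[OF H_subspace], of 0] by simp
next
  case (insert a A)
  have "(\<Sum>i\<in>A. c i \<odot> x i) \<in> H"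
    using insert by (intro subspace_sum[OF H_subspace] subspace_scale[OF H_subspace]) auto
  then show ?case
    using insert assms(1) by (simp add: dual_add dual_scale subspace_scale[OF H_subspace])
qed

lemma dual_lincomb:
  assumes "\<And>i. i \<in> A \<Longrightarrow> \<mu> i \<in> cartan_dual L H"
  shows "(\<lambda>h. \<Sum>i\<in>A. c i * \<mu> i h) \<in> cartan_dual L H"
  using assms
  by (auto simp: cartan_dual_def sum_distrib_left sum.distrib distrib_left mult.left_commute intro!: sum.neutral sum.cong)

section \<open>The Killing form as a trace over the weight basis\<close>

lemma killing_trace: "killing L x y = trace_on wb (\<lambda>z. br x (br y z))"
proof -
  let ?P = "\<lambda>B. independent B \<and> span B = UNIV"
  define B where "B = (SOME B. ?P B)"
  have B: "independent B" "span B = UNIV"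
    using someI[of ?P wb] wb_independent wb_span by (auto simp: B_def)
  have "Vector_Spaces.linear sc sc (\<lambda>z. br x (br y z))"
    using ad_linear by (auto simp: Vector_Spaces.linear_iff)
  then have "trace_on B (\<lambda>z. br x (br y z)) = trace_on wb (\<lambda>z. br x (br y z))"
    by (intro trace_on_basis_indep finite_independent B wb_independent wb_span)
  then show ?thesis by (simp add: killing_def endo_trace_def B_def[symmetric] trace_on_def)
qed

lemma killing_add: "killing L (x + y) z = killing L x z + killing L y z"
    "killing L x (y + z) = killing L x y + killing L x z"
  and killing_scale: "killing L (c \<odot> x) y = c * killing L x y" "killing L x (c \<odot> y) = c * killing L x y"
  using wb_independent wb_span
  by (simp_all add: killing_trace trace_on_def br_add br_scale representation_add representation_scale
      sum.distrib sum_distrib_left)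

lemma killing_zero: "killing L 0 x = 0" "killing L x 0 = 0"
  using killing_scale(1)[of 0 0 x] killing_scale(2)[of x 0 0] by simp_all

lemma killing_diff: "killing L (x - y) z = killing L x z - killing L y z"
  using killing_add(1)[of "x - y" y z] by simp

lemma killing_minus: "killing L (- x) z = - killing L x z"
  using killing_diff[of 0 x z] by (simp add: killing_zero)

lemma killing_sum:
  shows "killing L x (\<Sum>i\<in>A. c i \<odot> y i) = (\<Sum>i\<in>A. c i * killing L x (y i))"
    and "killing L (\<Sum>i\<in>A. c i \<odot> y i) x = (\<Sum>i\<in>A. c i * killing L (y i) x)"
  by (induction A rule: infinite_finite_induct) (simp_all add: killing_zero killing_add killing_scale)

lemma killing_sym: "killing L x y = killing L y x"
  unfolding killing_trace
  by (rule trace_on_commute[OF wb_independent wb_finite ad_linear ad_linear]) (simp_all add: wb_span)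

lemma killing_invariant: "killing L (br x y) z = killing L x (br y z)"
proof -
  have tr: "trace_on wb (\<lambda>w. f w - g w) = trace_on wb f - trace_on wb g" for f g
    using wb_independent wb_span by (simp add: trace_on_def representation_diff sum_subtractf)
  have "killing L (br x y) z = trace_on wb (\<lambda>w. br x (br y (br z w)) - br y (br x (br z w)))"
    by (simp add: killing_trace br_jacobi)
  also have "\<dots> = trace_on wb (\<lambda>w. br x (br y (br z w))) - trace_on wb (\<lambda>w. br y (br x (br z w)))"
    by (rule tr)
  \<comment> \<open>Cyclicity of the trace, with ad y as one factor and ad x ad z as the
    other.\<close>
  also have "trace_on wb (\<lambda>w. br y (br x (br z w))) = trace_on wb (\<lambda>w. br x (br z (br y w)))"
    by (rule trace_on_commute[OF wb_independent wb_finite ad_linear])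
      (use ad_linear in \<open>auto simp: Vector_Spaces.linear_iff wb_span\<close>)
  also have "trace_on wb (\<lambda>w. br x (br y (br z w))) - \<dots>
      = trace_on wb (\<lambda>w. br x (br y (br z w)) - br x (br z (br y w)))"
    by (rule tr[symmetric])
  also have "\<dots> = killing L x (br y z)"
    by (simp add: killing_trace br_jacobi br_diff)
  finally show ?thesis .
qed

lemma killing_H:
  assumes "h \<in> H" "k \<in> H"
  shows "killing L h k = (\<Sum>b\<in>wb. wt b h * wt b k)"
  unfolding killing_trace trace_on_def
proof (intro sum.cong refl)
  fix b assume "b \<in> wb"
  then show "rep (br h (br k b)) b = wt b h * wt b k"
    using assms wb_independent by (simp add: rep_br_H representation_basis mult.commute)
qed

lemma center_trivial:
  assumes "\<And>y. br x y = 0"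
  shows "x = 0"
proof -
  let ?Z = "{x. \<forall>y. br x y = 0}"
  have "br a b = 0" if "b \<in> ?Z" for a b using that br_anticomm[of a b] by simp
  then have "lie_ideal L ?Z"
    by (auto simp: lie_ideal_def subspace_def br_add br_scale br_zero)
  moreover have "?Z \<noteq> UNIV" using simple by (auto simp: simple_lie_algebra_def)
  ultimately have "?Z = {0}" using simple by (auto simp: simple_lie_algebra_def)
  then show ?thesis using assms by blast
qed

text \<open>Such an h acts as 0 on every weight vector, so it is central.\<close>

lemma weights_separate:
  assumes "h \<in> H" "\<And>b. b \<in> wb \<Longrightarrow> wt b h = 0"
  shows "h = 0"
proof (rule center_trivial)
  fix y
  have "br h y = br h (\<Sum>b\<in>wb. rep y b \<odot> b)" using rep_expand[of y] by simp
  also have "\<dots> = (\<Sum>b\<in>wb. rep y b \<odot> br h b)" by (rule endo_sum[OF ad_linear])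
  also have "\<dots> = 0" using assms by (intro sum.neutral) (simp add: wt_eigen)
  finally show "br h y = 0" .
qed

end

section \<open>Simple roots and the Killing form\<close>

locale lie_simple_roots = lie_cartan L H
  for L :: "'g::ab_group_add lie_structure" and H +
  fixes l :: nat and \<alpha> :: "nat \<Rightarrow> 'g \<Rightarrow> complex"
  assumes simple_roots: "simple_roots L H l \<alpha>" and rank_pos: "1 \<le> l"
begin

definition comb :: "(nat \<Rightarrow> complex) \<Rightarrow> 'g \<Rightarrow> complex" where
  "comb c = (\<lambda>h. \<Sum>i\<in>{1..l}. c i * \<alpha> i h)"

abbreviation icomb :: "(nat \<Rightarrow> int) \<Rightarrow> 'g \<Rightarrow> complex" where
  "icomb c \<equiv> comb (\<lambda>i. of_int (c i))"

lemma simple_root: "i \<in> {1..l} \<Longrightarrow> \<alpha> i \<in> roots L H"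
  and simple_roots_independent: "(\<And>h. (\<Sum>i\<in>{1..l}. c i * \<alpha> i h) = 0) \<Longrightarrow> i \<in> {1..l} \<Longrightarrow> c i = 0"
  and root_sign: "\<beta> \<in> roots L H \<Longrightarrow> nonneg_comb l \<alpha> \<beta> \<or> nonneg_comb l \<alpha> (- \<beta>)"
  using simple_roots by (auto simp: simple_roots_def)

lemma simple_root_dual: "i \<in> {1..l} \<Longrightarrow> \<alpha> i \<in> cartan_dual L H"
  using simple_root root_dual by blast

lemma comb_dual: "comb c \<in> cartan_dual L H"
  unfolding comb_def by (rule dual_lincomb) (rule simple_root_dual)

lemma comb_eqD:
  assumes "comb c = comb d" "i \<in> {1..l}"
  shows "c i = d i"
proof -
  have "(\<Sum>i\<in>{1..l}. (c i - d i) * \<alpha> i h) = 0" for h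
    using fun_cong[OF assms(1), of h] by (simp add: comb_def left_diff_distrib sum_subtractf)
  then have "c i - d i = 0" using simple_roots_independent[of "\<lambda>i. c i - d i"] assms(2) by blast
  then show ?thesis by simp
qed

lemma comb_cong: "(\<And>i. i \<in> {1..l} \<Longrightarrow> c i = d i) \<Longrightarrow> comb c = comb d"
  by (simp add: comb_def)

lemma comb_0: "comb (\<lambda>_. 0) = (\<lambda>_. 0)"
  and comb_uminus: "comb (\<lambda>i. - c i) = - comb c"
  and comb_diff: "comb (\<lambda>i. c i - d i) = comb c - comb d"
  by (auto simp: comb_def sum_negf left_diff_distrib sum_subtractf)

lemma comb_unit: "i \<in> {1..l} \<Longrightarrow> comb (\<lambda>j. if j = i then 1 else 0) = \<alpha> i"
  by (simp add: comb_def if_distrib[of "\<lambda>x. x * _"] cong: if_cong)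

text \<open>Natural coefficients become integers with sign conditions, so that roots can be
  subtracted and reflected within one coordinate type.\<close>

lemma nonneg_comb_iff: "nonneg_comb l \<alpha> \<mu> \<longleftrightarrow> (\<exists>c. \<mu> = icomb c \<and> (\<forall>i\<in>{1..l}. 0 \<le> c i))"
proof
  assume "nonneg_comb l \<alpha> \<mu>"
  then obtain c :: "nat \<Rightarrow> nat" where "\<mu> = (\<lambda>h. \<Sum>i\<in>{1..l}. of_nat (c i) * \<alpha> i h)"
    by (auto simp: nonneg_comb_def)
  then have "\<mu> = icomb (\<lambda>i. int (c i))" by (simp add: comb_def)
  then show "\<exists>c. \<mu> = icomb c \<and> (\<forall>i\<in>{1..l}. 0 \<le> c i)"
    by (intro exI[of _ "\<lambda>i. int (c i)"]) simp
next
  assume "\<exists>c. \<mu> = icomb c \<and> (\<forall>i\<in>{1..l}. 0 \<le> c i)"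
  then obtain c :: "nat \<Rightarrow> int" where c: "\<mu> = icomb c" "\<forall>i\<in>{1..l}. 0 \<le> c i" by blast
  then have "\<mu> = comb (\<lambda>i. of_nat (nat (c i)))"
    by (auto intro!: comb_cong)
  then show "nonneg_comb l \<alpha> \<mu>" by (auto simp: nonneg_comb_def comb_def)
qed

lemma root_icomb:
  assumes "\<beta> \<in> roots L H"
  shows "\<exists>c. \<beta> = icomb c \<and> ((\<forall>i\<in>{1..l}. 0 \<le> c i) \<or> (\<forall>i\<in>{1..l}. c i \<le> 0))"
proof (cases "nonneg_comb l \<alpha> \<beta>")
  case True
  then show ?thesis by (auto simp: nonneg_comb_iff)
next
  case False
  then obtain c where c: "- \<beta> = icomb c" "\<forall>i\<in>{1..l}. 0 \<le> c i"
    using root_sign[OF assms] by (auto simp: nonneg_comb_iff)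
  have "\<beta> = - (- \<beta>)" by (simp add: fun_eq_iff)
  also have "\<dots> = icomb (\<lambda>i. - c i)" unfolding c(1) by (simp add: comb_uminus)
  finally show ?thesis using c(2) by (intro exI[of _ "\<lambda>i. - c i"]) auto
qed

lemma weight_icomb: "b \<in> wb \<Longrightarrow> \<exists>c. wt b = icomb c"
proof (cases "wt b = (\<lambda>_. 0)")
  case True
  then show ?thesis by (intro exI[of _ "\<lambda>_. 0"]) (simp add: comb_0)
next
  case False
  assume "b \<in> wb"
  then show ?thesis using False root_space_weight_mem root_icomb by blast
qed

section \<open>Coweights dual to the simple roots\<close>

lemma fundamental_coweights_exist:
  "\<exists>e. \<forall>i\<in>{1..l}. e i \<in> H \<and> (\<forall>j\<in>{1..l}. \<alpha> j (e i) = (if i = j then 1 else 0))"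
proof (rule dual_vectors_exist[OF H_subspace])
  fix c i assume c: "\<forall>v\<in>H. (\<Sum>i\<in>{1..l}. c i * \<alpha> i v) = 0" and i: "i \<in> {1..l}"
  \<comment> \<open>Independence in \<open>simple_roots\<close> is stated on the whole algebra; a
    relation on H extends there because functionals vanish outside H.\<close>
  have "(\<Sum>i\<in>{1..l}. c i * \<alpha> i v) = 0" for v
    using c simple_root_dual dual_outside by (cases "v \<in> H") (auto intro!: sum.neutral)
  then show "c i = 0" using simple_roots_independent i by blast
qed (use simple_root_dual dual_add dual_scale in auto)

definition cw :: "nat \<Rightarrow> 'g" where
  "cw = (SOME e. \<forall>i\<in>{1..l}. e i \<in> H \<and> (\<forall>j\<in>{1..l}. \<alpha> j (e i) = (if i = j then 1 else 0)))"

lemma cw_H: "i \<in> {1..l} \<Longrightarrow> cw i \<in> H"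
  and cw_eval: "i \<in> {1..l} \<Longrightarrow> j \<in> {1..l} \<Longrightarrow> \<alpha> j (cw i) = (if i = j then 1 else 0)"
  using someI_ex[OF fundamental_coweights_exist] unfolding cw_def[symmetric] by blast+

lemma cw_lincomb_H: "(\<Sum>i\<in>{1..l}. c i \<odot> cw i) \<in> H"
  by (intro subspace_sum[OF H_subspace] subspace_scale[OF H_subspace] cw_H)

lemma simple_root_cw_lincomb:
  assumes "j \<in> {1..l}"
  shows "\<alpha> j (\<Sum>i\<in>{1..l}. c i \<odot> cw i) = c j"
proof -
  have "\<alpha> j (\<Sum>i\<in>{1..l}. c i \<odot> cw i) = (\<Sum>i\<in>{1..l}. c i * \<alpha> j (cw i))"
    using dual_sum[OF simple_root_dual[OF assms]] cw_H by blast
  also have "\<dots> = (\<Sum>i\<in>{1..l}. if i = j then c i else 0)"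
    using assms by (intro sum.cong) (auto simp: cw_eval)
  finally show ?thesis using assms by simp
qed

lemma simple_roots_separate:
  assumes "h \<in> H" "\<And>i. i \<in> {1..l} \<Longrightarrow> \<alpha> i h = 0"
  shows "h = 0"
proof (rule weights_separate[OF assms(1)])
  fix b assume "b \<in> wb"
  then obtain c where "wt b = icomb c" using weight_icomb by blast
  then show "wt b h = 0" using assms(2) by (simp add: comb_def)
qed

lemma H_expand:
  assumes "h \<in> H"
  shows "h = (\<Sum>i\<in>{1..l}. \<alpha> i h \<odot> cw i)"
proof -
  let ?k = "\<Sum>i\<in>{1..l}. \<alpha> i h \<odot> cw i"
  have kH: "?k \<in> H" by (rule cw_lincomb_H)
  have "h - ?k = 0"
  proof (rule simple_roots_separate)
    show "h - ?k \<in> H" by (rule subspace_diff[OF H_subspace assms kH])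
    fix i assume i: "i \<in> {1..l}"
    have "\<alpha> i h = \<alpha> i (h - ?k) + \<alpha> i ?k"
      using dual_add[OF simple_root_dual[OF i] subspace_diff[OF H_subspace assms kH] kH] by simp
    then show "\<alpha> i (h - ?k) = 0" using simple_root_cw_lincomb[OF i] by simp
  qed
  then show ?thesis by simp
qed

lemma dual_expand:
  assumes "\<mu> \<in> cartan_dual L H"
  shows "\<mu> = comb (\<lambda>i. \<mu> (cw i))"
proof (rule dual_eqI[OF assms comb_dual])
  fix h assume "h \<in> H"
  have "\<mu> h = \<mu> (\<Sum>i\<in>{1..l}. \<alpha> i h \<odot> cw i)" using H_expand[OF \<open>h \<in> H\<close>] by simp
  also have "\<dots> = (\<Sum>i\<in>{1..l}. \<alpha> i h * \<mu> (cw i))"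
    using cw_H by (intro dual_sum[OF assms]) auto
  finally show "\<mu> h = comb (\<lambda>i. \<mu> (cw i)) h" by (simp add: comb_def mult.commute)
qed

text \<open>Weights are integral combinations of the simple roots, so they take conjugate values at
  conjugate points, and \<open>killing L h (cnj h)\<close> is a sum of squared absolute values.\<close>

lemma killing_H_nondegenerate:
  assumes h: "h \<in> H" and orth: "\<And>k. k \<in> H \<Longrightarrow> killing L h k = 0"
  shows "h = 0"
proof -
  define k where "k = (\<Sum>i\<in>{1..l}. cnj (\<alpha> i h) \<odot> cw i)"
  have k: "k \<in> H" unfolding k_def by (rule cw_lincomb_H)
  have cnj: "wt b k = cnj (wt b h)" if b: "b \<in> wb" for b
  proof -
    obtain c where c: "wt b = icomb c" using weight_icomb b by blast
    show ?thesis unfolding c comb_def using simple_root_cw_lincomb by (simp add: k_def)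
  qed
  have "0 = killing L h k" using orth k by simp
  also have "\<dots> = (\<Sum>b\<in>wb. complex_of_real ((cmod (wt b h))\<^sup>2))"
    unfolding killing_H[OF h k]
    by (intro sum.cong) (simp_all add: cnj complex_norm_square[symmetric] del: of_real_power)
  also have "\<dots> = complex_of_real (\<Sum>b\<in>wb. (cmod (wt b h))\<^sup>2)" by simp
  finally have "(\<Sum>b\<in>wb. (cmod (wt b h))\<^sup>2) = 0" by (metis of_real_eq_0_iff)
  then have "\<forall>b\<in>wb. (cmod (wt b h))\<^sup>2 = 0"
    using sum_nonneg_eq_0_iff[OF wb_finite, of "\<lambda>b. (cmod (wt b h))\<^sup>2"] by simp
  then show "h = 0" by (intro weights_separate[OF h]) auto
qed

text \<open>The functionals \<open>killing L (cw j)\<close> are independent on H by nondegeneracy,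
  so \<open>dual_vectors_exist\<close> supplies vectors dual to the coweights, and t is assembled
  from them. This gives meaning to the definite description in
  \<open>killing_dual_vec\<close>.\<close>

lemma killing_dual_vec_ex1:
  assumes \<mu>: "\<mu> \<in> cartan_dual L H"
  shows "\<exists>!t. t \<in> H \<and> (\<forall>h\<in>H. killing L t h = \<mu> h)"
proof -
  have "\<exists>f. \<forall>i\<in>{1..l}. f i \<in> H \<and> (\<forall>j\<in>{1..l}. killing L (cw j) (f i) = (if i = j then 1 else 0))"
  proof (rule dual_vectors_exist[OF H_subspace])
    fix c i assume c: "\<forall>v\<in>H. (\<Sum>i\<in>{1..l}. c i * killing L (cw i) v) = 0" and i: "i \<in> {1..l}"
    have "(\<Sum>i\<in>{1..l}. c i \<odot> cw i) = 0"
      using c by (intro killing_H_nondegenerate[OF cw_lincomb_H]) (simp add: killing_sum)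
    then show "c i = 0" using simple_root_cw_lincomb[OF i, of c] dual_scale[OF simple_root_dual[OF i] subspace_0[OF H_subspace], of 0]
      by simp
  qed (auto simp: killing_add killing_scale)
  then obtain f where f: "\<And>i. i \<in> {1..l} \<Longrightarrow> f i \<in> H"
    "\<And>i j. i \<in> {1..l} \<Longrightarrow> j \<in> {1..l} \<Longrightarrow> killing L (cw j) (f i) = (if i = j then 1 else 0)"
    by blast
  define t where "t = (\<Sum>i\<in>{1..l}. \<mu> (cw i) \<odot> f i)"
  have t: "t \<in> H" unfolding t_def by (intro subspace_sum[OF H_subspace] subspace_scale[OF H_subspace] f)
  have tj: "killing L t (cw j) = \<mu> (cw j)" if j: "j \<in> {1..l}" for j
  proof -
    have "killing L t (cw j) = (\<Sum>i\<in>{1..l}. \<mu> (cw i) * killing L (cw j) (f i))"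
      by (simp add: t_def killing_sum killing_sym)
    also have "\<dots> = (\<Sum>i\<in>{1..l}. if i = j then \<mu> (cw i) else 0)"
      using f(2) j by (intro sum.cong) auto
    finally show ?thesis using j by simp
  qed
  have "killing L t h = \<mu> h" if h: "h \<in> H" for h
  proof -
    have "killing L t h = killing L t (\<Sum>i\<in>{1..l}. \<alpha> i h \<odot> cw i)" using H_expand[OF h] by simp
    also have "\<dots> = (\<Sum>i\<in>{1..l}. \<alpha> i h * \<mu> (cw i))" by (simp add: killing_sum tj)
    also have "\<dots> = \<mu> (\<Sum>i\<in>{1..l}. \<alpha> i h \<odot> cw i)" using cw_H by (intro dual_sum[OF \<mu>, symmetric]) auto
    finally show ?thesis using H_expand[OF h] by simp
  qed
  moreover have "u = t" if "u \<in> H" "\<forall>h\<in>H. killing L u h = \<mu> h" for u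
  proof -
    have "u - t = 0" using that t calculation
      by (intro killing_H_nondegenerate subspace_diff[OF H_subspace]) (auto simp: killing_diff)
    then show ?thesis by simp
  qed
  ultimately show ?thesis using t by blast
qed

section \<open>The induced form on the dual of H\<close>

abbreviation tv where "tv \<equiv> killing_dual_vec L H"
abbreviation fm where "fm \<equiv> form L H"

lemma tv_H: "\<mu> \<in> cartan_dual L H \<Longrightarrow> tv \<mu> \<in> H"
  and killing_tv: "\<mu> \<in> cartan_dual L H \<Longrightarrow> h \<in> H \<Longrightarrow> killing L (tv \<mu>) h = \<mu> h"
  using theI'[OF killing_dual_vec_ex1] unfolding killing_dual_vec_def[symmetric] by blast+

lemma form_eval: "\<mu> \<in> cartan_dual L H \<Longrightarrow> \<nu> \<in> cartan_dual L H \<Longrightarrow> fm \<mu> \<nu> = \<mu> (tv \<nu>)"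
  by (simp add: form_def killing_tv tv_H)

lemma form_sym: "fm \<mu> \<nu> = fm \<nu> \<mu>"
  by (simp add: form_def killing_sym)

lemma form_lincomb:
  assumes "\<And>i. i \<in> A \<Longrightarrow> \<mu> i \<in> cartan_dual L H" "\<nu> \<in> cartan_dual L H"
  shows "fm (\<lambda>h. \<Sum>i\<in>A. c i * \<mu> i h) \<nu> = (\<Sum>i\<in>A. c i * fm (\<mu> i) \<nu>)"
  using assms by (simp add: form_eval dual_lincomb)

lemma form_comb: "\<nu> \<in> cartan_dual L H \<Longrightarrow> fm (comb c) \<nu> = (\<Sum>i\<in>{1..l}. c i * fm (\<alpha> i) \<nu>)"
  unfolding comb_def by (rule form_lincomb) (rule simple_root_dual)

text \<open>\<open>killing_H\<close> carried over to the dual; on integral vectors this is the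
  source of positivity.\<close>

lemma form_sum_weights:
  assumes "\<mu> \<in> cartan_dual L H" "\<nu> \<in> cartan_dual L H"
  shows "fm \<mu> \<nu> = (\<Sum>b\<in>wb. fm (wt b) \<mu> * fm (wt b) \<nu>)"
  using assms by (simp add: form_def[of L H \<mu> \<nu>] killing_H tv_H form_eval wt_dual)

text \<open>The radical is an ideal by invariance, so it is 0 or everything. In the second case
  nondegeneracy on H would make the coweight \<open>cw 1\<close> vanish, although \<alpha> 1 takes
  the value 1 there.\<close>

lemma killing_nondegenerate:
  assumes "\<And>y. killing L x y = 0"
  shows "x = 0"
proof -
  let ?R = "{x. \<forall>y. killing L x y = 0}"
  have "killing L (br a b) y = 0" if "b \<in> ?R" for a b y
    using that br_anticomm[of a b] killing_invariant[of b a y] by (simp add: killing_minus)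
  then have "lie_ideal L ?R"
    by (auto simp: lie_ideal_def subspace_def killing_add killing_scale killing_zero)
  moreover have "?R \<noteq> UNIV"
  proof
    assume "?R = UNIV"
    then have "cw 1 = 0" using rank_pos by (intro killing_H_nondegenerate cw_H) auto
    then have "\<alpha> 1 (cw 1) = 0" using rank_pos
      dual_scale[OF simple_root_dual[of 1] subspace_0[OF H_subspace], of 0] by simp
    then show False using cw_eval[of 1 1] rank_pos by simp
  qed
  ultimately have "?R = {0}" using simple by (auto simp: simple_lie_algebra_def)
  then show ?thesis using assms by blast
qed

section \<open>Pairing of opposite root spaces\<close>

lemma killing_root_spaces:
  assumes "x \<in> root_space L H \<mu>" "y \<in> root_space L H \<nu>" "h \<in> H" "\<mu> h + \<nu> h \<noteq> 0"
  shows "killing L x y = 0"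
proof -
  have "br h x = \<mu> h \<odot> x" "br h y = \<nu> h \<odot> y" using assms by (auto simp: root_space_def)
  moreover have "killing L (br h x) y = - killing L x (br h y)"
    using killing_invariant[of x h y] br_anticomm[of h x] by (simp add: killing_minus)
  ultimately have "(\<mu> h + \<nu> h) * killing L x y = 0"
    by (simp add: killing_scale distrib_right)
  then show ?thesis using assms(4) by simp
qed

text \<open>By nondegeneracy x pairs nontrivially with some basis vector, and
  \<open>killing_root_spaces\<close> leaves only the weight - \<mu> for it.\<close>

lemma root_space_pairing:
  assumes "x \<in> root_space L H \<mu>" "\<mu> \<in> cartan_dual L H" "x \<noteq> 0"
  shows "\<exists>b\<in>wb. wt b = - \<mu> \<and> killing L x b \<noteq> 0"
proof (rule ccontr)
  assume *: "\<not> ?thesis"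
  have "killing L x b = 0" if b: "b \<in> wb" for b
  proof (cases "wt b = - \<mu>")
    case True
    then show ?thesis using * b by auto
  next
    case False
    have "- \<mu> \<in> cartan_dual L H"
      using assms(2) by (auto simp: cartan_dual_def)
    then obtain h where "h \<in> H" "wt b h \<noteq> (- \<mu>) h"
      using False dual_eqI[OF wt_dual[OF b]] by blast
    then show ?thesis
      using killing_root_spaces[OF assms(1) wt_root_space[OF b], of h]
      by (simp add: eq_neg_iff_add_eq_0 add.commute)
  qed
  then have "killing L x y = 0" for y
    using rep_expand[of y] killing_sum(1)[of x "rep y" "\<lambda>b. b" wb] by simp
  then show False using killing_nondegenerate assms(3) by blast
qed

lemma root_witness:
  assumes "\<beta> \<in> roots L H"
  shows "\<exists>b\<in>wb. wt b = \<beta>"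
  using assms by (auto simp: roots_eq)

lemma root_uminus:
  assumes "\<beta> \<in> roots L H"
  shows "- \<beta> \<in> roots L H"
proof -
  obtain b where b: "b \<in> wb" "wt b = \<beta>" using root_witness[OF assms] by blast
  have "b \<in> root_space L H \<beta>" using wt_root_space[OF b(1)] b(2) by simp
  then obtain b' where b': "b' \<in> wb" "wt b' = - \<beta>"
    using root_space_pairing[OF _ root_dual[OF assms] wb_nonzero[OF b(1)]] by blast
  have "- \<beta> \<noteq> (\<lambda>_. 0)"
    using root_nonzero[OF assms] by (auto simp: fun_eq_iff)
  then show ?thesis using root_space_weight_mem[OF b'(1)] b'(2) by simp
qed

text \<open>Both sides lie in H, so pairing with every k in H decides; invariance turns
  \<open>killing L k (br x y)\<close> into \<beta>(k) \<open>killing L x y\<close>.\<close>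

lemma br_opposite:
  assumes "x \<in> root_space L H \<beta>" "y \<in> root_space L H (- \<beta>)" "\<beta> \<in> cartan_dual L H"
  shows "br x y = killing L x y \<odot> tv \<beta>"
proof -
  have "(\<lambda>h. \<beta> h + (- \<beta>) h) = (\<lambda>_. 0)" by auto
  then have xy: "br x y \<in> H" using br_root_space[OF assms(1,2)] root_space_0 by simp
  have "br x y - killing L x y \<odot> tv \<beta> = 0"
  proof (rule killing_H_nondegenerate)
    show "br x y - killing L x y \<odot> tv \<beta> \<in> H"
      using xy tv_H[OF assms(3)] by (intro subspace_diff[OF H_subspace] subspace_scale[OF H_subspace])
    fix k assume k: "k \<in> H"
    have "killing L (br x y) k = killing L k (br x y)" by (rule killing_sym)
    also have "\<dots> = killing L (br k x) y" by (rule killing_invariant[symmetric])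
    also have "\<dots> = \<beta> k * killing L x y" using assms(1) k by (simp add: root_space_def killing_scale)
    finally show "killing L (br x y - killing L x y \<odot> tv \<beta>) k = 0"
      using killing_tv[OF assms(3) k] by (simp add: killing_diff killing_scale)
  qed
  then show ?thesis by simp
qed

end

section \<open>Root strings\<close>

context lie_cartan
begin

lemma span_ad_stable:
  assumes "\<And>b. b \<in> B \<Longrightarrow> br x b \<in> span B" "v \<in> span B"
  shows "br x v \<in> span B"
  using assms(2)
proof (induction rule: span_induct_alt)
  case base
  then show ?case by (simp add: br_zero span_zero)
next
  case (step c u v)
  then show ?case using assms(1) by (simp add: br_add br_scale span_add span_scale)
qed

text \<open>The trace of ad x ad y - ad y ad x on the stable space \<open>span B\<close> is 0, and
  [x, y] is diagonal there. Estimates of such eigenvalue sums take the place of sl2 representation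
  theory in this section.\<close>

lemma commutator_trace_zero:
  assumes B: "independent B"
    and st: "\<And>b. b \<in> B \<Longrightarrow> br x b \<in> span B" "\<And>b. b \<in> B \<Longrightarrow> br y b \<in> span B"
    and eig: "\<And>b. b \<in> B \<Longrightarrow> br (br x y) b = m b \<odot> b"
  shows "(\<Sum>b\<in>B. m b) = 0"
proof -
  have fin: "finite B" by (rule finite_independent[OF B])
  have "m b = representation B (br x (br y b)) b - representation B (br y (br x b)) b" if b: "b \<in> B" for b
  proof -
    have "m b = representation B (br (br x y) b) b"
      using b B eig by (simp add: representation_scale span_base representation_basis)
    also have "\<dots> = representation B (br x (br y b)) b - representation B (br y (br x b)) b"
      using b st by (simp add: br_jacobi representation_diff[OF B] span_ad_stable)
    finally show ?thesis .
  qed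
  then have "(\<Sum>b\<in>B. m b) = trace_on B (\<lambda>z. br x (br y z)) - trace_on B (\<lambda>z. br y (br x z))"
    by (simp add: trace_on_def sum_subtractf)
  also have "trace_on B (\<lambda>z. br x (br y z)) = trace_on B (\<lambda>z. br y (br x z))"
    by (rule trace_on_commute[OF B fin ad_linear ad_linear]) (fact st)+
  finally show ?thesis by simp
qed

lemma rep_span_subset:
  assumes "v \<in> span B" "B \<subseteq> wb" "rep v b \<noteq> 0"
  shows "b \<in> B"
  using representation_extend[OF wb_independent assms(1,2)] assms(3) representation_ne_zero by metis

end

context lie_simple_roots
begin

text \<open>A vector of weight - \<beta> pairing nontrivially with x can be rescaled so that [x, y]
  becomes the coroot, on which \<beta> takes the value 2. The condition on the norm is supplied
  later by \<open>root_norm_nonzero\<close>.\<close>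

lemma sl2_triple_exists:
  assumes \<beta>: "\<beta> \<in> roots L H" and nz: "fm \<beta> \<beta> \<noteq> 0"
  obtains x y where "x \<in> wb" "wt x = \<beta>" "y \<in> root_space L H (- \<beta>)" "y \<noteq> 0"
    "br x y = (2 / fm \<beta> \<beta>) \<odot> tv \<beta>"
proof -
  obtain x where x: "x \<in> wb" "wt x = \<beta>" using root_witness[OF \<beta>] by blast
  have x\<beta>: "x \<in> root_space L H \<beta>" using wt_root_space[OF x(1)] x(2) by simp
  obtain b where b: "b \<in> wb" "wt b = - \<beta>" "killing L x b \<noteq> 0"
    using root_space_pairing[OF x\<beta> root_dual[OF \<beta>] wb_nonzero[OF x(1)]] by blast
  define y where "y = (2 / fm \<beta> \<beta> / killing L x b) \<odot> b"
  have "y \<in> root_space L H (- \<beta>)"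
    using wt_root_space[OF b(1)] b(2) by (simp add: y_def root_space_def br_scale mult.commute)
  moreover have "y \<noteq> 0" using nz b wb_nonzero by (simp add: y_def)
  moreover have "br x y = (2 / fm \<beta> \<beta>) \<odot> tv \<beta>"
    using br_opposite[OF x\<beta> \<open>y \<in> _\<close> root_dual[OF \<beta>]] b(3) by (simp add: y_def killing_scale)
  ultimately show thesis using that x by blast
qed

lemma coroot_eval:
  assumes "\<mu> \<in> cartan_dual L H" "\<beta> \<in> cartan_dual L H"
  shows "\<mu> ((2 / fm \<beta> \<beta>) \<odot> tv \<beta>) = 2 * fm \<mu> \<beta> / fm \<beta> \<beta>"
  using assms by (simp add: dual_scale tv_H form_eval)

lemma dual_uminus: "\<mu> \<in> cartan_dual L H \<Longrightarrow> - \<mu> \<in> cartan_dual L H"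
  by (auto simp: cartan_dual_def)

lemma form_uminus:
  assumes "\<mu> \<in> cartan_dual L H" "\<nu> \<in> cartan_dual L H"
  shows "fm (- \<mu>) \<nu> = - fm \<mu> \<nu>" "fm \<mu> (- \<nu>) = - fm \<mu> \<nu>"
  using assms form_sym[of \<mu> "- \<nu>"] form_sym[of \<mu> \<nu>] by (simp_all add: form_eval dual_uminus)

text \<open>The trace of \<open>[x, y]\<close> on \<open>\<complex>y \<oplus> \<complex>[x, y] \<oplus> (sum of the root spaces of the positive multiples of \<beta>)\<close>
  vanishes; it is \<open>- 2 + \<Sum> 2k dim\<close>.\<close>

lemma root_multiples_unique:
  assumes \<beta>: "\<beta> \<in> roots L H" and nz: "fm \<beta> \<beta> \<noteq> 0"
  shows "\<exists>x\<in>wb. wt x = \<beta> \<and> {b \<in> wb. \<exists>k\<ge>1. wt b = (\<lambda>h. of_nat k * \<beta> h)} = {x}"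
proof -
  note \<beta>d = root_dual[OF \<beta>]
  obtain x y where x: "x \<in> wb" "wt x = \<beta>" and y: "y \<in> root_space L H (- \<beta>)" "y \<noteq> 0"
    and xy: "br x y = (2 / fm \<beta> \<beta>) \<odot> tv \<beta>"
    using sl2_triple_exists[OF \<beta> nz] .
  define t where "t = br x y"
  have tH: "t \<in> H" unfolding t_def xy by (intro subspace_scale[OF H_subspace] tv_H \<beta>d)
  have \<beta>t: "\<beta> t = 2" using coroot_eval[OF \<beta>d \<beta>d] nz by (simp add: t_def xy)
  have t0: "t \<noteq> 0" using \<beta>t dual_scale[OF \<beta>d tH, of 0] by auto
  have x\<beta>: "x \<in> root_space L H \<beta>" using wt_root_space[OF x(1)] x(2) by simp
  have tt: "t \<in> root_space L H (\<lambda>_. 0)" using tH root_space_0 by simp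
  let ?B1 = "{b \<in> wb. \<exists>k\<ge>1. wt b = (\<lambda>h. of_nat k * \<beta> h)}"
  let ?B0 = "insert y (insert t ?B1)"
  have B1: "finite ?B1" "independent ?B1" "?B1 \<subseteq> wb"
    using wb_finite independent_mono[OF wb_independent, of ?B1] by auto
  have dual0: "(\<lambda>_. 0) \<in> cartan_dual L H" by (simp add: cartan_dual_def)
  \<comment> \<open>On a multiple k\<beta> the coroot t has the eigenvalue 2k > 0, never 0 or - 2,
    the eigenvalues of t and y. This separates the three pieces and makes ?B0 independent.\<close>
  have wt_t: "wt b t \<noteq> 0 \<and> wt b t \<noteq> - 2" if b: "b \<in> ?B1" for b
  proof -
    obtain k :: nat where k: "k \<ge> 1" "wt b = (\<lambda>h. of_nat k * \<beta> h)" using b by blast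
    have "complex_of_nat k * 2 = of_nat (k * 2)" by simp
    moreover have "complex_of_nat (k * 2) \<noteq> - 2"
    proof
      assume "complex_of_nat (k * 2) = - 2"
      then have "complex_of_nat (k * 2 + 2) = 0" by simp
      then show False unfolding of_nat_eq_0_iff by simp
    qed
    ultimately show ?thesis using k \<beta>t by simp
  qed
  have rep_t: "rep t b = 0" if "wt b t \<noteq> 0" for b
  proof (rule ccontr)
    assume "rep t b \<noteq> 0"
    then have "wt b = (\<lambda>_. 0)" using rep_root_space[OF tt dual0] by blast
    then show False using that by simp
  qed
  have rep_y: "rep y b = 0" if "wt b t \<noteq> - 2" for b
  proof (rule ccontr)
    assume "rep y b \<noteq> 0"
    then have "wt b = - \<beta>" using rep_root_space[OF y(1) dual_uminus[OF \<beta>d]] by blast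
    then show False using that \<beta>t by simp
  qed
  have t_notin: "t \<notin> span ?B1"
  proof
    assume *: "t \<in> span ?B1"
    have "rep t b = 0" for b
      using rep_span_subset[OF * B1(3), of b] rep_t[of b] wt_t[of b] by blast
    then show False using rep_expand[of t] t0 by simp
  qed
  have y_notin: "y \<notin> span (insert t ?B1)"
  proof
    assume "y \<in> span (insert t ?B1)"
    then obtain a where a: "y - a \<odot> t \<in> span ?B1" unfolding span_breakdown_eq by blast
    have rep_d: "rep (y - a \<odot> t) b = rep y b - a * rep t b" for b
      using wb_independent wb_span by (simp add: representation_diff representation_scale)
    have "rep y b = 0" for b
    proof (cases "wt b t = - 2")
      case True
      then have "b \<notin> ?B1" "rep t b = 0" using wt_t[of b] rep_t[of b] by auto
      then show ?thesis using rep_span_subset[OF a B1(3), of b] rep_d[of b] by force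
    qed (rule rep_y)
    then show False using rep_expand[of y] y(2) by simp
  qed
  have ind: "independent ?B0"
    using t_notin y_notin B1(2) by (simp add: independent_insert)
  have inB1: "z \<in> span ?B0" if "z \<in> root_space L H (\<lambda>h. of_nat k * \<beta> h)" "k \<ge> 1" for z k
  proof -
    have "(\<lambda>h. of_nat k * \<beta> h) \<in> cartan_dual L H"
      using \<beta>d by (auto simp: cartan_dual_def distrib_left)
    then have "z \<in> span {b \<in> wb. wt b = (\<lambda>h. of_nat k * \<beta> h)}" using root_space_span that(1) by blast
    moreover have "{b \<in> wb. wt b = (\<lambda>h. of_nat k * \<beta> h)} \<subseteq> ?B0" using that(2) by blast
    ultimately show ?thesis using span_mono by blast
  qed
  \<comment> \<open>x moves y to t, t to a multiple of x, and the root space of k\<beta> to that of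
    (k + 1)\<beta>. In the other direction the space ends at y, because [y, y] = 0.\<close>
  have x_st: "br x b \<in> span ?B0" if b: "b \<in> ?B0" for b
  proof -
    consider "b = y" | "b = t" | "b \<in> ?B1" using b by blast
    then show ?thesis
    proof cases
      case 1
      then show ?thesis using span_base[of t ?B0] by (simp add: t_def)
    next
      case 2
      have "br x t = - (\<beta> t \<odot> x)" using br_anticomm[of x t] x\<beta> tH by (simp add: root_space_def)
      then show ?thesis unfolding 2
        using x x\<beta> inB1[of x 1] by (simp add: span_neg span_scale)
    next
      case 3
      then obtain k :: nat where k: "k \<ge> 1" "wt b = (\<lambda>h. of_nat k * \<beta> h)" by blast
      have "b \<in> root_space L H (\<lambda>h. of_nat k * \<beta> h)" using wt_root_space[of b] 3 k by simp
      from br_root_space[OF x\<beta> this] have "br x b \<in> root_space L H (\<lambda>h. of_nat (Suc k) * \<beta> h)"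
        by (simp add: distrib_right)
      then show ?thesis by (rule inB1) simp
    qed
  qed
  have y_st: "br y b \<in> span ?B0" if b: "b \<in> ?B0" for b
  proof -
    consider "b = y" | "b = t" | "b \<in> ?B1" using b by blast
    then show ?thesis
    proof cases
      case 1
      then show ?thesis by (simp add: br_self span_zero)
    next
      case 2
      have "br y t = \<beta> t \<odot> y" using br_anticomm[of y t] y(1) tH by (simp add: root_space_def scale_minus_left)
      then show ?thesis unfolding 2 by (simp add: span_scale span_base)
    next
      case 3
      then obtain k :: nat where k: "k \<ge> 1" "wt b = (\<lambda>h. of_nat k * \<beta> h)" by blast
      have bk: "b \<in> root_space L H (\<lambda>h. of_nat k * \<beta> h)" using wt_root_space[of b] 3 k by simp
      show ?thesis
      proof (cases "k = 1")
        case True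
        then have "br b y = killing L b y \<odot> tv \<beta>" using bk by (intro br_opposite y(1) \<beta>d) simp
        moreover have "tv \<beta> = (fm \<beta> \<beta> / 2) \<odot> t" using nz by (simp add: t_def xy)
        ultimately have "br y b = - ((killing L b y * (fm \<beta> \<beta> / 2)) \<odot> t)"
          using br_anticomm[of y b] by simp
        then show ?thesis by (simp add: span_neg span_scale span_base)
      next
        case False
        have "br y b \<in> root_space L H (\<lambda>h. (- \<beta>) h + of_nat k * \<beta> h)" by (rule br_root_space[OF y(1) bk])
        also have "(\<lambda>h. (- \<beta>) h + of_nat k * \<beta> h) = (\<lambda>h. of_nat (k - 1) * \<beta> h)"
          using k(1) by (auto simp: of_nat_diff left_diff_distrib)
        finally show ?thesis using inB1[of _ "k - 1"] False k(1) by simp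
      qed
    qed
  qed
  define m where "m b = (if b = y then - 2 else if b = t then 0 else wt b t)" for b
  have yt: "y \<noteq> t" "y \<notin> ?B1" "t \<notin> ?B1"
    using t_notin y_notin span_base[of y "insert t ?B1"] span_base[of t ?B1] by blast+
  have eig: "br t b = m b \<odot> b" if b: "b \<in> ?B0" for b
  proof -
    consider "b = y" | "b = t" | "b \<in> wb" "b \<noteq> y" "b \<noteq> t" using b yt by blast
    then show ?thesis
    proof cases
      case 1
      have "br t y = (- \<beta>) t \<odot> y" using y(1) tH unfolding root_space_def by blast
      then show ?thesis using 1 \<beta>t by (simp add: m_def)
    qed (simp_all add: m_def br_self wt_eigen tH yt(1)[symmetric])
  qed
  have "(\<Sum>b\<in>?B0. m b) = 0"
    using x_st y_st eig by (intro commutator_trace_zero[OF ind, of x y]) (auto simp: t_def)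
  also have "(\<Sum>b\<in>?B0. m b) = - 2 + (\<Sum>b\<in>?B1. m b)"
    using yt B1(1) by (simp add: m_def)
  also have "(\<Sum>b\<in>?B1. m b) = (\<Sum>b\<in>?B1. wt b t)"
    using yt by (intro sum.cong) (auto simp: m_def)
  finally have sum2: "(\<Sum>b\<in>?B1. wt b t) = 2" by (simp add: eq_neg_iff_add_eq_0[symmetric])
  have "\<forall>b\<in>?B1. \<exists>k. k \<ge> 1 \<and> wt b = (\<lambda>h. of_nat k * \<beta> h)" by blast
  from bchoice[OF this] obtain kk :: "'g \<Rightarrow> nat"
    where kk: "\<And>b. b \<in> ?B1 \<Longrightarrow> kk b \<ge> 1 \<and> wt b = (\<lambda>h. of_nat (kk b) * \<beta> h)"
    by blast
  \<comment> \<open>The trace identity now says that the multiples k, counted with dimension, add up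
    to 1. As all k are at least 1, x is the only vector.\<close>
  have "complex_of_nat (\<Sum>b\<in>?B1. kk b * 2) = (\<Sum>b\<in>?B1. wt b t)"
    unfolding of_nat_sum
  proof (intro sum.cong refl)
    fix b assume "b \<in> ?B1"
    then have "wt b = (\<lambda>h. of_nat (kk b) * \<beta> h)" using kk by blast
    from fun_cong[OF this, of t] show "complex_of_nat (kk b * 2) = wt b t" using \<beta>t by simp
  qed
  also have "\<dots> = of_nat 2" using sum2 by simp
  finally have "(\<Sum>b\<in>?B1. kk b * 2) = 2" unfolding of_nat_eq_iff .
  then have "(\<Sum>b\<in>?B1. kk b) = 1" unfolding sum_distrib_right[symmetric] by simp
  moreover have "(\<Sum>b\<in>?B1. 1) \<le> (\<Sum>b\<in>?B1. kk b)" by (intro sum_mono) (use kk in blast)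
  ultimately have "card ?B1 \<le> 1" unfolding card_eq_sum by linarith
  then have "\<forall>a\<in>?B1. \<forall>b\<in>?B1. a = b"
    using card_le_Suc0_iff_eq[OF B1(1)] by simp
  moreover have "wt x = (\<lambda>h. of_nat 1 * \<beta> h)" using x(2) by simp
  then have "x \<in> ?B1" using x(1) by blast
  ultimately have "?B1 = {x}" by blast
  then show ?thesis using x by blast
qed

lemma root_space_dim_one:
  assumes "wt b \<in> roots L H" "fm (wt b) (wt b) \<noteq> 0" "b \<in> wb" "b' \<in> wb" "wt b' = wt b"
  shows "b' = b"
proof -
  obtain x where x: "{c \<in> wb. \<exists>k\<ge>1. wt c = (\<lambda>h. of_nat k * wt b h)} = {x}"
    using root_multiples_unique[OF assms(1,2)] by blast
  have "c \<in> {x}" if c: "c \<in> wb" "wt c = wt b" for c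
  proof -
    have "wt c = (\<lambda>h. of_nat 1 * wt b h)" using c(2) by simp
    then show ?thesis unfolding x[symmetric] using c(1) by blast
  qed
  from this[of b] this[of b'] show ?thesis using assms by simp
qed

lemma nat_multiple_root:
  assumes "\<beta> \<in> roots L H" "fm \<beta> \<beta> \<noteq> 0" "(\<lambda>h. of_nat k * \<beta> h) \<in> roots L H"
  shows "k = 1"
proof -
  obtain x where x: "wt x = \<beta>" "{c \<in> wb. \<exists>k\<ge>1. wt c = (\<lambda>h. of_nat k * \<beta> h)} = {x}"
    using root_multiples_unique[OF assms(1,2)] by blast
  have "k \<noteq> 0" using root_nonzero[OF assms(3)] by (cases "k = 0") simp_all
  obtain b where b: "b \<in> wb" "wt b = (\<lambda>h. of_nat k * \<beta> h)" using root_witness[OF assms(3)] by blast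
  have "1 \<le> k" using \<open>k \<noteq> 0\<close> by simp
  then have "b \<in> {x}" unfolding x(2)[symmetric] using b by blast
  then have eq: "(\<lambda>h. of_nat k * \<beta> h) = \<beta>" using b x by simp
  obtain h where "\<beta> h \<noteq> 0" using root_nonzero[OF assms(1)] by auto
  moreover have "of_nat k * \<beta> h = \<beta> h" using fun_cong[OF eq, of h] by simp
  ultimately show ?thesis by simp
qed

lemma int_multiple_root:
  assumes "\<beta> \<in> roots L H" "fm \<beta> \<beta> \<noteq> 0" "(\<lambda>h. of_int k * \<beta> h) \<in> roots L H"
  shows "k = 1 \<or> k = - 1"
proof (cases "k \<ge> 0")
  case True
  then obtain n where "k = int n" using nonneg_int_cases by blast
  then show ?thesis using nat_multiple_root[OF assms(1,2), of n] assms(3) by simp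
next
  case False
  define n where "n = nat (- k)"
  have "k = - int n" using False by (simp add: n_def)
  moreover have "- (\<lambda>h. of_int k * \<beta> h) \<in> roots L H" by (rule root_uminus[OF assms(3)])
  ultimately show ?thesis using nat_multiple_root[OF assms(1,2), of n] by (simp add: fun_Compl_def)
qed

text \<open>If \<open>\<beta> - j\<gamma>\<close> were the first missing member of the string, the root spaces before it would be
  stable under the triple of \<open>\<gamma>\<close>, but the trace of the coroot on them is at least \<open>j(m - j + 1)\<close>.\<close>

lemma root_string:
  assumes \<beta>: "\<beta> \<in> roots L H" and \<gamma>: "\<gamma> \<in> roots L H"
    and nz: "\<And>\<delta>. \<delta> \<in> roots L H \<Longrightarrow> fm \<delta> \<delta> \<noteq> 0"
    and ne: "\<beta> \<noteq> \<gamma>" "\<beta> \<noteq> - \<gamma>"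
    and m: "2 * fm \<beta> \<gamma> / fm \<gamma> \<gamma> = of_nat m"
  shows "(\<lambda>h. \<beta> h - of_nat m * \<gamma> h) \<in> roots L H"
proof (rule ccontr)
  assume neg: "\<not> ?thesis"
  note \<beta>d = root_dual[OF \<beta>] and \<gamma>d = root_dual[OF \<gamma>]
  define s where "s k = (\<lambda>h. \<beta> h - of_int k * \<gamma> h)" for k :: int
  define j where "j = (LEAST j. s (int j) \<notin> roots L H)"
  have sm: "s (int m) \<notin> roots L H" using neg by (simp add: s_def)
  have sj: "s (int j) \<notin> roots L H" using LeastI[of "\<lambda>j. s (int j) \<notin> roots L H", OF sm] by (simp add: j_def)
  have jm: "j \<le> m" using Least_le[of "\<lambda>j. s (int j) \<notin> roots L H", OF sm] by (simp add: j_def)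
  have below: "s (int k) \<in> roots L H" if "k < j" for k
    using not_less_Least[of k "\<lambda>j. s (int j) \<notin> roots L H"] that by (auto simp: j_def)
  have "s 0 = \<beta>" by (simp add: s_def)
  then have j0: "0 < j" using sj \<beta> by (cases j) auto
  have sd: "s k \<in> cartan_dual L H" for k
    using \<beta>d \<gamma>d by (auto simp: s_def cartan_dual_def algebra_simps)
  \<comment> \<open>A vanishing member would make \<beta> an integral multiple of \<gamma>, so
    \<beta> = \<gamma> or \<beta> = - \<gamma>, which is excluded. Hence each weight of the string
    that occurs is a root.\<close>
  have s0: "s k \<noteq> (\<lambda>_. 0)" for k
  proof
    assume "s k = (\<lambda>_. 0)"
    then have eq: "\<beta> = (\<lambda>h. of_int k * \<gamma> h)" by (auto simp: s_def fun_eq_iff)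
    then have "k = 1 \<or> k = - 1" using int_multiple_root[OF \<gamma> nz[OF \<gamma>], of k] \<beta> by simp
    then show False using ne eq by (auto simp: fun_eq_iff)
  qed
  obtain x y where x: "x \<in> wb" "wt x = \<gamma>" and y: "y \<in> root_space L H (- \<gamma>)"
    and xy: "br x y = (2 / fm \<gamma> \<gamma>) \<odot> tv \<gamma>"
    using sl2_triple_exists[OF \<gamma> nz[OF \<gamma>]] .
  have x\<gamma>: "x \<in> root_space L H \<gamma>" using wt_root_space[OF x(1)] x(2) by simp
  define t where "t = br x y"
  have tH: "t \<in> H" unfolding t_def xy by (intro subspace_scale[OF H_subspace] tv_H \<gamma>d)
  have "\<gamma> t = 2" "\<beta> t = of_nat m"
    using coroot_eval[OF \<gamma>d \<gamma>d] coroot_eval[OF \<beta>d \<gamma>d] nz[OF \<gamma>] m by (simp_all add: t_def xy)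
  then have st: "s k t = of_int (int m - 2 * k)" for k by (simp add: s_def mult.commute)
  \<comment> \<open>k is bounded only from above, so the members with negative k are included: x
    lowers k and stays inside, y raises k and meets the gap at j.\<close>
  define B where "B = {b \<in> wb. \<exists>k<int j. wt b = s k}"
  have B: "B \<subseteq> wb" "independent B" "finite B"
    using independent_mono[OF wb_independent, of B] wb_finite by (auto simp: B_def)
  have inB: "z \<in> span B" if z: "z \<in> root_space L H (s k)" "k \<le> int j" for z k
  proof (cases "k = int j")
    case True
    then have "z = 0"
      using z(1) sj sd[of k] s0[of k] root_space_weight[OF z(1) sd] root_space_weight_mem by metis
    then show ?thesis by (simp add: span_zero)
  next
    case False
    have "z \<in> span {b \<in> wb. wt b = s k}" by (rule root_space_span[OF z(1) sd])
    moreover have "{b \<in> wb. wt b = s k} \<subseteq> B" using z(2) False by (auto simp: B_def intro!: exI[of _ k])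
    ultimately show ?thesis using span_mono by blast
  qed
  have "(\<Sum>b\<in>B. wt b t) = 0"
  proof (rule commutator_trace_zero[OF B(2), of x y])
    fix b assume "b \<in> B"
    then obtain k where k: "b \<in> wb" "k < int j" "wt b = s k" by (auto simp: B_def)
    have bk: "b \<in> root_space L H (s k)" using wt_root_space[OF k(1)] k(3) by simp
    have "(\<lambda>h. \<gamma> h + s k h) = s (k - 1)" "(\<lambda>h. (- \<gamma>) h + s k h) = s (k + 1)"
      by (auto simp: s_def algebra_simps)
    then have "br x b \<in> root_space L H (s (k - 1))" "br y b \<in> root_space L H (s (k + 1))"
      using br_root_space[OF x\<gamma> bk] br_root_space[OF y bk] by simp_all
    then show "br x b \<in> span B" "br y b \<in> span B" using inB k(2) by auto
    show "br (br x y) b = wt b t \<odot> b" using wt_eigen[OF k(1) tH] by (simp add: t_def)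
  qed
  moreover have "\<forall>b\<in>B. \<exists>k<int j. wt b = s k" by (auto simp: B_def)
  then obtain kk where kk: "\<And>b. b \<in> B \<Longrightarrow> kk b < int j \<and> wt b = s (kk b)" by metis
  have "complex_of_int (\<Sum>b\<in>B. int m - 2 * kk b) = (\<Sum>b\<in>B. wt b t)"
    unfolding of_int_sum using kk st by (intro sum.cong) simp_all
  ultimately have sum0: "(\<Sum>b\<in>B. int m - 2 * kk b) = 0" by (metis of_int_eq_0_iff)
  have "inj_on kk B"
  proof (rule inj_onI)
    fix b b' assume *: "b \<in> B" "b' \<in> B" "kk b = kk b'"
    then have "wt b' = wt b" using kk[of b] kk[of b'] by simp
    moreover have "wt b \<in> roots L H"
      using * B(1) kk[of b] s0 root_space_weight_mem by (metis subsetD)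
    ultimately show "b = b'" using root_space_dim_one[of b b'] nz * B(1) by blast
  qed
  then have "(\<Sum>b\<in>B. int m - 2 * kk b) = (\<Sum>k\<in>kk ` B. int m - 2 * k)"
    by (simp add: sum.reindex)
  moreover have sub: "{0..<int j} \<subseteq> kk ` B"
  proof
    fix k assume k: "k \<in> {0..<int j}"
    then obtain i where i: "k = int i" "i < j" by (metis atLeastLessThan_iff nonneg_int_cases of_nat_less_iff)
    then have "s k \<in> roots L H" using below by blast
    then obtain b where b: "b \<in> wb" "wt b = s k" using root_witness by blast
    then have bB: "b \<in> B" using k by (auto simp: B_def)
    have "s (kk b) t = s k t" using kk[OF bB] b by simp
    then have "kk b = k" unfolding st of_int_eq_iff by simp
    then show "k \<in> kk ` B" using bB by blast
  qed
  \<comment> \<open>The remaining indices are negative, and their terms m - 2k are positive.\<close>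
  moreover have "(\<Sum>k\<in>{0..<int j}. int m - 2 * k) \<le> (\<Sum>k\<in>kk ` B. int m - 2 * k)"
    using B(3) sub kk by (intro sum_mono2) force+
  moreover have "(\<Sum>k\<in>{0..<int j}. int m - 2 * k) = int j * (int m - int j + 1)" for j
  proof (induction j)
    case (Suc j)
    have "{0..<int (Suc j)} = insert (int j) {0..<int j}" by auto
    then show ?case using Suc by (simp add: algebra_simps)
  qed simp
  ultimately have "int j * (int m - int j + 1) \<le> 0" using sum0 by simp
  moreover have "int j * (int m - int j + 1) > 0" using j0 jm by simp
  ultimately show False by simp
qed

text \<open>The cases \<beta> = \<gamma> and \<beta> = - \<gamma> are separate because their strings
  pass through 0. A negative Cartan number becomes positive when \<gamma> is replaced by - \<gamma>,
  which gives the same reflection.\<close>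

lemma root_string_signed:
  assumes \<beta>: "\<beta> \<in> roots L H" and \<gamma>: "\<gamma> \<in> roots L H"
    and nz: "\<And>\<delta>. \<delta> \<in> roots L H \<Longrightarrow> fm \<delta> \<delta> \<noteq> 0"
    and n: "2 * fm \<beta> \<gamma> / fm \<gamma> \<gamma> = of_int n"
  shows "reflection L H \<gamma> \<beta> \<in> roots L H"
proof -
  note \<beta>d = root_dual[OF \<beta>] and \<gamma>d = root_dual[OF \<gamma>]
  have refl: "reflection L H \<gamma> \<beta> = (\<lambda>h. \<beta> h - of_int n * \<gamma> h)"
    using n by (simp add: reflection_def)
  consider "\<beta> = \<gamma>" | "\<beta> = - \<gamma>" | "\<beta> \<noteq> \<gamma>" "\<beta> \<noteq> - \<gamma>" "n \<ge> 0" | "\<beta> \<noteq> \<gamma>" "\<beta> \<noteq> - \<gamma>" "n < 0"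
    by linarith
  then show ?thesis
  proof cases
    case 1
    then have "reflection L H \<gamma> \<beta> = - \<gamma>" using nz[OF \<gamma>] by (auto simp: reflection_def)
    then show ?thesis using root_uminus[OF \<gamma>] by simp
  next
    case 2
    then have "reflection L H \<gamma> \<beta> = \<gamma>"
      using nz[OF \<gamma>] form_uminus(1)[OF \<gamma>d \<gamma>d] by (auto simp: reflection_def)
    then show ?thesis using \<gamma> by simp
  next
    case 3
    then have "of_nat (nat n) = complex_of_int n" by simp
    then show ?thesis using root_string[OF \<beta> \<gamma> nz 3(1,2), of "nat n"] n refl by simp
  next
    case 4
    have n': "of_nat (nat (- n)) = - complex_of_int n" using 4 by simp
    have "2 * fm \<beta> (- \<gamma>) / fm (- \<gamma>) (- \<gamma>) = - of_int n"
      using n by (simp add: form_uminus \<beta>d \<gamma>d dual_uminus)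
    then have "2 * fm \<beta> (- \<gamma>) / fm (- \<gamma>) (- \<gamma>) = of_nat (nat (- n))" using n' by simp
    moreover have "\<beta> \<noteq> - (- \<gamma>)" using 4(1) by (auto simp: fun_eq_iff)
    ultimately show ?thesis
      using root_string[OF \<beta> root_uminus[OF \<gamma>] nz 4(2), of "nat (- n)"] refl n' by simp
  qed
qed

end

section \<open>Alternating reflections on a Dynkin diagram\<close>

abbreviation nodes :: "dynkin_type \<Rightarrow> nat set" where
  "nodes X \<equiv> {1..type_rank X}"

definition nbr_sum :: "dynkin_type \<Rightarrow> (nat \<Rightarrow> 'a::comm_ring_1) \<Rightarrow> nat \<Rightarrow> 'a" where
  "nbr_sum X c i = (\<Sum>j\<in>{j \<in> nodes X. dynkin_adjacent X i j}. c j)"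

text \<open>\<open>refl_prod\<close> in coordinates with respect to the simple roots, for \<open>J\<close> without adjacent nodes.\<close>

definition refl_step :: "dynkin_type \<Rightarrow> nat set \<Rightarrow> (nat \<Rightarrow> 'a::comm_ring_1) \<Rightarrow> nat \<Rightarrow> 'a" where
  "refl_step X J c = (\<lambda>i. if i \<in> J then nbr_sum X c i - c i else c i)"

definition two_coloring :: "dynkin_type \<Rightarrow> nat set \<Rightarrow> nat set \<Rightarrow> bool" where
  "two_coloring X J1 J2 \<longleftrightarrow> J1 \<union> J2 = nodes X \<and> J1 \<inter> J2 = {} \<and>
     (\<forall>i\<in>J1. \<forall>j\<in>J1. \<not> dynkin_adjacent X i j) \<and> (\<forall>i\<in>J2. \<forall>j\<in>J2. \<not> dynkin_adjacent X i j)"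

definition unit_vec :: "nat \<Rightarrow> nat \<Rightarrow> 'a::comm_ring_1" where
  "unit_vec j i = (if i = j then 1 else 0)"

definition cox_step :: "dynkin_type \<Rightarrow> nat set \<Rightarrow> nat set \<Rightarrow> (nat \<Rightarrow> 'a::comm_ring_1) \<Rightarrow> nat \<Rightarrow> 'a" where
  "cox_step X J1 J2 c = refl_step X J2 (refl_step X J1 c)"

text \<open>Half steps of the Coxeter element. J1 acts first, in accordance with \<sigma> = \<tau>2
  \<tau>1, so the terms of even index are given by its powers
  (\<open>alt_steps_even\<close>).\<close>

primrec alt_steps :: "dynkin_type \<Rightarrow> nat set \<Rightarrow> nat set \<Rightarrow> (nat \<Rightarrow> 'a::comm_ring_1) \<Rightarrow> nat \<Rightarrow> nat \<Rightarrow> 'a" where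
  "alt_steps X J1 J2 c 0 = c"
| "alt_steps X J1 J2 c (Suc t) = refl_step X (if even t then J1 else J2) (alt_steps X J1 J2 c t)"

lemma adjacent_sym: "dynkin_adjacent X i j \<longleftrightarrow> dynkin_adjacent X j i"
  by (auto simp: dynkin_adjacent_def)

lemma adjacent_irrefl: "admissible_type X \<Longrightarrow> \<not> dynkin_adjacent X i i"
  by (cases X) (auto simp: dynkin_adjacent_def)

lemma alt_steps_even: "alt_steps X J1 J2 c (2 * n) = (cox_step X J1 J2 ^^ n) c"
  by (induction n) (simp_all add: cox_step_def)

lemma refl_step_neighbours:
  assumes "\<forall>i\<in>J. \<forall>j\<in>J. \<not> dynkin_adjacent X i j" "i \<in> J"
  shows "nbr_sum X (refl_step X J c) i = nbr_sum X c i"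
  unfolding nbr_sum_def using assms by (intro sum.cong) (auto simp: refl_step_def)

lemma refl_step_involutive:
  assumes "\<forall>i\<in>J. \<forall>j\<in>J. \<not> dynkin_adjacent X i j"
  shows "refl_step X J (refl_step X J c) = c"
proof
  fix i
  show "refl_step X J (refl_step X J c) i = c i"
  proof (cases "i \<in> J")
    case True
    then have "refl_step X J (refl_step X J c) i = nbr_sum X c i - refl_step X J c i"
      using refl_step_neighbours[OF assms True, of c] unfolding refl_step_def[of X J "refl_step X J c"] by simp
    then show ?thesis using True by (simp add: refl_step_def)
  qed (simp add: refl_step_def)
qed

lemma refl_step_uminus: "refl_step X J (\<lambda>i. - c i) = (\<lambda>i. - refl_step X J c i)"
  by (auto simp: refl_step_def nbr_sum_def sum_negf)

lemma refl_step_unit: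
  assumes "\<forall>i\<in>J. \<forall>j\<in>J. \<not> dynkin_adjacent X i j" "s \<in> J"
  shows "refl_step X J (unit_vec s) = (\<lambda>i. - unit_vec s i)"
proof
  fix i
  have "nbr_sum X (unit_vec s) i = 0" if "i \<in> J"
    unfolding nbr_sum_def using assms that by (intro sum.neutral) (auto simp: unit_vec_def)
  then show "refl_step X J (unit_vec s) i = - unit_vec s i"
    using assms(2) by (auto simp: refl_step_def unit_vec_def)
qed

text \<open>What the argument needs about a type: \<open>\<theta>\<close> will turn out to be the highest root, \<open>s\<close> the special
  node, \<open>g\<close> half the Coxeter number, and \<open>\<pi>\<close> the diagram automorphism \<open>- w\<^sub>0\<close>.\<close>

definition coxeter_data ::
    "dynkin_type \<Rightarrow> nat \<Rightarrow> nat set \<Rightarrow> nat set \<Rightarrow> (nat \<Rightarrow> int) \<Rightarrow> nat \<Rightarrow> (nat \<Rightarrow> nat) \<Rightarrow> bool" where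
  "coxeter_data X g J1 J2 \<theta> s \<pi> \<longleftrightarrow>
     two_coloring X J1 J2 \<and> 1 \<le> g \<and>
     (\<forall>i. special_node X i \<longrightarrow> i = s) \<and> s \<in> nodes X \<and> (s \<in> J1 \<longleftrightarrow> odd g) \<and>
     (\<forall>i. 0 \<le> \<theta> i) \<and> (\<forall>i\<in>nodes X. nbr_sum X \<theta> i \<le> 2 * \<theta> i) \<and>
     (\<forall>i\<in>J2. nbr_sum X \<theta> i = 2 * \<theta> i) \<and> (\<exists>i\<in>J1. nbr_sum X \<theta> i \<noteq> 2 * \<theta> i) \<and>
     (\<forall>k. 1 \<le> k \<and> k < g \<longrightarrow> (\<forall>i. 0 \<le> alt_steps X J1 J2 \<theta> k i) \<and> alt_steps X J1 J2 \<theta> k \<noteq> \<theta>) \<and>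
     alt_steps X J1 J2 \<theta> (g - 1) = unit_vec s \<and>
     (\<forall>j\<in>nodes X. \<pi> j \<in> nodes X \<and> \<pi> (\<pi> j) = j \<and> (\<pi> j \<in> J1 \<longleftrightarrow> j \<in> J1) \<and>
        (cox_step X J1 J2 ^^ g) (unit_vec j) = (\<lambda>i. - unit_vec (\<pi> j) i :: int))"

subsection \<open>Consequences for the orbit of the highest root\<close>

text \<open>The parity condition on s puts it into the class updated in step g, which therefore just
  changes the sign of \<open>unit_vec s\<close>. Afterwards the steps leaving the indices g - 1 + j
  and g - 1 - j use the same class, as these indices have equal parity, and involutivity undoes one
  step after the other.\<close>

lemma coxeter_data_reversal:
  assumes D: "coxeter_data X g J1 J2 \<theta> s \<pi>" and "1 \<le> j" "j \<le> g"
  shows "alt_steps X J1 J2 \<theta> (g - 1 + j) = (\<lambda>i. - alt_steps X J1 J2 \<theta> (g - j) i)"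
  using assms(2,3)
proof (induction j rule: nat_induct_at_least)
  case base
  from D have s: "s \<in> (if even (g - 1) then J1 else J2)"
    by (auto simp: coxeter_data_def two_coloring_def)
  moreover have "\<forall>i\<in>(if even (g - 1) then J1 else J2). \<forall>j\<in>(if even (g - 1) then J1 else J2).
      \<not> dynkin_adjacent X i j"
    using D by (auto simp: coxeter_data_def two_coloring_def)
  ultimately have unit: "refl_step X (if even (g - 1) then J1 else J2) (unit_vec s) = (\<lambda>i. - unit_vec s i :: int)"
    by (intro refl_step_unit)
  have s0: "alt_steps X J1 J2 \<theta> (g - 1) = unit_vec s" using D unfolding coxeter_data_def by blast
  have "alt_steps X J1 J2 \<theta> (g - 1 + 1)
      = refl_step X (if even (g - 1) then J1 else J2) (alt_steps X J1 J2 \<theta> (g - 1))"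
    unfolding Suc_eq_plus1[symmetric] by (rule alt_steps.simps)
  then show ?case unfolding s0 unit .
next
  case (Suc j)
  let ?J = "if even (g - 1 + j) then J1 else J2"
  have J: "\<forall>i\<in>?J. \<forall>j\<in>?J. \<not> dynkin_adjacent X i j"
    using D by (auto simp: coxeter_data_def two_coloring_def)
  have "even (g - Suc j) \<longleftrightarrow> even (g - 1 + j)" using Suc by presburger
  then have "alt_steps X J1 J2 \<theta> (Suc (g - Suc j)) = refl_step X ?J (alt_steps X J1 J2 \<theta> (g - Suc j))" by simp
  moreover have "Suc (g - Suc j) = g - j" using Suc by simp
  ultimately have prev: "alt_steps X J1 J2 \<theta> (g - j) = refl_step X ?J (alt_steps X J1 J2 \<theta> (g - Suc j))" by simp
  have "alt_steps X J1 J2 \<theta> (g - 1 + Suc j) = refl_step X ?J (alt_steps X J1 J2 \<theta> (g - 1 + j))" by simp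
  also have "\<dots> = refl_step X ?J (\<lambda>i. - alt_steps X J1 J2 \<theta> (g - j) i)" using Suc by simp
  also have "\<dots> = (\<lambda>i. - alt_steps X J1 J2 \<theta> (g - Suc j) i)"
    unfolding refl_step_uminus prev refl_step_involutive[OF J] ..
  finally show ?case .
qed

lemma coxeter_data_nonzero:
  assumes "coxeter_data X g J1 J2 \<theta> s \<pi>"
  shows "\<exists>i. \<theta> i > 0"
proof (rule ccontr)
  assume "\<not> ?thesis"
  then have "\<theta> = (\<lambda>_. 0)" using assms by (auto simp: coxeter_data_def fun_eq_iff order.antisym not_less)
  then show False using assms by (auto simp: coxeter_data_def nbr_sum_def)
qed

text \<open>The reversal reaches - \<theta> already at index 2g - 1; the remaining update of J2
  fixes it, because \<theta> is orthogonal to the simple roots in J2.\<close>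

lemma coxeter_data_half_period:
  assumes D: "coxeter_data X g J1 J2 \<theta> s \<pi>"
  shows "alt_steps X J1 J2 \<theta> (2 * g) = (\<lambda>i. - \<theta> i)"
proof -
  have g: "1 \<le> g" using D by (simp add: coxeter_data_def)
  have eq: "2 * g = Suc (g - 1 + g)" and odd: "odd (g - 1 + g)" using g by presburger+
  have "alt_steps X J1 J2 \<theta> (2 * g) = refl_step X J2 (alt_steps X J1 J2 \<theta> (g - 1 + g))"
    by (simp only: eq alt_steps.simps odd if_False)
  also have "\<dots> = refl_step X J2 (\<lambda>i. - \<theta> i)" using coxeter_data_reversal[OF D g] by simp
  also have "\<dots> = (\<lambda>i. - \<theta> i)"
    unfolding refl_step_uminus using D by (auto simp: refl_step_def coxeter_data_def)
  finally show ?thesis .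
qed

text \<open>Before index g this is part of the data; from g on all coordinates are \<le> 0, while
  \<theta> has a positive one.\<close>

lemma coxeter_data_no_return:
  assumes D: "coxeter_data X g J1 J2 \<theta> s \<pi>" and k: "1 \<le> k" "k \<le> 2 * g"
  shows "alt_steps X J1 J2 \<theta> k \<noteq> \<theta>"
proof (cases "k < g")
  case True
  then show ?thesis using D k by (simp add: coxeter_data_def)
next
  case False
  have "alt_steps X J1 J2 \<theta> k i \<le> 0" for i
  proof (cases "k = 2 * g")
    case True
    then show ?thesis using coxeter_data_half_period[OF D] D by (simp add: coxeter_data_def)
  next
    case neq: False
    define j where "j = k - (g - 1)"
    have j: "1 \<le> j" "j \<le> g" "k = g - 1 + j" using False neq k by (auto simp: j_def)
    have "0 \<le> alt_steps X J1 J2 \<theta> (g - j) i"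
      using D j by (cases "g - j = 0") (auto simp: coxeter_data_def)
    then show ?thesis using coxeter_data_reversal[OF D j(1,2)] j(3) by simp
  qed
  then show ?thesis using coxeter_data_nonzero[OF D] by (metis not_less)
qed

subsection \<open>Connectedness\<close>

text \<open>Induction along the path; in type D node l hangs on l - 2, in type E node 2 hangs on 4.
  Connectedness serves twice: for the equal length of the simple roots and for the uniqueness of the
  two-colouring.\<close>

lemma dynkin_connected_from_1:
  assumes X: "admissible_type X"
    and P: "\<And>i j. i \<in> nodes X \<Longrightarrow> j \<in> nodes X \<Longrightarrow> dynkin_adjacent X i j \<Longrightarrow> P i \<Longrightarrow> P j"
    and "P 1" "b \<in> nodes X"
  shows "P b"
proof (cases X)
  case (TypeA l)
  have "1 \<le> b" "b \<le> l" using assms(4) TypeA by auto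
  then show ?thesis
  proof (induction b rule: nat_induct_at_least)
    case base
    then show ?case using assms(3) by simp
  next
    case (Suc n)
    then show ?case using P[of n "Suc n"] TypeA by (simp add: dynkin_adjacent_def)
  qed
next
  case (TypeD l)
  have l: "4 \<le> l" using X TypeD by simp
  have path: "P i" if "1 \<le> i" "i \<le> l - 1" for i
    using that
  proof (induction i rule: nat_induct_at_least)
    case base
    then show ?case using assms(3) by simp
  next
    case (Suc n)
    then show ?case using P[of n "Suc n"] TypeD by (simp add: dynkin_adjacent_def)
  qed
  show ?thesis
  proof (cases "b = l")
    case True
    then show ?thesis using P[of "l - 2" l] path[of "l - 2"] TypeD l by (simp add: dynkin_adjacent_def)
  next
    case False
    then show ?thesis using path assms(4) TypeD by auto
  qed
next
  case (TypeE l)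
  have l: "6 \<le> l" using X TypeE by auto
  have path: "P i" if "3 \<le> i" "i \<le> l" for i
    using that
  proof (induction i rule: nat_induct_at_least)
    case base
    then show ?case using assms(3) P[of 1 3] TypeE by (simp add: dynkin_adjacent_def)
  next
    case (Suc n)
    then show ?case using P[of n "Suc n"] TypeE by (simp add: dynkin_adjacent_def)
  qed
  moreover have "P 2" using P[of 4 2] path[of 4] TypeE l by (simp add: dynkin_adjacent_def)
  moreover have "b = 1 \<or> b = 2 \<or> 3 \<le> b" using assms(4) by auto
  ultimately show ?thesis using assms(3,4) TypeE by auto
qed

lemma dynkin_connected:
  assumes X: "admissible_type X"
    and P: "\<And>i j. i \<in> nodes X \<Longrightarrow> j \<in> nodes X \<Longrightarrow> dynkin_adjacent X i j \<Longrightarrow> P i \<Longrightarrow> P j"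
    and "P a" "a \<in> nodes X" "b \<in> nodes X"
  shows "P b"
proof -
  have "P 1"
  proof (rule ccontr)
    assume "\<not> P 1"
    have "\<not> P a"
    proof (rule dynkin_connected_from_1[OF X])
      fix i j assume "i \<in> nodes X" "j \<in> nodes X" "dynkin_adjacent X i j" "\<not> P i"
      then show "\<not> P j" using P[of j i] adjacent_sym by blast
    qed (fact \<open>\<not> P 1\<close> assms(4))+
    then show False using assms(3) by simp
  qed
  then show ?thesis using dynkin_connected_from_1[where P = P] X P assms(5) by blast
qed

text \<open>In a two-colouring the class changes across every edge, so agreement of two colourings
  spreads along edges.\<close>

lemma two_coloring_unique:
  assumes "admissible_type X" "two_coloring X I1 I2" "two_coloring X J1 J2" "a \<in> I1" "a \<in> J1"
  shows "I1 = J1" "I2 = J2"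
proof -
  have I: "I1 \<union> I2 = nodes X" "I1 \<inter> I2 = {}" and J: "J1 \<union> J2 = nodes X" "J1 \<inter> J2 = {}"
    using assms by (auto simp: two_coloring_def)
  have *: "b \<in> I1 \<longleftrightarrow> b \<in> J1" if b: "b \<in> nodes X" for b
  proof (rule dynkin_connected[OF assms(1), of "\<lambda>b. b \<in> I1 \<longleftrightarrow> b \<in> J1" a b])
    fix i j assume ij: "i \<in> nodes X" "j \<in> nodes X" "dynkin_adjacent X i j" "i \<in> I1 \<longleftrightarrow> i \<in> J1"
    have "j \<in> I1 \<longleftrightarrow> i \<notin> I1"
      using assms(2) ij(1-3) unfolding two_coloring_def by blast
    moreover have "j \<in> J1 \<longleftrightarrow> i \<notin> J1"
      using assms(3) ij(1-3) unfolding two_coloring_def by blast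
    ultimately show "j \<in> I1 \<longleftrightarrow> j \<in> J1" using ij(4) by blast
  qed (use assms I b in auto)
  then show "I1 = J1" using I J by blast
  then show "I2 = J2" using I J by blast
qed

subsection \<open>The discrete wave equation\<close>

text \<open>In time steps in which one class of the two-colouring is updated, the coordinates satisfy
  \<open>u(t+2) + u(t) = A u(t+1)\<close> with the adjacency matrix \<open>A\<close>.\<close>

fun wave :: "dynkin_type \<Rightarrow> (nat \<Rightarrow> 'a::comm_ring_1) \<Rightarrow> nat \<Rightarrow> nat \<Rightarrow> 'a" where
  "wave X c 0 = c"
| "wave X c (Suc 0) = c"
| "wave X c (Suc (Suc t)) = (\<lambda>i. if i \<in> nodes X then nbr_sum X (wave X c (Suc t)) i - wave X c t i else 0)"

lemma wave_support: "(\<And>i. i \<notin> nodes X \<Longrightarrow> c i = 0) \<Longrightarrow> i \<notin> nodes X \<Longrightarrow> wave X c t i = 0"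
  by (induction X c t rule: wave.induct) auto

text \<open>Nodes in J1 show the wave at even times, nodes in J2 at odd times. An update of one
  class uses the other at the time in between, and the two equal initial layers provide the case k =
  0.\<close>

lemma cox_step_wave:
  assumes col: "two_coloring X J1 J2" and supp: "\<And>i. i \<notin> nodes X \<Longrightarrow> c i = 0"
  shows "(cox_step X J1 J2 ^^ k) c = (\<lambda>i. if i \<in> J1 then wave X c (2 * k) i else wave X c (Suc (2 * k)) i)"
proof (induction k)
  case 0
  show ?case by (rule ext) (simp add: mult_0_right)
next
  case (Suc k)
  let ?c = "(cox_step X J1 J2 ^^ k) c"
  have col': "J1 \<union> J2 = nodes X" "J1 \<inter> J2 = {}"
    "\<forall>i\<in>J1. \<forall>j\<in>J1. \<not> dynkin_adjacent X i j" "\<forall>i\<in>J2. \<forall>j\<in>J2. \<not> dynkin_adjacent X i j"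
    using col by (auto simp: two_coloring_def)
  let ?d = "refl_step X J1 ?c"
  have d: "?d i = (if i \<in> J1 then wave X c (2 * Suc k) i else wave X c (Suc (2 * k)) i)" for i
  proof (cases "i \<in> J1")
    case True
    have "nbr_sum X ?c i = nbr_sum X (wave X c (Suc (2 * k))) i"
      unfolding nbr_sum_def Suc using col' True by (intro sum.cong) auto
    then show ?thesis using True col' Suc by (auto simp: refl_step_def)
  next
    case False
    then show ?thesis using Suc by (simp add: refl_step_def)
  qed
  have "refl_step X J2 ?d i = (if i \<in> J1 then wave X c (2 * Suc k) i else wave X c (Suc (2 * Suc k)) i)" for i
  proof (cases "i \<in> J2")
    case True
    have "nbr_sum X ?d i = nbr_sum X (wave X c (2 * Suc k)) i"
      unfolding nbr_sum_def using col' True d by (intro sum.cong) auto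
    moreover have "?d i = wave X c (Suc (2 * k)) i" using d col' True by auto
    moreover have "i \<in> nodes X" "i \<notin> J1" using col' True by auto
    ultimately show ?thesis using True by (simp add: refl_step_def[of X J2])
  next
    case False
    then have "refl_step X J2 ?d i = ?d i" by (simp only: refl_step_def[of X J2] if_False)
    moreover have "wave X c t i = 0" if "i \<notin> J1" for t
      using wave_support[of X c, OF supp] that False col' by blast
    ultimately show ?thesis using d by (cases "i \<in> J1") (simp_all only: if_True if_False simp_thms)
  qed
  then show ?case unfolding funpow.simps o_apply cox_step_def[of X J1 J2 ?c] by (rule ext)
qed

text \<open>On a strip with vanishing boundary values, the rectangle whose lower corner is \<open>(t, N - i)\<close> and
  whose side corners lie on the boundary has the upper corner \<open>(t + N, i)\<close>.\<close>

lemma strip_wave_half_period: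
  fixes w :: "nat \<Rightarrow> nat \<Rightarrow> 'a::comm_ring_1"
  assumes bd: "\<And>t. w t 0 = 0" "\<And>t. w t N = 0"
    and eq: "\<And>t i. Suc i < N \<Longrightarrow> w (t + 2) (Suc i) + w t (Suc i) = w (t + 1) i + w (t + 1) (i + 2)"
    and "i \<le> N"
  shows "w (t + N) i = - w t (N - i)"
proof -
  have cancel: "a + e = f + d" if "a + b = c + d" "e + c = b + f" for a b c d e f :: 'a
  proof -
    have "(a + b) + (e + c) = (c + d) + (b + f)" using that by simp
    then have "(a + e) + (b + c) = (f + d) + (b + c)" by (simp only: ac_simps)
    then show ?thesis by simp
  qed
  have cancel': "a + e = c + f" if "a + b = c + d" "d + e = b + f" for a b c d e f :: 'a
  proof -
    have "(a + b) + (d + e) = (c + d) + (b + f)" using that by simp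
    then have "(a + e) + (b + d) = (c + f) + (b + d)" by (simp only: ac_simps)
    then show ?thesis by simp
  qed
  \<comment> \<open>The wave equation summed over a row of a adjacent diamonds: a rectangle with
    sides 1 and a along the two diagonal directions.\<close>
  have one: "w t (Suc j) + w (t + a + 1) (j + a) = w (t + a) (Suc j + a) + w (t + 1) j"
    if "Suc j + a \<le> N" for t j a
    using that
  proof (induction a)
    case (Suc a)
    have "w (t + a + 2) (Suc (j + a)) + w (t + a) (Suc j + a) = w (t + a + 1) (j + a) + w (t + a + 1) (j + a + 2)"
      using Suc.prems eq[of "j + a" "t + a"] by simp
    from cancel[OF Suc.IH this] show ?case using Suc.prems by simp
  qed simp
  have rect: "w t (j + b) + w (t + a + b) (j + a) = w (t + a) (j + b + a) + w (t + b) j"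
    if "j + a + b \<le> N" for t j a b
    using that
  proof (induction b arbitrary: j)
    case (Suc b)
    have 1: "w t (Suc j + b) + w (t + a + b) (Suc j + a) = w (t + a) (Suc j + b + a) + w (t + b) (Suc j)"
      using Suc.IH[of "Suc j"] Suc.prems by simp
    have eq: "t + b + a = t + a + b" by simp
    have 2: "w (t + b) (Suc j) + w (t + a + b + 1) (j + a) = w (t + a + b) (Suc j + a) + w (t + b + 1) j"
      using one[of j a "t + b", unfolded eq] Suc.prems by simp
    from cancel'[OF 1 2] show ?case by simp
  qed simp
  have "w t (N - i) + w (t + N) i = 0"
    using rect[of 0 i "N - i" t] \<open>i \<le> N\<close> by (simp add: bd)
  then show ?thesis by (metis add.commute eq_neg_iff_add_eq_0)
qed

lemma coxeter_dataI:
  assumes "two_coloring X J1 J2" "1 \<le> g" "\<And>i. special_node X i \<Longrightarrow> i = s" "s \<in> nodes X" "s \<in> J1 \<longleftrightarrow> odd g"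
    "\<And>i. 0 \<le> \<theta> i" "\<And>i. i \<in> nodes X \<Longrightarrow> nbr_sum X \<theta> i \<le> 2 * \<theta> i"
    "\<And>i. i \<in> J2 \<Longrightarrow> nbr_sum X \<theta> i = 2 * \<theta> i" "a \<in> J1" "nbr_sum X \<theta> a \<noteq> 2 * \<theta> a"
    "\<And>k i. 1 \<le> k \<Longrightarrow> k < g \<Longrightarrow> 0 \<le> alt_steps X J1 J2 \<theta> k i"
    "\<And>k. 1 \<le> k \<Longrightarrow> k < g \<Longrightarrow> alt_steps X J1 J2 \<theta> k \<noteq> \<theta>"
    "alt_steps X J1 J2 \<theta> (g - 1) = unit_vec s"
    "\<And>j. j \<in> nodes X \<Longrightarrow> \<pi> j \<in> nodes X \<and> \<pi> (\<pi> j) = j \<and> (\<pi> j \<in> J1 \<longleftrightarrow> j \<in> J1)"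
    "\<And>j. j \<in> nodes X \<Longrightarrow> (cox_step X J1 J2 ^^ g) (unit_vec j) = (\<lambda>i. - unit_vec (\<pi> j) i :: int)"
  shows "coxeter_data X g J1 J2 \<theta> s \<pi>"
  unfolding coxeter_data_def
  by (intro conjI allI impI ballI bexI[of _ a] assms(1-13,15) assms(14)[THEN conjunct1]
      assms(14)[THEN conjunct2, THEN conjunct1] assms(14)[THEN conjunct2, THEN conjunct2])
    auto

subsection \<open>Type A\<close>

lemma nbr_sum_A:
  assumes "i \<in> {1..l}" "c 0 = 0" "c (Suc l) = 0"
  shows "nbr_sum (TypeA l) c i = c (i - 1) + c (i + 1)"
proof -
  have "nbr_sum (TypeA l) c i = (\<Sum>j\<in>{i - 1, i + 1}. c j)"
    unfolding nbr_sum_def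
  proof (rule sum.mono_neutral_left)
    show "\<forall>j\<in>{i - 1, i + 1} - {j \<in> nodes (TypeA l). dynkin_adjacent (TypeA l) i j}. c j = 0"
      using assms by (auto simp: dynkin_adjacent_def le_Suc_eq elim!: order.antisym[elim_format])
  qed (auto simp: dynkin_adjacent_def)
  then show ?thesis using assms by simp
qed

text \<open>g Coxeter steps are 2g time steps. The half period is applied at the times 0 and 1, one
  for each class; as \<pi> is an involution, \<open>unit_vec j\<close> read at \<pi> i is the unit
  vector of \<pi> j read at i.\<close>

lemma cox_step_unit_from_wave:
  fixes \<pi> :: "nat \<Rightarrow> nat"
  assumes col: "two_coloring X J1 J2" and j: "j \<in> nodes X"
    and \<pi>: "\<And>i. i \<in> nodes X \<Longrightarrow> \<pi> i \<in> nodes X \<and> \<pi> (\<pi> i) = i"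
    and wave: "\<And>(c :: nat \<Rightarrow> int) t i. (\<And>i. i \<notin> nodes X \<Longrightarrow> c i = 0) \<Longrightarrow> i \<in> nodes X
      \<Longrightarrow> wave X c (t + 2 * g) i = - wave X c t (\<pi> i)"
  shows "(cox_step X J1 J2 ^^ g) (unit_vec j) = (\<lambda>i. - unit_vec (\<pi> j) i :: int)"
proof
  fix i
  have supp: "i \<notin> nodes X \<Longrightarrow> unit_vec j i = (0 :: int)" for i using j by (auto simp: unit_vec_def)
  have cox: "(cox_step X J1 J2 ^^ g) (unit_vec j) i =
      (if i \<in> J1 then wave X (unit_vec j) (2 * g) i else wave X (unit_vec j) (Suc (2 * g)) i :: int)"
    by (subst cox_step_wave[OF col]) (use supp in auto)
  show "(cox_step X J1 J2 ^^ g) (unit_vec j) i = (- unit_vec (\<pi> j) i :: int)"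
  proof (cases "i \<in> nodes X")
    case True
    have "(cox_step X J1 J2 ^^ g) (unit_vec j) i = (- unit_vec j (\<pi> i) :: int)"
      using cox wave[of "unit_vec j" i 0, OF supp True] wave[of "unit_vec j" i 1, OF supp True] by simp
    moreover have "\<pi> i = j \<longleftrightarrow> i = \<pi> j" using \<pi> j True by metis
    ultimately show ?thesis by (simp add: unit_vec_def)
  next
    case False
    then have "i \<noteq> \<pi> j" using \<pi> j by blast
    then show ?thesis using cox wave_support[of X "unit_vec j", OF supp False] by (simp add: unit_vec_def)
  qed
qed

text \<open>The highest root has all coordinates 1. Each step removes both ends of its support, so k
  steps leave the interval from k + 1 to l - k, which shrinks to the middle node g. The strip has
  width l + 1 = 2g, and its reflection i -> l + 1 - i is the diagram automorphism.\<close>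

lemma coxeter_data_A:
  assumes g: "1 \<le> g"
  defines "l \<equiv> 2 * g - 1"
  shows "coxeter_data (TypeA l) g {i \<in> {1..l}. odd i} {i \<in> {1..l}. even i}
    (\<lambda>i. if i \<in> {1..l} then 1 else 0) g (\<lambda>i. l + 1 - i)"
proof -
  let ?X = "TypeA l" and ?J1 = "{i \<in> {1..l}. odd i}" and ?J2 = "{i \<in> {1..l}. even i}"
  let ?\<theta> = "\<lambda>i. if i \<in> {1..l} then 1 else 0 :: int"
  have col: "two_coloring ?X ?J1 ?J2"
    by (auto simp: two_coloring_def dynkin_adjacent_def)
  have alt: "alt_steps ?X ?J1 ?J2 ?\<theta> k = (\<lambda>i. if Suc k \<le> i \<and> i + k \<le> l then 1 else 0)"
    if "k < g" for k
    using that
  proof (induction k)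
    case 0
    then show ?case by auto
  next
    case (Suc k)
    let ?v = "\<lambda>k i. if Suc k \<le> i \<and> i + k \<le> l then 1 else 0 :: int"
    let ?J = "if even k then ?J1 else ?J2"
    have "refl_step ?X ?J (?v k) i = ?v (Suc k) i" for i
    proof (cases "i \<in> {1..l} \<and> odd (i + k)")
      case True
      then have "i \<in> ?J" by auto
      moreover have "nbr_sum ?X (?v k) i = ?v k (i - 1) + ?v k (i + 1)"
        using True by (intro nbr_sum_A) auto
      moreover have "?v k (i - 1) + ?v k (i + 1) - ?v k i = ?v (Suc k) i"
      proof -
        have "Suc l = 2 * g" using g by (simp add: l_def)
        then have "even (Suc l)" by simp
        \<comment> \<open>Parity rules out the positions just outside the support, where an update
          would enlarge the interval again.\<close>
        then have "i \<noteq> k" "i + k \<noteq> Suc l" using True by (metis even_add, metis)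
        then consider "i < k" | "i = Suc k" | "Suc k < i" "i + k < l" | "i + k = l" "Suc k < i" | "Suc l < i + k"
          using Suc.prems by (fastforce simp: l_def)
        then show ?thesis
          using True Suc.prems by cases (auto simp: l_def)
      qed
      ultimately show ?thesis by (simp only: refl_step_def if_True)
    next
      case False
      then have "i \<notin> ?J" by auto
      moreover have "i \<noteq> Suc k" using False Suc.prems by (auto simp: l_def)
      moreover have "i + k \<noteq> l"
      proof
        assume *: "i + k = l"
        have "odd l" using g by (simp add: l_def)
        then have "odd (i + k)" using * by simp
        moreover have "i \<in> {1..l}" using * Suc.prems by (auto simp: l_def)
        ultimately show False using False by blast
      qed
      ultimately show ?thesis by (auto simp: refl_step_def)
    qed
    then have step: "refl_step ?X ?J (?v k) = ?v (Suc k)" by (rule ext)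
    show ?case unfolding alt_steps.simps Suc.IH[OF Suc_lessD[OF Suc.prems]] step ..
  qed
  have wave: "wave ?X c (t + 2 * g) i = - wave ?X c t (l + 1 - i)"
    if c: "\<And>i. i \<notin> nodes ?X \<Longrightarrow> c i = 0" and i: "i \<in> nodes ?X" for c :: "nat \<Rightarrow> int" and t i
  proof -
    have z: "wave ?X c t 0 = 0" "wave ?X c t (Suc l) = 0" for t
      using wave_support[of ?X c, OF c] by auto
    have "2 * g = Suc l" using g by (simp add: l_def)
    moreover have "wave ?X c (t + Suc l) i = - wave ?X c t (Suc l - i)"
    proof (rule strip_wave_half_period)
      fix t i assume "Suc i < Suc l"
      then show "wave ?X c (t + 2) (Suc i) + wave ?X c t (Suc i)
          = wave ?X c (t + 1) i + wave ?X c (t + 1) (i + 2)"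
        using nbr_sum_A[of "Suc i" l "wave ?X c (Suc t)"] z by simp
    qed (use z i in auto)
    ultimately show ?thesis by simp
  qed
  have \<theta>: "nbr_sum ?X ?\<theta> i = ?\<theta> (i - 1) + ?\<theta> (i + 1)" if "i \<in> {1..l}" for i
    using that by (intro nbr_sum_A) auto
  have cox: "(cox_step ?X ?J1 ?J2 ^^ g) (unit_vec j) = (\<lambda>i. - unit_vec (l + 1 - j) i :: int)"
    if "j \<in> {1..l}" for j
    using wave that by (intro cox_step_unit_from_wave[OF col]) auto
  have l1: "1 \<le> l" and l: "l + 1 = 2 * g" using g by (auto simp: l_def)
  show ?thesis
  proof (rule coxeter_dataI[OF col g])
    show "1 \<in> ?J1" "nbr_sum ?X ?\<theta> 1 \<noteq> 2 * ?\<theta> 1"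
      using \<theta>[of 1] l1 by simp_all
    show "nbr_sum ?X ?\<theta> i \<le> 2 * ?\<theta> i" if "i \<in> nodes ?X" for i
      using \<theta>[of i] that by auto
    show "nbr_sum ?X ?\<theta> i = 2 * ?\<theta> i" if "i \<in> ?J2" for i
    proof -
      have "odd l" using l by presburger
      then have "i \<noteq> 1" "i \<noteq> l" "i \<in> {1..l}" using that by auto
      then have "i \<in> {1..l}" "i - 1 \<in> {1..l}" "i + 1 \<in> {1..l}" by auto
      then show ?thesis using \<theta>[of i] by simp
    qed
    show "alt_steps ?X ?J1 ?J2 ?\<theta> (g - 1) = unit_vec g"
    proof
      fix i
      have "Suc (g - 1) \<le> i \<and> i + (g - 1) \<le> l \<longleftrightarrow> i = g" using g l by linarith
      moreover have "g - 1 < g" using g by simp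
      ultimately show "alt_steps ?X ?J1 ?J2 ?\<theta> (g - 1) i = unit_vec g i"
        by (simp only: alt unit_vec_def)
    qed
    show "0 \<le> alt_steps ?X ?J1 ?J2 ?\<theta> k i" if "k < g" for k i
      unfolding alt[OF that] by simp
    show "alt_steps ?X ?J1 ?J2 ?\<theta> k \<noteq> ?\<theta>" if "1 \<le> k" "k < g" for k
    proof
      assume "alt_steps ?X ?J1 ?J2 ?\<theta> k = ?\<theta>"
      from fun_cong[OF this, of 1] show False
        unfolding alt[OF that(2)] using that l1 by simp
    qed
    show "(cox_step ?X ?J1 ?J2 ^^ g) (unit_vec j) = (\<lambda>i. - unit_vec (l + 1 - j) i :: int)"
      if "j \<in> nodes ?X" for j
      using cox[of j] that by simp
    show "i = g" if "special_node ?X i" for i using that l by (simp add: special_node_def)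
    show "g \<in> nodes ?X" "g \<in> ?J1 \<longleftrightarrow> odd g" using g by (auto simp: l_def)
    show "l + 1 - j \<in> nodes ?X \<and> l + 1 - (l + 1 - j) = j \<and> (l + 1 - j \<in> ?J1 \<longleftrightarrow> j \<in> ?J1)"
      if "j \<in> nodes ?X" for j
    proof -
      have "1 \<le> j" "j \<le> l" using that by auto
      have "even (l + 1)" unfolding l by simp
      then have "even (l + 1 - j) \<longleftrightarrow> even j" using \<open>j \<le> l\<close> by (metis even_diff_nat even_add trans_le_add1 not_less)
      moreover have "1 \<le> l + 1 - j" "l + 1 - j \<le> l" "l + 1 - (l + 1 - j) = j"
        using \<open>1 \<le> j\<close> \<open>j \<le> l\<close> by linarith+
      ultimately show ?thesis using \<open>1 \<le> j\<close> \<open>j \<le> l\<close>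
        by (simp only: mem_Collect_eq atLeastAtMost_iff type_rank.simps simp_thms)
    qed
    show "0 \<le> ?\<theta> i" for i by simp
  qed
qed

subsection \<open>Type D\<close>

text \<open>With rank n + 4 the branch node is n + 2 and the fork ends are n + 3 and n + 4;
  \<open>c 0 = 0\<close> covers the left end.\<close>

lemma nbr_sum_D:
  assumes c: "c 0 = 0"
  shows "i \<in> {1..n+1} \<Longrightarrow> nbr_sum (TypeD (n + 4)) c i = c (i - 1) + c (i + 1)"
    and "nbr_sum (TypeD (n + 4)) c (n + 2) = c (n + 1) + c (n + 3) + c (n + 4)"
    and "nbr_sum (TypeD (n + 4)) c (n + 3) = c (n + 2)"
    and "nbr_sum (TypeD (n + 4)) c (n + 4) = c (n + 2)"
proof -
  let ?N = "\<lambda>i. {j \<in> nodes (TypeD (n + 4)). dynkin_adjacent (TypeD (n + 4)) i j}"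
  show "nbr_sum (TypeD (n + 4)) c i = c (i - 1) + c (i + 1)" if i: "i \<in> {1..n+1}"
  proof (cases "i = 1")
    case True
    have "?N 1 = {2}" by (auto simp: dynkin_adjacent_def)
    then show ?thesis using True c by (simp add: nbr_sum_def numeral_2_eq_2)
  next
    case False
    have "?N i = {i - 1, i + 1}" using i False by (auto simp: dynkin_adjacent_def)
    then show ?thesis using i by (simp add: nbr_sum_def)
  qed
  have "?N (n + 2) = {n + 1, n + 3, n + 4}" by (auto simp: dynkin_adjacent_def)
  then show "nbr_sum (TypeD (n + 4)) c (n + 2) = c (n + 1) + c (n + 3) + c (n + 4)"
    by (simp add: nbr_sum_def)
  have "?N (n + 3) = {n + 2}" by (auto simp: dynkin_adjacent_def)
  then show "nbr_sum (TypeD (n + 4)) c (n + 3) = c (n + 2)" by (simp add: nbr_sum_def)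
  have "?N (n + 4) = {n + 2}" by (auto simp: dynkin_adjacent_def)
  then show "nbr_sum (TypeD (n + 4)) c (n + 4) = c (n + 2)" by (simp add: nbr_sum_def)
qed

lemma special_node_D:
  assumes "special_node (TypeD (n + 4)) i"
  shows "i = n + 2"
proof (rule ccontr)
  assume ne: "i \<noteq> n + 2"
  let ?N = "{j \<in> nodes (TypeD (n + 4)). dynkin_adjacent (TypeD (n + 4)) i j}"
  have "?N \<subseteq> (if i \<le> n + 1 then {i - 1, i + 1} else {n + 2})"
    using ne by (auto simp: dynkin_adjacent_def)
  then have "card ?N \<le> card (if i \<le> n + 1 then {i - 1, i + 1} else {n + 2})"
    by (intro card_mono) auto
  also have "\<dots> \<le> 2" by (simp add: card_insert_if)
  finally show False using assms by (simp add: special_node_def)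
qed

text \<open>For \<open>k \<ge> 1\<close> the \<open>k\<close>-th root on the way down from the highest root \<open>\<epsilon>\<^sub>1 + \<epsilon>\<^sub>2\<close> is
  \<open>\<epsilon>\<^sub>k + \<epsilon>\<^sub>k\<^sub>+\<^sub>2\<close>, where \<open>\<epsilon>\<^sub>i - \<epsilon>\<^sub>i\<^sub>+\<^sub>1\<close> is the \<open>i\<close>-th simple root; \<open>dclass\<close> is the class of the nodes updated in that step.\<close>

definition droot :: "nat \<Rightarrow> nat \<Rightarrow> nat \<Rightarrow> int" where
  "droot n k i = (if i = 0 \<or> n + 4 < i \<or> i < k then 0 else if k + 2 \<le> i \<and> i \<le> n + 2 then 2 else 1)"

definition dclass :: "nat \<Rightarrow> nat \<Rightarrow> nat set" where
  "dclass n p = {i \<in> {1..n + 4}. even ((if i = n + 4 then n + 3 else i) + p)}"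

lemma D_cases:
  fixes i n :: nat
  assumes "i \<in> {1..n + 4}"
  obtains "i \<in> {1..n + 1}" | "i = n + 2" | "i = n + 3" | "i = n + 4"
  using assms by fastforce

text \<open>The step subtracts the simple roots at k and k + 2 (at 2 alone when k = 0): these are
  the only updated nodes where the neighbour sum differs from twice the coordinate. The bound on k
  keeps k + 2 from passing the branch node.\<close>

lemma refl_step_droot:
  assumes k: "k \<le> n"
  shows "refl_step (TypeD (n + 4)) (dclass n k) (droot n k) = droot n (Suc k)"
proof
  fix i
  have z: "droot n k 0 = 0" by (simp add: droot_def)
  show "refl_step (TypeD (n + 4)) (dclass n k) (droot n k) i = droot n (Suc k) i"
  proof (cases "i \<in> dclass n k")
    case True
    then have i: "i \<in> {1..n + 4}" by (simp add: dclass_def)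
    from i have "nbr_sum (TypeD (n + 4)) (droot n k) i - droot n k i = droot n (Suc k) i"
    proof (cases rule: D_cases)
      case 1
      have "even (i + k)" using True 1 by (simp add: dclass_def)
      then have "i \<noteq> Suc k" "i \<noteq> k + 3" "Suc i \<noteq> k" by auto
      then consider "Suc i < k" | "i = k" | "i = k + 2" | "k + 3 < i" by linarith
      then show ?thesis
        unfolding nbr_sum_D(1)[where c = "droot n k", OF z 1] using 1 k by cases (auto simp: droot_def)
    next
      case 2
      have "even (n + 2 + k)" using True 2 by (simp add: dclass_def)
      then have "n + 2 \<noteq> k + 3" by auto
      then show ?thesis unfolding 2 nbr_sum_D(2)[where c = "droot n k", OF z] using k
        by (cases "k = n") (auto simp: droot_def)
    next
      case 3
      then show ?thesis unfolding 3 nbr_sum_D(3)[where c = "droot n k", OF z] using k by (auto simp: droot_def)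
    next
      case 4
      then show ?thesis unfolding 4 nbr_sum_D(4)[where c = "droot n k", OF z] using k by (auto simp: droot_def)
    qed
    then show ?thesis using True by (simp only: refl_step_def if_True)
  next
    case False
    have "i \<noteq> k \<or> i = 0" "i \<noteq> k + 2" using False k by (auto simp: dclass_def)
    then have "droot n k i = droot n (Suc k) i" by (auto simp: droot_def)
    then show ?thesis using False by (simp add: refl_step_def)
  qed
qed

text \<open>Here the root has coordinate 1 at n + 1, ..., n + 4 and 0 elsewhere. Its whole support
  except the branch node is updated, and these three coordinates drop to 0.\<close>

lemma refl_step_droot_last:
  "refl_step (TypeD (n + 4)) (dclass n (n + 1)) (droot n (n + 1)) = unit_vec (n + 2)"
proof
  fix i
  have z: "droot n (n + 1) 0 = 0" by (simp add: droot_def)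
  show "refl_step (TypeD (n + 4)) (dclass n (n + 1)) (droot n (n + 1)) i = unit_vec (n + 2) i"
  proof (cases "i \<in> dclass n (n + 1)")
    case True
    then have i: "i \<in> {1..n + 4}" by (simp add: dclass_def)
    from i have "nbr_sum (TypeD (n + 4)) (droot n (n + 1)) i - droot n (n + 1) i = unit_vec (n + 2) i"
    proof (cases rule: D_cases)
      case 1
      have "even (i + (n + 1))" using True 1 by (simp add: dclass_def)
      then have "i \<noteq> n" by auto
      then have "i < n \<or> i = n + 1" using 1 by auto
      then show ?thesis
        unfolding nbr_sum_D(1)[where c = "droot n (n + 1)", OF z 1] using 1 by (auto simp: droot_def unit_vec_def)
    next
      case 2
      have "even (n + 2 + (n + 1))" using True 2 by (simp add: dclass_def)
      then show ?thesis by simp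
    next
      case 3
      then show ?thesis unfolding 3 nbr_sum_D(3)[where c = "droot n (n + 1)", OF z] by (auto simp: droot_def unit_vec_def)
    next
      case 4
      then show ?thesis unfolding 4 nbr_sum_D(4)[where c = "droot n (n + 1)", OF z] by (auto simp: droot_def unit_vec_def)
    qed
    then show ?thesis using True by (simp only: refl_step_def if_True)
  next
    case False
    then have "i \<noteq> n + 1" "i \<noteq> n + 3" "i \<noteq> n + 4" by (auto simp: dclass_def)
    then have "droot n (n + 1) i = unit_vec (n + 2) i" by (auto simp: droot_def unit_vec_def)
    then show ?thesis using False by (simp add: refl_step_def)
  qed
qed

text \<open>Folding: adding the coordinates of the two end nodes of the fork gives a symmetric wave on a
  path of length \<open>2n + 5\<close>; their difference changes sign in every double step.\<close>

lemma wave_D_half_period: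
  fixes c :: "nat \<Rightarrow> int"
  assumes c: "\<And>i. i \<notin> {1..n + 4} \<Longrightarrow> c i = 0" and i: "i \<in> {1..n + 4}"
  defines "X \<equiv> TypeD (n + 4)"
  shows "wave X c (t + 2 * (n + 3)) i =
    - wave X c t (if even (n + 3) \<and> n + 3 \<le> i then (if i = n + 3 then n + 4 else n + 3) else i)"
proof -
  define u where "u = wave X c"
  have nodes: "nodes X = {1..n + 4}" by (simp add: X_def)
  have z: "u t 0 = 0" for t
    unfolding u_def by (rule wave_support) (use c in \<open>simp_all only: nodes, auto\<close>)
  have rec: "u (t + 2) j = nbr_sum X (u (t + 1)) j - u t j" if "j \<in> {1..n + 4}" for t j
    using that by (simp add: u_def X_def)
  define y where "y t j = (if j \<le> n + 2 then u t j else if j = n + 3 then u t (n + 3) + u t (n + 4)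
    else u t (2 * (n + 3) - j))" for t j
  have y0: "y t 0 = 0" "y t (2 * (n + 3)) = 0" for t by (simp_all add: y_def z)
  have sym: "y t (2 * (n + 3) - j) = y t j" if "j \<le> 2 * (n + 3)" for t j
    using that by (auto simp: y_def)
  have left: "y (t + 2) (Suc j) + y t (Suc j) = y (t + 1) j + y (t + 1) (j + 2)" if j: "Suc j < n + 3" for t j
  proof (cases "Suc j = n + 2")
    case True
    then show ?thesis using nbr_sum_D(2)[of "u (t + 1)" n, OF z] rec[of "n + 2" t]
      by (simp add: y_def X_def)
  next
    case False
    then have "Suc j \<in> {1..n + 1}" using j by auto
    then show ?thesis using nbr_sum_D(1)[of "u (t + 1)" "Suc j" n, OF z] rec[of "Suc j" t] j
      by (simp add: y_def X_def)
  qed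
  have y_eq: "y (t + 2 * (n + 3)) j = - y t (2 * (n + 3) - j)" if "j \<le> 2 * (n + 3)" for t j
  proof (rule strip_wave_half_period[OF y0 _ that])
    fix t j assume j: "Suc j < 2 * (n + 3)"
    consider "Suc j < n + 3" | "Suc j = n + 3" | "n + 3 < Suc j" by linarith
    then show "y (t + 2) (Suc j) + y t (Suc j) = y (t + 1) j + y (t + 1) (j + 2)"
    proof cases
      case 1
      then show ?thesis by (rule left)
    next
      case 2
      then have "j = n + 2" by simp
      then show ?thesis
        using nbr_sum_D(3)[of "u (t + 1)" n, OF z] nbr_sum_D(4)[of "u (t + 1)" n, OF z] rec[of "n + 3" t] rec[of "n + 4" t]
        by (simp add: y_def X_def)
    next
      case 3
      define j' where "j' = 2 * (n + 3) - (j + 2)"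
      have j': "Suc j' < n + 3" "Suc j = 2 * (n + 3) - Suc j'" "j = 2 * (n + 3) - (j' + 2)" "j + 2 = 2 * (n + 3) - j'"
        "Suc j' \<le> 2 * (n + 3)" "j' \<le> 2 * (n + 3)" "j' + 2 \<le> 2 * (n + 3)"
        using 3 j by (auto simp: j'_def)
      have "y (t + 2) (Suc j) = y (t + 2) (Suc j')" "y t (Suc j) = y t (Suc j')"
        "y (t + 1) j = y (t + 1) (j' + 2)" "y (t + 1) (j + 2) = y (t + 1) j'"
        using sym[OF j'(5)] sym[OF j'(6)] sym[OF j'(7)] j'(2-4) by metis+
      then show ?thesis using left[OF j'(1), of t] by simp
    qed
  qed
  \<comment> \<open>The strip width 2(n + 3) is the Coxeter number. As y is symmetric, the
    reflection of the strip has no effect, and the half period acts as - 1 on the folded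
    wave.\<close>
  have y_neg: "y (t + 2 * (n + 3)) j = - y t j" if "j \<le> 2 * (n + 3)" for j
    using y_eq[OF that] sym[OF that] by simp
  have d: "u (t + 2 * k) (n + 3) - u (t + 2 * k) (n + 4) = (- 1) ^ k * (u t (n + 3) - u t (n + 4))" for k
  proof (induction k)
    case (Suc k)
    then show ?case
      using nbr_sum_D(3)[of "u (t + 2 * k + 1)" n, OF z] nbr_sum_D(4)[of "u (t + 2 * k + 1)" n, OF z]
        rec[of "n + 3" "t + 2 * k"] rec[of "n + 4" "t + 2 * k"]
      by (simp add: X_def)
  qed simp
  \<comment> \<open>Over n + 3 double steps the sum changes sign and the difference is multiplied by
    (- 1)^(n + 3). So the fork ends are exchanged up to sign if n + 3 is even; otherwise each just
    changes sign.\<close>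
  have s: "u (t + 2 * (n + 3)) (n + 3) + u (t + 2 * (n + 3)) (n + 4) = - (u t (n + 3) + u t (n + 4))"
    using y_neg[of "n + 3"] by (simp add: y_def)
  from i show ?thesis
    unfolding u_def[symmetric]
  proof (cases rule: D_cases)
    case 1
    then show "u (t + 2 * (n + 3)) i =
      - u t (if even (n + 3) \<and> n + 3 \<le> i then (if i = n + 3 then n + 4 else n + 3) else i)"
      using y_neg[of i] by (simp add: y_def)
  next
    case 2
    then show "u (t + 2 * (n + 3)) i =
      - u t (if even (n + 3) \<and> n + 3 \<le> i then (if i = n + 3 then n + 4 else n + 3) else i)"
      using y_neg[of i] by (simp add: y_def)
  next
    case 3
    show "u (t + 2 * (n + 3)) i =
      - u t (if even (n + 3) \<and> n + 3 \<le> i then (if i = n + 3 then n + 4 else n + 3) else i)"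
    proof (cases "even (n + 3)")
      case True
      then have "u (t + 2 * (n + 3)) (n + 3) - u (t + 2 * (n + 3)) (n + 4) = u t (n + 3) - u t (n + 4)"
        using d[of "n + 3"] by simp
      then have "u (t + 2 * (n + 3)) (n + 3) = - u t (n + 4)" using s by linarith
      then show ?thesis using 3 True by simp
    next
      case False
      then have "u (t + 2 * (n + 3)) (n + 3) - u (t + 2 * (n + 3)) (n + 4) = - (u t (n + 3) - u t (n + 4))"
        using d[of "n + 3"] by simp
      then have "u (t + 2 * (n + 3)) (n + 3) = - u t (n + 3)" using s by linarith
      then show ?thesis using 3 False by simp
    qed
  next
    case 4
    show "u (t + 2 * (n + 3)) i =
      - u t (if even (n + 3) \<and> n + 3 \<le> i then (if i = n + 3 then n + 4 else n + 3) else i)"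
    proof (cases "even (n + 3)")
      case True
      then have "u (t + 2 * (n + 3)) (n + 3) - u (t + 2 * (n + 3)) (n + 4) = u t (n + 3) - u t (n + 4)"
        using d[of "n + 3"] by simp
      then have "u (t + 2 * (n + 3)) (n + 4) = - u t (n + 3)" using s by linarith
      then show ?thesis using 4 True by simp
    next
      case False
      then have "u (t + 2 * (n + 3)) (n + 3) - u (t + 2 * (n + 3)) (n + 4) = - (u t (n + 3) - u t (n + 4))"
        using d[of "n + 3"] by simp
      then have "u (t + 2 * (n + 3)) (n + 4) = - u t (n + 4)" using s by linarith
      then show ?thesis using 4 False by simp
    qed
  qed
qed

text \<open>The Coxeter number 2(l - 1) for l = n + 4 gives g = n + 3. The highest root has
  coordinates 1, 2, ..., 2, 1, 1 and is orthogonal to all simple roots but the second. The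
  automorphism exchanges the fork ends exactly for odd rank, that is for even g.\<close>

lemma coxeter_data_D:
  "coxeter_data (TypeD (n + 4)) (n + 3) (dclass n 0) (dclass n 1) (droot n 0) (n + 2)
    (\<lambda>i. if even (n + 3) \<and> n + 3 \<le> i then (if i = n + 3 then n + 4 else n + 3) else i)"
proof -
  let ?X = "TypeD (n + 4)" and ?J1 = "dclass n 0" and ?J2 = "dclass n 1" and ?\<theta> = "droot n 0"
  let ?\<pi> = "\<lambda>i. if even (n + 3) \<and> n + 3 \<le> i then (if i = n + 3 then n + 4 else n + 3) else i"
  have col: "two_coloring ?X ?J1 ?J2"
    by (auto simp: two_coloring_def dynkin_adjacent_def dclass_def)
  have cls: "(if even k then ?J1 else ?J2) = dclass n k" for k
    by (auto simp: dclass_def)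
  have alt: "alt_steps ?X ?J1 ?J2 ?\<theta> k = droot n k" if "k \<le> n + 1" for k
    using that
  proof (induction k)
    case (Suc k)
    then show ?case unfolding alt_steps.simps cls using refl_step_droot[of k n] by simp
  qed simp
  have last: "alt_steps ?X ?J1 ?J2 ?\<theta> (n + 2) = unit_vec (n + 2)"
  proof -
    have "alt_steps ?X ?J1 ?J2 ?\<theta> (Suc (n + 1)) = unit_vec (n + 2)"
      unfolding alt_steps.simps(2) cls alt[OF order_refl] by (rule refl_step_droot_last)
    then show ?thesis by simp
  qed
  have k_cases: "k \<le> n + 1 \<or> k = n + 2" if "k < n + 3" for k using that by auto
  have z: "droot n 0 0 = 0" by (simp add: droot_def)
  have nbr: "nbr_sum ?X ?\<theta> i = (if i = 2 then 3 else 2 * ?\<theta> i)" if i: "i \<in> {1..n + 4}" for i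
    using i
  proof (cases rule: D_cases)
    case 1
    consider "i = 1" | "i = 2" | "3 \<le> i" using 1 by fastforce
    then show ?thesis unfolding nbr_sum_D(1)[where c = "droot n 0", OF z 1] using 1 by cases (auto simp: droot_def)
  next
    case 2
    then show ?thesis unfolding 2 nbr_sum_D(2)[where c = "droot n 0", OF z] by (auto simp: droot_def)
  next
    case 3
    then show ?thesis unfolding 3 nbr_sum_D(3)[where c = "droot n 0", OF z] by (auto simp: droot_def)
  next
    case 4
    then show ?thesis unfolding 4 nbr_sum_D(4)[where c = "droot n 0", OF z] by (auto simp: droot_def)
  qed
  have \<pi>: "?\<pi> j \<in> {1..n + 4} \<and> ?\<pi> (?\<pi> j) = j \<and> (?\<pi> j \<in> ?J1 \<longleftrightarrow> j \<in> ?J1)" if "j \<in> {1..n + 4}" for j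
    using that by (auto simp: dclass_def)
  show ?thesis
  proof (rule coxeter_dataI[OF col])
    show "i = n + 2" if "special_node ?X i" for i using special_node_D[OF that] .
    show "2 \<in> ?J1" by (simp add: dclass_def)
    show "nbr_sum ?X ?\<theta> 2 \<noteq> 2 * ?\<theta> 2" by (simp add: nbr droot_def)
    show "nbr_sum ?X ?\<theta> i \<le> 2 * ?\<theta> i" if "i \<in> nodes ?X" for i
      using that nbr[of i] by (cases "i = 2") (auto simp: droot_def)
    show "nbr_sum ?X ?\<theta> i = 2 * ?\<theta> i" if "i \<in> ?J2" for i
      using that nbr[of i] by (auto simp: dclass_def)
    show "0 \<le> alt_steps ?X ?J1 ?J2 ?\<theta> k i" if "k < n + 3" for k i
      using k_cases[OF that]
    proof
      assume k: "k \<le> n + 1"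
      show ?thesis unfolding alt[OF k] by (simp add: droot_def)
    next
      assume k: "k = n + 2"
      show ?thesis unfolding k last by (simp add: unit_vec_def)
    qed
    show "alt_steps ?X ?J1 ?J2 ?\<theta> k \<noteq> ?\<theta>" if "1 \<le> k" "k < n + 3" for k
    proof
      assume "alt_steps ?X ?J1 ?J2 ?\<theta> k = ?\<theta>"
      \<comment> \<open>Coordinate 2 is lowered in the very first step and stays below 2 for 1 \<le>
        k < g.\<close>
      then have two: "alt_steps ?X ?J1 ?J2 ?\<theta> k 2 = 2" by (simp add: droot_def)
      from k_cases[OF that(2)] show False
      proof
        assume k: "k \<le> n + 1"
        show False using two that(1) unfolding alt[OF k] by (simp add: droot_def split: if_splits)
      next
        assume k: "k = n + 2"
        show False using two unfolding k last by (simp add: unit_vec_def split: if_splits)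
      qed
    qed
    show "alt_steps ?X ?J1 ?J2 ?\<theta> (n + 3 - 1) = unit_vec (n + 2)" using last by simp
    show "?\<pi> j \<in> nodes ?X \<and> ?\<pi> (?\<pi> j) = j \<and> (?\<pi> j \<in> ?J1 \<longleftrightarrow> j \<in> ?J1)" if "j \<in> nodes ?X" for j
      using \<pi>[of j] that by simp
    show "(cox_step ?X ?J1 ?J2 ^^ (n + 3)) (unit_vec j) = (\<lambda>i. - unit_vec (?\<pi> j) i :: int)"
      if "j \<in> nodes ?X" for j
    proof (rule cox_step_unit_from_wave[OF col that])
      show "?\<pi> i \<in> nodes ?X \<and> ?\<pi> (?\<pi> i) = i" if "i \<in> nodes ?X" for i
        using \<pi>[of i] that by simp
      show "wave ?X c (t + 2 * (n + 3)) i = - wave ?X c t (?\<pi> i)"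
        if "\<And>i. i \<notin> nodes ?X \<Longrightarrow> c i = 0" "i \<in> nodes ?X" for c :: "nat \<Rightarrow> int" and t i
        using that by (intro wave_D_half_period) auto
    qed
  qed (auto simp: droot_def dclass_def)
qed

subsection \<open>Type E\<close>

definition list_vec :: "'a::comm_ring_1 list \<Rightarrow> nat \<Rightarrow> 'a" where
  "list_vec xs i = (if i \<in> {1..length xs} then xs ! (i - 1) else 0)"

lemma list_vec_eq_iff:
  assumes "length xs = length ys"
  shows "list_vec xs = list_vec ys \<longleftrightarrow> xs = ys"
proof
  assume eq: "list_vec xs = list_vec ys"
  show "xs = ys"
  proof (rule nth_equalityI[OF assms])
    fix i assume "i < length xs"
    then show "xs ! i = ys ! i" using fun_cong[OF eq, of "Suc i"] assms by (simp add: list_vec_def)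
  qed
qed simp

lemma list_vec_nonneg: "\<forall>x\<in>set xs. (0::int) \<le> x \<Longrightarrow> 0 \<le> list_vec xs i"
  by (auto simp: list_vec_def)

lemma list_vec_uminus: "(\<lambda>i. - list_vec xs i) = list_vec (map uminus xs)"
proof
  show "- list_vec xs i = list_vec (map uminus xs) i" for i
    by (cases "i \<in> {1..length xs}") (auto simp: list_vec_def)
qed

lemma E_node_cases:
  assumes "i \<in> nodes (TypeE l)" "l \<in> {6, 7, 8}"
  obtains "i = 1" | "i = 2" | "i = 3" | "i = 4" | "i = 5" | "i = 6" | "i = 7" "7 \<le> l" | "i = 8" "8 \<le> l"
  using assms by fastforce

lemma E_neighbours:
  assumes "l \<in> {6, 7, 8}"
  defines "N \<equiv> \<lambda>i. {j \<in> nodes (TypeE l). dynkin_adjacent (TypeE l) i j}"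
  shows "N 1 = {3}" "N 2 = {4}" "N 3 = {1, 4}" "N 4 = {2, 3, 5}" "N 5 = {4, 6}"
    and "N 6 = (if l = 6 then {5} else {5, 7})"
    and "7 \<le> l \<Longrightarrow> N 7 = (if l = 7 then {6} else {6, 8})" and "8 \<le> l \<Longrightarrow> N 8 = {7}"
  using assms(1) by (auto simp: N_def dynkin_adjacent_def)

lemma nbr_sum_E:
  assumes "l \<in> {6, 7, 8}"
  shows "nbr_sum (TypeE l) c 1 = c 3" "nbr_sum (TypeE l) c 2 = c 4" "nbr_sum (TypeE l) c 3 = c 1 + c 4"
    "nbr_sum (TypeE l) c 4 = c 2 + c 3 + c 5" "nbr_sum (TypeE l) c 5 = c 4 + c 6"
    "nbr_sum (TypeE l) c 6 = (if l = 6 then c 5 else c 5 + c 7)"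
    and "7 \<le> l \<Longrightarrow> nbr_sum (TypeE l) c 7 = (if l = 7 then c 6 else c 6 + c 8)"
    and "8 \<le> l \<Longrightarrow> nbr_sum (TypeE l) c 8 = c 7"
  unfolding nbr_sum_def using E_neighbours[OF assms] by (simp_all add: add.assoc)

lemma unit_vec_list_vec:
  assumes "j \<in> {1..n}"
  shows "unit_vec j = list_vec (map (\<lambda>i. if i = j then 1 else 0) [1..<Suc n])"
proof
  fix i
  show "unit_vec j i = list_vec (map (\<lambda>i. if i = j then 1 else 0) [1..<Suc n]) i"
    using assms by (auto simp: unit_vec_def list_vec_def simp del: upt_Suc)
qed

lemma alt_steps_numeral:
  "alt_steps X J1 J2 c (numeral k) =
    refl_step X (if even (pred_numeral k :: nat) then J1 else J2) (alt_steps X J1 J2 c (pred_numeral k))"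
  by (simp add: numeral_eq_Suc)

lemma cox_step_numeral:
  "(cox_step X J1 J2 ^^ numeral k) c = cox_step X J1 J2 ((cox_step X J1 J2 ^^ pred_numeral k) c)"
  by (simp add: numeral_eq_Suc)

lemma special_node_E:
  assumes l: "l \<in> {6, 7, 8}" and "special_node (TypeE l) i"
  shows "i = 4"
proof -
  have i: "i \<in> nodes (TypeE l)"
    and card: "card {j \<in> nodes (TypeE l). dynkin_adjacent (TypeE l) i j} = 3"
    using assms(2) by (auto simp: special_node_def)
  from i l show ?thesis
    using card E_neighbours[OF l] by (cases rule: E_node_cases) (auto split: if_splits)
qed

text \<open>The update written out for arbitrary entries: node 2 is joined to 4, the others form the
  path 1, 3, 4, 5, 6. With both classes covered, iteration becomes substitution into explicit
  lists.\<close>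

lemma refl_step_E6:
  shows "refl_step (TypeE 6) {2, 3, 5} (list_vec [a, b, c, d, e, f]) =
      list_vec [a, d - b, a + d - c, d, d + f - e, f]"
    and "refl_step (TypeE 6) {1, 4, 6} (list_vec [a, b, c, d, e, f]) =
      list_vec [c - a, b, c, b + c + e - d, e, e - f]"
proof -
  show "refl_step (TypeE 6) {2, 3, 5} (list_vec [a, b, c, d, e, f]) =
      list_vec [a, d - b, a + d - c, d, d + f - e, f]" (is "?L = ?R")
  proof
    fix i
    show "?L i = ?R i"
    proof (cases "i \<in> nodes (TypeE 6)")
      case True
      then show ?thesis
        by (cases rule: E_node_cases) (simp_all add: refl_step_def nbr_sum_E[of 6, simplified] list_vec_def)
    next
      case False
      then have "i \<notin> {2, 3, 5}" "i \<notin> {1..6}" by auto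
      then show ?thesis by (auto simp: refl_step_def list_vec_def)
    qed
  qed
  show "refl_step (TypeE 6) {1, 4, 6} (list_vec [a, b, c, d, e, f]) =
      list_vec [c - a, b, c, b + c + e - d, e, e - f]" (is "?L = ?R")
  proof
    fix i
    show "?L i = ?R i"
    proof (cases "i \<in> nodes (TypeE 6)")
      case True
      then show ?thesis
        by (cases rule: E_node_cases) (simp_all add: refl_step_def nbr_sum_E[of 6, simplified] list_vec_def)
    next
      case False
      then have "i \<notin> {1, 4, 6}" "i \<notin> {1..6}" by auto
      then show ?thesis by (auto simp: refl_step_def list_vec_def)
    qed
  qed
qed

text \<open>h = 12. The highest root is orthogonal to all simple roots but the one at node 2, which
  determines J1; the special node 4 lies in J2 since g = 6 is even. The list for \<pi> is the flip
  of the diagram, 1 <-> 6 and 3 <-> 5.\<close>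

lemma coxeter_data_E6:
  "coxeter_data (TypeE 6) 6 {2, 3, 5} {1, 4, 6}
    (list_vec [1, 2, 2, 3, 2, 1]) 4 (\<lambda>i. [6, 2, 5, 4, 3, 1] ! (i - 1))"
proof (rule coxeter_dataI)
  let ?X = "TypeE 6" and ?J1 = "{2, 3, 5}" and ?J2 = "{1, 4, 6}"
  let ?\<theta> = "list_vec [1, 2, 2, 3, 2, 1] :: nat \<Rightarrow> int"
  let ?\<pi> = "\<lambda>i. [6, 2, 5, 4, 3, 1] ! (i - 1) :: nat"
  have upt: "[Suc 0..<7] = [1, 2, 3, 4, 5, 6]" by (simp add: upt_rec)
  note nbr = nbr_sum_E[of 6, simplified]
  show "two_coloring ?X ?J1 ?J2"
    by (auto simp: two_coloring_def dynkin_adjacent_def)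
  show "i = 4" if "special_node ?X i" for i
    using special_node_E[OF _ that] by simp
  show "0 \<le> ?\<theta> i" for i by (rule list_vec_nonneg) simp
  show "nbr_sum ?X ?\<theta> i \<le> 2 * ?\<theta> i" if "i \<in> nodes ?X" for i
    using that by (cases rule: E_node_cases) (simp_all add: nbr list_vec_def)
  show "nbr_sum ?X ?\<theta> i = 2 * ?\<theta> i" if "i \<in> ?J2" for i
    using that by (elim insertE emptyE) (simp_all add: nbr list_vec_def)
  show "2 \<in> ?J1" "nbr_sum ?X ?\<theta> 2 \<noteq> 2 * ?\<theta> 2"
    by (simp_all add: nbr list_vec_def)
  show "0 \<le> alt_steps ?X ?J1 ?J2 ?\<theta> k i" if "1 \<le> k" "k < 6" for k i
  proof -
    have "k = 1 \<or> k = 2 \<or> k = 3 \<or> k = 4 \<or> k = 5" using that by presburger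
    then show ?thesis
      by (elim disjE) (simp_all add: alt_steps_numeral refl_step_E6[unfolded One_nat_def] list_vec_nonneg)
  qed
  show "alt_steps ?X ?J1 ?J2 ?\<theta> k \<noteq> ?\<theta>" if "1 \<le> k" "k < 6" for k
  proof -
    have "k = 1 \<or> k = 2 \<or> k = 3 \<or> k = 4 \<or> k = 5" using that by presburger
    then show ?thesis
      by (elim disjE) (simp_all add: alt_steps_numeral refl_step_E6[unfolded One_nat_def] list_vec_eq_iff)
  qed
  show "alt_steps ?X ?J1 ?J2 ?\<theta> (6 - 1) = unit_vec 4"
    by (simp add: unit_vec_list_vec[of _ 6] upt alt_steps_numeral refl_step_E6[unfolded One_nat_def])
  show "?\<pi> j \<in> nodes ?X \<and> ?\<pi> (?\<pi> j) = j \<and> (?\<pi> j \<in> ?J1 \<longleftrightarrow> j \<in> ?J1)"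
    if "j \<in> nodes ?X" for j
    using that by (cases rule: E_node_cases) simp_all
  show "(cox_step ?X ?J1 ?J2 ^^ 6) (unit_vec j) = (\<lambda>i. - unit_vec (?\<pi> j) i :: int)"
    if "j \<in> nodes ?X" for j
    using that
    by (cases rule: E_node_cases)
      (simp_all add: unit_vec_list_vec[of _ 6] upt list_vec_uminus cox_step_numeral cox_step_def refl_step_E6[unfolded One_nat_def])
qed simp_all

lemma refl_step_E7:
  shows "refl_step (TypeE 7) {1, 4, 6} (list_vec [a, b, c, d, e, f, g]) =
      list_vec [c - a, b, c, b + c + e - d, e, e + g - f, g]"
    and "refl_step (TypeE 7) {2, 3, 5, 7} (list_vec [a, b, c, d, e, f, g]) =
      list_vec [a, d - b, a + d - c, d, d + f - e, f, f - g]"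
proof -
  show "refl_step (TypeE 7) {1, 4, 6} (list_vec [a, b, c, d, e, f, g]) =
      list_vec [c - a, b, c, b + c + e - d, e, e + g - f, g]" (is "?L = ?R")
  proof
    fix i
    show "?L i = ?R i"
    proof (cases "i \<in> nodes (TypeE 7)")
      case True
      then show ?thesis
        by (cases rule: E_node_cases) (simp_all add: refl_step_def nbr_sum_E[of 7, simplified] list_vec_def)
    next
      case False
      then have "i \<notin> {1, 4, 6}" "i \<notin> {1..7}" by auto
      then show ?thesis by (auto simp: refl_step_def list_vec_def)
    qed
  qed
  show "refl_step (TypeE 7) {2, 3, 5, 7} (list_vec [a, b, c, d, e, f, g]) =
      list_vec [a, d - b, a + d - c, d, d + f - e, f, f - g]" (is "?L = ?R")
  proof
    fix i
    show "?L i = ?R i"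
    proof (cases "i \<in> nodes (TypeE 7)")
      case True
      then show ?thesis
        by (cases rule: E_node_cases) (simp_all add: refl_step_def nbr_sum_E[of 7, simplified] list_vec_def)
    next
      case False
      then have "i \<notin> {2, 3, 5, 7}" "i \<notin> {1..7}" by auto
      then show ?thesis by (auto simp: refl_step_def list_vec_def)
    qed
  qed
qed

text \<open>h = 18. Node 1 determines J1, and as g = 9 is odd the special node 4 lies in J1 too;
  \<pi> is the identity because - 1 belongs to the Weyl group.\<close>

lemma coxeter_data_E7:
  "coxeter_data (TypeE 7) 9 {1, 4, 6} {2, 3, 5, 7}
    (list_vec [2, 2, 3, 4, 3, 2, 1]) 4 (\<lambda>i. i)"
proof (rule coxeter_dataI)
  let ?X = "TypeE 7" and ?J1 = "{1, 4, 6}" and ?J2 = "{2, 3, 5, 7}"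
  let ?\<theta> = "list_vec [2, 2, 3, 4, 3, 2, 1] :: nat \<Rightarrow> int"
  have upt: "[Suc 0..<8] = [1, 2, 3, 4, 5, 6, 7]" by (simp add: upt_rec)
  note nbr = nbr_sum_E[of 7, simplified]
  show "two_coloring ?X ?J1 ?J2"
    by (auto simp: two_coloring_def dynkin_adjacent_def)
  show "i = 4" if "special_node ?X i" for i
    using special_node_E[OF _ that] by simp
  show "0 \<le> ?\<theta> i" for i by (rule list_vec_nonneg) simp
  show "nbr_sum ?X ?\<theta> i \<le> 2 * ?\<theta> i" if "i \<in> nodes ?X" for i
    using that by (cases rule: E_node_cases) (simp_all add: nbr list_vec_def)
  show "nbr_sum ?X ?\<theta> i = 2 * ?\<theta> i" if "i \<in> ?J2" for i
    using that by (elim insertE emptyE) (simp_all add: nbr list_vec_def)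
  show "1 \<in> ?J1" "nbr_sum ?X ?\<theta> 1 \<noteq> 2 * ?\<theta> 1"
    by (simp_all add: nbr list_vec_def)
  show "0 \<le> alt_steps ?X ?J1 ?J2 ?\<theta> k i" if "1 \<le> k" "k < 9" for k i
  proof -
    have "k = 1 \<or> k = 2 \<or> k = 3 \<or> k = 4 \<or> k = 5 \<or> k = 6 \<or> k = 7 \<or> k = 8" using that by presburger
    then show ?thesis
      by (elim disjE) (simp_all add: alt_steps_numeral refl_step_E7[unfolded One_nat_def] list_vec_nonneg)
  qed
  show "alt_steps ?X ?J1 ?J2 ?\<theta> k \<noteq> ?\<theta>" if "1 \<le> k" "k < 9" for k
  proof -
    have "k = 1 \<or> k = 2 \<or> k = 3 \<or> k = 4 \<or> k = 5 \<or> k = 6 \<or> k = 7 \<or> k = 8" using that by presburger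
    then show ?thesis
      by (elim disjE) (simp_all add: alt_steps_numeral refl_step_E7[unfolded One_nat_def] list_vec_eq_iff)
  qed
  show "alt_steps ?X ?J1 ?J2 ?\<theta> (9 - 1) = unit_vec 4"
    by (simp add: unit_vec_list_vec[of _ 7] upt alt_steps_numeral refl_step_E7[unfolded One_nat_def])
  show "j \<in> nodes ?X \<and> j = j \<and> (j \<in> ?J1 \<longleftrightarrow> j \<in> ?J1)"
    if "j \<in> nodes ?X" for j
    using that by (cases rule: E_node_cases) simp_all
  show "(cox_step ?X ?J1 ?J2 ^^ 9) (unit_vec j) = (\<lambda>i. - unit_vec (j) i :: int)"
    if "j \<in> nodes ?X" for j
    using that
    by (cases rule: E_node_cases)
      (simp_all add: unit_vec_list_vec[of _ 7] upt list_vec_uminus cox_step_numeral cox_step_def refl_step_E7[unfolded One_nat_def])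
qed simp_all

lemma refl_step_E8:
  shows "refl_step (TypeE 8) {1, 4, 6, 8} (list_vec [a, b, c, d, e, f, g, h]) =
      list_vec [c - a, b, c, b + c + e - d, e, e + g - f, g, g - h]"
    and "refl_step (TypeE 8) {2, 3, 5, 7} (list_vec [a, b, c, d, e, f, g, h]) =
      list_vec [a, d - b, a + d - c, d, d + f - e, f, f + h - g, h]"
proof -
  show "refl_step (TypeE 8) {1, 4, 6, 8} (list_vec [a, b, c, d, e, f, g, h]) =
      list_vec [c - a, b, c, b + c + e - d, e, e + g - f, g, g - h]" (is "?L = ?R")
  proof
    fix i
    show "?L i = ?R i"
    proof (cases "i \<in> nodes (TypeE 8)")
      case True
      then show ?thesis
        by (cases rule: E_node_cases) (simp_all add: refl_step_def nbr_sum_E[of 8, simplified] list_vec_def)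
    next
      case False
      then have "i \<notin> {1, 4, 6, 8}" "i \<notin> {1..8}" by auto
      then show ?thesis by (auto simp: refl_step_def list_vec_def)
    qed
  qed
  show "refl_step (TypeE 8) {2, 3, 5, 7} (list_vec [a, b, c, d, e, f, g, h]) =
      list_vec [a, d - b, a + d - c, d, d + f - e, f, f + h - g, h]" (is "?L = ?R")
  proof
    fix i
    show "?L i = ?R i"
    proof (cases "i \<in> nodes (TypeE 8)")
      case True
      then show ?thesis
        by (cases rule: E_node_cases) (simp_all add: refl_step_def nbr_sum_E[of 8, simplified] list_vec_def)
    next
      case False
      then have "i \<notin> {2, 3, 5, 7}" "i \<notin> {1..8}" by auto
      then show ?thesis by (auto simp: refl_step_def list_vec_def)
    qed
  qed
qed

text \<open>h = 30. The simple root not orthogonal to the highest root is at node 8, the end of the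
  long arm; g = 15 is odd, and again \<pi> is trivial.\<close>

lemma coxeter_data_E8:
  "coxeter_data (TypeE 8) 15 {1, 4, 6, 8} {2, 3, 5, 7}
    (list_vec [2, 3, 4, 6, 5, 4, 3, 2]) 4 (\<lambda>i. i)"
proof (rule coxeter_dataI)
  let ?X = "TypeE 8" and ?J1 = "{1, 4, 6, 8}" and ?J2 = "{2, 3, 5, 7}"
  let ?\<theta> = "list_vec [2, 3, 4, 6, 5, 4, 3, 2] :: nat \<Rightarrow> int"
  have upt: "[Suc 0..<9] = [1, 2, 3, 4, 5, 6, 7, 8]" by (simp add: upt_rec)
  note nbr = nbr_sum_E[of 8, simplified]
  show "two_coloring ?X ?J1 ?J2"
    by (auto simp: two_coloring_def dynkin_adjacent_def)
  show "i = 4" if "special_node ?X i" for i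
    using special_node_E[OF _ that] by simp
  show "0 \<le> ?\<theta> i" for i by (rule list_vec_nonneg) simp
  show "nbr_sum ?X ?\<theta> i \<le> 2 * ?\<theta> i" if "i \<in> nodes ?X" for i
    using that by (cases rule: E_node_cases) (simp_all add: nbr list_vec_def)
  show "nbr_sum ?X ?\<theta> i = 2 * ?\<theta> i" if "i \<in> ?J2" for i
    using that by (elim insertE emptyE) (simp_all add: nbr list_vec_def)
  show "8 \<in> ?J1" "nbr_sum ?X ?\<theta> 8 \<noteq> 2 * ?\<theta> 8"
    by (simp_all add: nbr list_vec_def)
  show "0 \<le> alt_steps ?X ?J1 ?J2 ?\<theta> k i" if "1 \<le> k" "k < 15" for k i
  proof -
    have "k = 1 \<or> k = 2 \<or> k = 3 \<or> k = 4 \<or> k = 5 \<or> k = 6 \<or> k = 7 \<or> k = 8 \<or> k = 9 \<or> k = 10 \<or> k = 11 \<or> k = 12 \<or> k = 13 \<or> k = 14" using that by presburger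
    then show ?thesis
      by (elim disjE) (simp_all add: alt_steps_numeral refl_step_E8[unfolded One_nat_def] list_vec_nonneg)
  qed
  show "alt_steps ?X ?J1 ?J2 ?\<theta> k \<noteq> ?\<theta>" if "1 \<le> k" "k < 15" for k
  proof -
    have "k = 1 \<or> k = 2 \<or> k = 3 \<or> k = 4 \<or> k = 5 \<or> k = 6 \<or> k = 7 \<or> k = 8 \<or> k = 9 \<or> k = 10 \<or> k = 11 \<or> k = 12 \<or> k = 13 \<or> k = 14" using that by presburger
    then show ?thesis
      by (elim disjE) (simp_all add: alt_steps_numeral refl_step_E8[unfolded One_nat_def] list_vec_eq_iff)
  qed
  show "alt_steps ?X ?J1 ?J2 ?\<theta> (15 - 1) = unit_vec 4"
    by (simp add: unit_vec_list_vec[of _ 8] upt alt_steps_numeral refl_step_E8[unfolded One_nat_def])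
  show "j \<in> nodes ?X \<and> j = j \<and> (j \<in> ?J1 \<longleftrightarrow> j \<in> ?J1)"
    if "j \<in> nodes ?X" for j
    using that by (cases rule: E_node_cases) simp_all
  show "(cox_step ?X ?J1 ?J2 ^^ 15) (unit_vec j) = (\<lambda>i. - unit_vec (j) i :: int)"
    if "j \<in> nodes ?X" for j
    using that
    by (cases rule: E_node_cases)
      (simp_all add: unit_vec_list_vec[of _ 8] upt list_vec_uminus cox_step_numeral cox_step_def refl_step_E8[unfolded One_nat_def])
qed simp_all

section \<open>The simply laced root system\<close>

lemma coxeter_data_exists:
  assumes "admissible_type X"
  shows "\<exists>g J1 J2 \<theta> s \<pi>. coxeter_data X g J1 J2 \<theta> s \<pi>"
proof (cases X)
  case (TypeA l)
  then have "odd l" using assms by simp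
  then have l: "l = 2 * ((l + 1) div 2) - 1" "1 \<le> (l + 1) div 2" by presburger+
  show ?thesis unfolding TypeA by (subst l(1), intro exI, rule coxeter_data_A[OF l(2)])
next
  case (TypeD l)
  then have "l = (l - 4) + 4" using assms by simp
  then obtain n where l: "l = n + 4" by blast
  show ?thesis unfolding TypeD l by (intro exI, rule coxeter_data_D)
next
  case (TypeE l)
  then have "l = 6 \<or> l = 7 \<or> l = 8" using assms by simp
  then show ?thesis
  proof (elim disjE)
    assume l: "l = 6"
    show ?thesis unfolding TypeE l by (intro exI, rule coxeter_data_E6)
  next
    assume l: "l = 7"
    show ?thesis unfolding TypeE l by (intro exI, rule coxeter_data_E7)
  next
    assume l: "l = 8"
    show ?thesis unfolding TypeE l by (intro exI, rule coxeter_data_E8)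
  qed
qed

section \<open>Linearity and transfer from integral to complex coordinates\<close>

lemma refl_step_of_int: "refl_step X J (\<lambda>i. of_int (c i)) = (\<lambda>i. of_int (refl_step X J c i))"
  by (auto simp: refl_step_def nbr_sum_def)

lemma cox_step_of_int:
  "(cox_step X J1 J2 ^^ n) (\<lambda>i. of_int (c i)) = (\<lambda>i. of_int ((cox_step X J1 J2 ^^ n) c i))"
  by (induction n) (simp_all add: cox_step_def refl_step_of_int)

lemma refl_step_lincomb:
  "refl_step X J (\<lambda>i. \<Sum>j\<in>A. c j * F j i) = (\<lambda>i. \<Sum>j\<in>A. c j * refl_step X J (F j) i)"
proof
  fix i
  have "nbr_sum X (\<lambda>i. \<Sum>j\<in>A. c j * F j i) i = (\<Sum>j\<in>A. c j * nbr_sum X (F j) i)"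
    unfolding nbr_sum_def by (subst sum.swap) (simp add: sum_distrib_left)
  then show "refl_step X J (\<lambda>i. \<Sum>j\<in>A. c j * F j i) i = (\<Sum>j\<in>A. c j * refl_step X J (F j) i)"
    by (simp add: refl_step_def right_diff_distrib sum_subtractf)
qed

lemma cox_step_lincomb:
  "(cox_step X J1 J2 ^^ n) (\<lambda>i. \<Sum>j\<in>A. c j * F j i) = (\<lambda>i. \<Sum>j\<in>A. c j * (cox_step X J1 J2 ^^ n) (F j) i)"
  by (induction n) (simp_all add: cox_step_def refl_step_lincomb)

lemma cox_step_uminus:
  "(cox_step X J1 J2 ^^ n) (\<lambda>i. - c i) = (\<lambda>i. - (cox_step X J1 J2 ^^ n) c i)"
  by (induction n) (simp_all add: cox_step_def refl_step_uminus)

text \<open>For \<sigma> = \<tau>2 \<tau>1 with involutions \<tau>1, \<tau>2 one has \<sigma> \<tau>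
  \<sigma> = \<tau> for either of them. Each induction step removes one factor \<sigma> on both
  sides.\<close>

lemma cox_step_conjugation:
  assumes "two_coloring X J1 J2"
  shows "(cox_step X J1 J2 ^^ n) (refl_step X J1 ((cox_step X J1 J2 ^^ n) c)) = refl_step X J1 c"
    and "(cox_step X J1 J2 ^^ n) (refl_step X J2 ((cox_step X J1 J2 ^^ n) c)) = refl_step X J2 c"
proof -
  have inv: "refl_step X J1 (refl_step X J1 c) = c" "refl_step X J2 (refl_step X J2 c) = c" for c :: "nat \<Rightarrow> 'a"
    using assms by (auto simp: two_coloring_def intro!: refl_step_involutive)
  show "(cox_step X J1 J2 ^^ n) (refl_step X J1 ((cox_step X J1 J2 ^^ n) c)) = refl_step X J1 c"
  proof (induction n arbitrary: c)
    case (Suc n)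
    have "(cox_step X J1 J2 ^^ Suc n) (refl_step X J1 ((cox_step X J1 J2 ^^ Suc n) c))
        = cox_step X J1 J2 ((cox_step X J1 J2 ^^ n) (refl_step X J1 ((cox_step X J1 J2 ^^ n) (cox_step X J1 J2 c))))"
      by (simp add: funpow_swap1)
    also have "\<dots> = refl_step X J1 c" unfolding Suc by (simp add: cox_step_def inv)
    finally show ?case .
  qed simp
  show "(cox_step X J1 J2 ^^ n) (refl_step X J2 ((cox_step X J1 J2 ^^ n) c)) = refl_step X J2 c"
  proof (induction n arbitrary: c)
    case (Suc n)
    have "(cox_step X J1 J2 ^^ Suc n) (refl_step X J2 ((cox_step X J1 J2 ^^ Suc n) c))
        = cox_step X J1 J2 ((cox_step X J1 J2 ^^ n) (refl_step X J2 ((cox_step X J1 J2 ^^ n) (cox_step X J1 J2 c))))"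
      by (simp add: funpow_swap1)
    also have "\<dots> = refl_step X J2 c" unfolding Suc by (simp add: cox_step_def inv)
    finally show ?case .
  qed simp
qed

text \<open>On unit vectors \<sigma>^g is - \<pi> with an involution \<pi>, so its square is the
  identity, and linearity extends this to every ring. The support condition makes c a sum of unit
  vectors.\<close>

lemma coxeter_data_period:
  fixes c :: "nat \<Rightarrow> 'a::comm_ring_1"
  assumes D: "coxeter_data X g J1 J2 \<theta> s \<pi>" and supp: "\<And>i. i \<notin> nodes X \<Longrightarrow> c i = 0"
  shows "(cox_step X J1 J2 ^^ g) ((cox_step X J1 J2 ^^ g) c) = c"
proof -
  let ?C = "cox_step X J1 J2"
  have c: "c = (\<lambda>i. \<Sum>j\<in>nodes X. c j * of_int (unit_vec j i))"
  proof
    fix i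
    have "(\<Sum>j\<in>nodes X. c j * of_int (unit_vec j i)) = (\<Sum>j\<in>nodes X. if i = j then c j else 0)"
      by (intro sum.cong) (auto simp: unit_vec_def)
    then show "c i = (\<Sum>j\<in>nodes X. c j * of_int (unit_vec j i))" using supp by simp
  qed
  have unit: "(?C ^^ g) ((?C ^^ g) (unit_vec j)) = (unit_vec j :: nat \<Rightarrow> int)" if "j \<in> nodes X" for j
  proof -
    have 1: "(?C ^^ g) (unit_vec j) = (\<lambda>i. - unit_vec (\<pi> j) i :: int)" "\<pi> j \<in> nodes X" "\<pi> (\<pi> j) = j"
      using D that unfolding coxeter_data_def by blast+
    have "(?C ^^ g) (unit_vec (\<pi> j)) = (\<lambda>i. - unit_vec (\<pi> (\<pi> j)) i :: int)"
      using D 1(2) unfolding coxeter_data_def by blast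
    then show ?thesis using 1 by (simp add: cox_step_uminus)
  qed
  have "(?C ^^ g) ((?C ^^ g) c) = (\<lambda>i. \<Sum>j\<in>nodes X. c j * of_int ((?C ^^ g) ((?C ^^ g) (unit_vec j)) i))"
    by (subst c) (simp only: cox_step_lincomb cox_step_of_int)
  also have "\<dots> = (\<lambda>i. \<Sum>j\<in>nodes X. c j * of_int (unit_vec j i))"
    using unit by (intro ext sum.cong) simp_all
  also have "\<dots> = c" by (rule c[symmetric])
  finally show ?thesis .
qed

lemma alt_steps_outside:
  assumes "J1 \<subseteq> nodes X" "J2 \<subseteq> nodes X" "i \<notin> nodes X"
  shows "alt_steps X J1 J2 c k i = c i"
  using assms by (induction k) (auto simp: refl_step_def)

section \<open>The integral Cartan form\<close>

locale lie_ade = lie_simple_roots L H l \<alpha>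
  for L :: "'g::ab_group_add lie_structure" and H l \<alpha> +
  fixes X :: dynkin_type
  assumes admissible: "admissible_type X" and rank: "l = type_rank X"
    and dynkin: "has_dynkin_type L H \<alpha> X"
begin

text \<open>Half the common squared length of the simple roots. It is just a complex number at this
  point; its sign is settled inside the proof of \<open>qf_positive_definite\<close>.\<close>

definition \<kappa> :: complex where
  "\<kappa> = fm (\<alpha> 1) (\<alpha> 1) / 2"

definition cart_row :: "(nat \<Rightarrow> 'a::comm_ring_1) \<Rightarrow> nat \<Rightarrow> 'a" where
  "cart_row c i = 2 * c i - nbr_sum X c i"

text \<open>The form rescaled so that simple roots have norm 2; by \<open>form_icomb\<close> the
  original form is \<kappa> times this one.\<close>

definition qf :: "(nat \<Rightarrow> int) \<Rightarrow> (nat \<Rightarrow> int) \<Rightarrow> int" where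
  "qf c d = (\<Sum>i\<in>{1..l}. c i * cart_row d i)"

lemma cartan_entry:
  "i \<in> {1..l} \<Longrightarrow> j \<in> {1..l} \<Longrightarrow> 2 * fm (\<alpha> i) (\<alpha> j) / fm (\<alpha> j) (\<alpha> j)
    = (if i = j then 2 else if dynkin_adjacent X i j then - 1 else 0)"
  using dynkin rank by (simp add: has_dynkin_type_def)

lemma simple_root_norm_nonzero: "i \<in> {1..l} \<Longrightarrow> fm (\<alpha> i) (\<alpha> i) \<noteq> 0"
  using cartan_entry[of i i] by auto

text \<open>For adjacent nodes the Cartan entries are - 1 in both directions, so both norms equal -
  2 (\<alpha> i, \<alpha> j); connectedness spreads the equality.\<close>

lemma simple_root_norm:
  assumes "i \<in> {1..l}"
  shows "fm (\<alpha> i) (\<alpha> i) = 2 * \<kappa>"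
proof (rule dynkin_connected[OF admissible, of "\<lambda>i. fm (\<alpha> i) (\<alpha> i) = 2 * \<kappa>" 1])
  fix i j assume ij: "i \<in> nodes X" "j \<in> nodes X" "dynkin_adjacent X i j" "fm (\<alpha> i) (\<alpha> i) = 2 * \<kappa>"
  have ne: "i \<noteq> j" using ij(3) adjacent_irrefl[OF admissible] by auto
  have "2 * fm (\<alpha> i) (\<alpha> j) = - fm (\<alpha> j) (\<alpha> j)"
    using cartan_entry[of i j] simple_root_norm_nonzero[of j] ij ne rank by (simp add: field_simps)
  moreover have "2 * fm (\<alpha> j) (\<alpha> i) = - fm (\<alpha> i) (\<alpha> i)"
    using cartan_entry[of j i] simple_root_norm_nonzero[of i] ij ne rank adjacent_sym[of X j i]
    by (simp add: field_simps)
  ultimately show "fm (\<alpha> j) (\<alpha> j) = 2 * \<kappa>" using ij(4) form_sym[of "\<alpha> i" "\<alpha> j"] by simp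
qed (use assms rank rank_pos in \<open>auto simp: \<kappa>_def\<close>)

lemma \<kappa>_nonzero: "\<kappa> \<noteq> 0"
  using simple_root_norm_nonzero[of 1] simple_root_norm[of 1] rank_pos by auto

lemma form_comb_simple:
  assumes i: "i \<in> {1..l}"
  shows "fm (comb c) (\<alpha> i) = \<kappa> * cart_row c i"
proof -
  have *: "fm (\<alpha> j) (\<alpha> i) = \<kappa> * (if j = i then 2 else if dynkin_adjacent X i j then - 1 else 0)"
    if "j \<in> {1..l}" for j
    using cartan_entry[OF that i] simple_root_norm[OF i] \<kappa>_nonzero adjacent_sym[of X i j]
    by (auto simp: field_simps split: if_splits)
  have "fm (comb c) (\<alpha> i) = (\<Sum>j\<in>{1..l}. c j * fm (\<alpha> j) (\<alpha> i))"
    by (rule form_comb[OF simple_root_dual[OF i]])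
  also have "\<dots> = (\<Sum>j\<in>{1..l}. \<kappa> * ((if j = i then 2 * c j else 0) - (if dynkin_adjacent X i j then c j else 0)))"
    using * adjacent_irrefl[OF admissible, of i] by (intro sum.cong) auto
  also have "\<dots> = \<kappa> * (2 * c i - (\<Sum>j\<in>{1..l}. if dynkin_adjacent X i j then c j else 0))"
    using i by (simp add: sum_distrib_left[symmetric] sum_subtractf)
  also have "(\<Sum>j\<in>{1..l}. if dynkin_adjacent X i j then c j else 0) = nbr_sum X c i"
    unfolding nbr_sum_def rank[symmetric] by (rule sum.inter_filter[symmetric]) simp
  finally show ?thesis by (simp add: cart_row_def)
qed

lemma cart_row_of_int: "cart_row (\<lambda>i. of_int (c i)) i = of_int (cart_row c i)"
  by (simp add: cart_row_def nbr_sum_def)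

lemma form_icomb: "fm (icomb c) (icomb d) = \<kappa> * of_int (qf c d)"
proof -
  have "fm (icomb c) (icomb d) = (\<Sum>i\<in>{1..l}. of_int (c i) * fm (\<alpha> i) (icomb d))"
    by (rule form_comb[OF comb_dual])
  also have "\<dots> = (\<Sum>i\<in>{1..l}. \<kappa> * of_int (c i * cart_row d i))"
    by (intro sum.cong) (simp_all add: form_sym[of "\<alpha> _"] form_comb_simple cart_row_of_int)
  finally show ?thesis by (simp add: qf_def sum_distrib_left)
qed

lemma qf_sym: "qf c d = qf d c"
  using form_icomb[of c d] form_icomb[of d c] form_sym[of "icomb c" "icomb d"] \<kappa>_nonzero by simp

text \<open>\<open>form_sum_weights\<close> gives \<kappa> qf(c, c) = \<kappa>^2 S(c), where S is a
  sum of integer squares over the weights, so positivity holds for all types at once. If S(c) = 0,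
  the vector is orthogonal to all weights and hence 0.\<close>

lemma qf_positive_definite:
  shows "0 \<le> qf c c" and "qf c c = 0 \<Longrightarrow> i \<in> {1..l} \<Longrightarrow> c i = 0"
proof -
  have "\<forall>b\<in>wb. \<exists>c. wt b = icomb c" using weight_icomb by blast
  from bchoice[OF this] obtain wc where wc: "\<And>b. b \<in> wb \<Longrightarrow> wt b = icomb (wc b)" by blast
  define S where "S c = (\<Sum>b\<in>wb. (qf (wc b) c)\<^sup>2)" for c
  have S: "of_int (qf c c) = \<kappa> * of_int (S c)" for c
  proof -
    have "\<kappa> * of_int (qf c c) = (\<Sum>b\<in>wb. fm (wt b) (icomb c) * fm (wt b) (icomb c))"
      unfolding form_icomb[symmetric] by (rule form_sum_weights[OF comb_dual comb_dual])
    also have "\<dots> = (\<Sum>b\<in>wb. \<kappa> * (\<kappa> * of_int ((qf (wc b) c)\<^sup>2)))"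
      by (intro sum.cong) (simp_all add: wc form_icomb power2_eq_square)
    also have "\<dots> = \<kappa> * (\<kappa> * of_int (S c))" by (simp add: S_def sum_distrib_left)
    finally show ?thesis using \<kappa>_nonzero by simp
  qed
  have S_nonneg: "0 \<le> S c" for c by (simp add: S_def sum_nonneg)
  have "qf (unit_vec 1) (unit_vec 1) = 2"
  proof -
    have "icomb (unit_vec 1) = \<alpha> 1"
      using comb_unit[of 1] rank_pos by (simp add: unit_vec_def if_distrib[of of_int] cong: if_cong)
    then have "\<kappa> * of_int (qf (unit_vec 1) (unit_vec 1)) = \<kappa> * 2"
      unfolding form_icomb[symmetric] using simple_root_norm[of 1] rank_pos by simp
    then show ?thesis using \<kappa>_nonzero by (metis mult_cancel_left of_int_eq_numeral_iff)
  qed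
  then have S1: "2 = \<kappa> * of_int (S (unit_vec 1))" using S[of "unit_vec 1"] by simp
  then have S1_pos: "0 < S (unit_vec 1)" using S_nonneg[of "unit_vec 1"] by (cases "S (unit_vec 1) = 0") auto
  \<comment> \<open>Multiplication with the relation 2 = \<kappa> S of the first simple root
    eliminates \<kappa> and leaves an equation between integers.\<close>
  have "complex_of_int (qf c c * S (unit_vec 1)) = of_int (2 * S c)" for c
    using S[of c] S1 by (simp add: mult.commute mult.left_commute)
  then have eq: "qf c c * S (unit_vec 1) = 2 * S c" for c unfolding of_int_eq_iff .
  show "0 \<le> qf c c"
    using eq[of c] S_nonneg[of c] S1_pos by (metis mult_nonneg_nonneg zero_le_mult_iff not_less zero_le_numeral)
  assume "qf c c = 0" and i: "i \<in> {1..l}"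
  then have "S c = 0" using eq[of c] by simp
  then have "\<forall>b\<in>wb. (qf (wc b) c)\<^sup>2 = 0"
    unfolding S_def using sum_nonneg_eq_0_iff[OF wb_finite, of "\<lambda>b. (qf (wc b) c)\<^sup>2"] by simp
  then have "wt b (tv (icomb c)) = 0" if "b \<in> wb" for b
    using that form_eval[OF wt_dual[OF that] comb_dual, of "\<lambda>i. of_int (c i)"] by (simp add: wc form_icomb)
  then have "tv (icomb c) = 0" by (intro weights_separate tv_H comb_dual)
  then have "icomb c = comb (\<lambda>_. 0)"
    unfolding comb_0 using killing_tv[OF comb_dual, of _ "\<lambda>i. of_int (c i)"] dual_outside[OF comb_dual]
    by (intro ext) (metis killing_zero(1))
  from comb_eqD[OF this i] show "c i = 0" by simp
qed

lemma root_norm_nonzero: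
  assumes "\<beta> \<in> roots L H"
  shows "fm \<beta> \<beta> \<noteq> 0"
proof
  obtain c where c: "\<beta> = icomb c" using root_icomb[OF assms] by blast
  assume "fm \<beta> \<beta> = 0"
  then have "qf c c = 0" using \<kappa>_nonzero by (simp add: c form_icomb)
  then have "\<beta> = comb (\<lambda>_. 0)" unfolding c using qf_positive_definite(2) by (intro comb_cong) simp
  then show False using root_nonzero[OF assms] by (simp add: comb_0)
qed

section \<open>Simple reflections in coordinates\<close>

lemma reflection_comb:
  assumes i: "i \<in> {1..l}"
  shows "reflection L H (\<alpha> i) (comb c) = comb (refl_step X {i} c)"
proof
  fix h
  have "2 * fm (comb c) (\<alpha> i) / fm (\<alpha> i) (\<alpha> i) = cart_row c i"
    using \<kappa>_nonzero by (simp add: form_comb_simple[OF i] simple_root_norm[OF i])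
  then have "reflection L H (\<alpha> i) (comb c) h = comb c h - cart_row c i * \<alpha> i h"
    by (simp add: reflection_def)
  also have "\<dots> = (\<Sum>j\<in>{1..l}. c j * \<alpha> j h) - (\<Sum>j\<in>{1..l}. if j = i then cart_row c j * \<alpha> j h else 0)"
    using i by (simp add: comb_def)
  also have "\<dots> = (\<Sum>j\<in>{1..l}. refl_step X {i} c j * \<alpha> j h)"
    unfolding sum_subtractf[symmetric]
    by (intro sum.cong) (auto simp: refl_step_def cart_row_def algebra_simps)
  finally show "reflection L H (\<alpha> i) (comb c) h = comb (refl_step X {i} c) h" by (simp add: comb_def)
qed

text \<open>J has no adjacent nodes, so no earlier reflection in the product changes a neighbour of
  i, and reflecting one after the other is the simultaneous update.\<close>

lemma refl_prod_comb:
  assumes J: "J \<subseteq> {1..l}" and ind: "\<forall>i\<in>J. \<forall>j\<in>J. \<not> dynkin_adjacent X i j"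
  shows "refl_prod L H \<alpha> J (comb c) = comb (refl_step X J c)"
proof -
  have "foldr (\<lambda>i w. reflection L H (\<alpha> i) \<circ> w) is id (comb c) = comb (refl_step X (set is) c)"
    if "distinct is" "set is \<subseteq> J" for "is"
    using that
  proof (induction "is")
    case Nil
    then show ?case by (simp add: refl_step_def)
  next
    case (Cons i "is")
    have "nbr_sum X (refl_step X (set is) c) i = nbr_sum X c i"
      unfolding nbr_sum_def using Cons.prems ind by (intro sum.cong) (auto simp: refl_step_def)
    then have "refl_step X {i} (refl_step X (set is) c) = refl_step X (set (i # is)) c"
      using Cons.prems unfolding refl_step_def[of X "{i}"] refl_step_def[of X "set (i # is)"]
      by (auto simp: refl_step_def fun_eq_iff)
    then show ?case using Cons reflection_comb[of i "refl_step X (set is) c"] J by auto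
  qed
  from this[of "sorted_list_of_set J"] show ?thesis
    using finite_subset[OF J] by (simp add: refl_prod_def)
qed

text \<open>For a simple root the Cartan number is \<open>cart_row c i\<close>, an integer because
  roots have integer coordinates; this is the integrality that \<open>root_string_signed\<close>
  asks for.\<close>

lemma reflection_root:
  assumes "i \<in> {1..l}" "\<beta> \<in> roots L H"
  shows "reflection L H (\<alpha> i) \<beta> \<in> roots L H"
proof -
  obtain c where c: "\<beta> = icomb c" using root_icomb[OF assms(2)] by blast
  show ?thesis
  proof (rule root_string_signed[OF assms(2) simple_root[OF assms(1)] root_norm_nonzero])
    show "2 * fm \<beta> (\<alpha> i) / fm (\<alpha> i) (\<alpha> i) = of_int (cart_row c i)"
      using \<kappa>_nonzero
      by (simp add: c form_comb_simple[OF assms(1)] simple_root_norm[OF assms(1)] cart_row_of_int)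
  qed
qed

lemma refl_prod_root:
  assumes "J \<subseteq> {1..l}" "\<beta> \<in> roots L H"
  shows "refl_prod L H \<alpha> J \<beta> \<in> roots L H"
proof -
  have "foldr (\<lambda>i w. reflection L H (\<alpha> i) \<circ> w) is id \<beta> \<in> roots L H" if "set is \<subseteq> {1..l}" for "is"
    using that assms(2) by (induction "is") (auto intro: reflection_root)
  then show ?thesis
    using finite_subset[OF assms(1)] assms(1) by (simp add: refl_prod_def)
qed

lemma qf_refl_step:
  assumes i: "i \<in> {1..l}"
  shows "qf (refl_step X {i} c) (refl_step X {i} c) = qf c c"
proof -
  define \<mu> where "\<mu> = icomb c"
  define k where "k = 2 * fm \<mu> (\<alpha> i) / fm (\<alpha> i) (\<alpha> i)"
  have \<mu>: "\<mu> \<in> cartan_dual L H" by (simp add: \<mu>_def comb_dual)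
  note \<alpha> = simple_root_dual[OF i]
  define \<nu> where "\<nu> = reflection L H (\<alpha> i) \<mu>"
  have \<nu>: "\<nu> = icomb (refl_step X {i} c)"
    by (simp add: \<nu>_def \<mu>_def reflection_comb[OF i] refl_step_of_int)
  then have \<nu>d: "\<nu> \<in> cartan_dual L H" by (simp add: comb_dual)
  have lin: "fm \<nu> \<xi> = fm \<mu> \<xi> - k * fm (\<alpha> i) \<xi>" if "\<xi> \<in> cartan_dual L H" for \<xi>
    using that \<mu> \<alpha> \<nu>d by (simp add: form_eval) (simp add: \<nu>_def reflection_def k_def form_eval[OF \<mu> \<alpha>] form_eval[OF \<alpha> \<alpha>])
  have kk: "k * fm (\<alpha> i) (\<alpha> i) = 2 * fm \<mu> (\<alpha> i)"
    using simple_root_norm_nonzero[OF i] by (simp add: k_def)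
  have "fm \<nu> \<nu> = fm \<mu> \<nu> - k * fm (\<alpha> i) \<nu>" by (rule lin[OF \<nu>d])
  also have "\<dots> = fm \<nu> \<mu> - k * fm \<nu> (\<alpha> i)" by (simp add: form_sym[of _ \<nu>])
  also have "\<dots> = fm \<mu> \<mu> - k * fm (\<alpha> i) \<mu> - k * (fm \<mu> (\<alpha> i) - k * fm (\<alpha> i) (\<alpha> i))"
    by (simp add: lin[OF \<mu>] lin[OF \<alpha>])
  also have "\<dots> = fm \<mu> \<mu>" unfolding kk by (simp add: form_sym[of "\<alpha> i" \<mu>])
  finally show ?thesis using \<kappa>_nonzero unfolding \<nu> \<mu>_def form_icomb by simp
qed

text \<open>Simple reflections lower the height of a positive root until it becomes simple.\<close>

lemma positive_root_norm:
  assumes "icomb c \<in> roots L H" "\<forall>i\<in>{1..l}. 0 \<le> c i"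
  shows "qf c c = 2"
  using assms
proof (induction "nat (\<Sum>i\<in>{1..l}. c i)" arbitrary: c rule: less_induct)
  case less
  have "qf c c \<noteq> 0" using root_norm_nonzero[OF less.prems(1)] by (auto simp: form_icomb)
  then have "0 < (\<Sum>i\<in>{1..l}. c i * cart_row c i)"
    using qf_positive_definite(1)[of c] by (simp add: qf_def)
  \<comment> \<open>A positive sum has a positive term; as c i \<ge> 0, both of its factors are
    positive, so the reflection at i lowers that coordinate.\<close>
  then obtain i where i: "i \<in> {1..l}" "0 < c i * cart_row c i"
    by (meson not_less sum_nonpos)
  have ci: "0 < c i" "0 < cart_row c i"
    using i less.prems(2) by (auto simp: zero_less_mult_iff dest: bspec[of _ _ i])
  define c' where "c' = refl_step X {i} c"
  have c': "c' j = (if j = i then c i - cart_row c i else c j)" for j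
    by (simp add: c'_def refl_step_def cart_row_def)
  have root: "icomb c' \<in> roots L H"
    using reflection_root[OF i(1) less.prems(1)] by (simp add: reflection_comb[OF i(1)] refl_step_of_int c'_def)
  obtain d where d: "icomb c' = icomb d" "(\<forall>i\<in>{1..l}. 0 \<le> d i) \<or> (\<forall>i\<in>{1..l}. d i \<le> 0)"
    using root_icomb[OF root] by blast
  have "c' j = d j" if "j \<in> {1..l}" for j using comb_eqD[OF d(1) that] by simp
  then consider "\<forall>i\<in>{1..l}. 0 \<le> c' i" | "\<forall>i\<in>{1..l}. c' i \<le> 0" using d(2) by auto
  then show ?case
  proof cases
    case 1
    have "(\<Sum>j\<in>{1..l}. c' j) < (\<Sum>j\<in>{1..l}. c j)"
      using i(1) ci(2) by (intro sum_strict_mono_ex1) (auto simp: c')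
    moreover have "0 \<le> (\<Sum>j\<in>{1..l}. c' j)" using 1 by (intro sum_nonneg) blast
    ultimately have "qf c' c' = 2" using less.hyps[of c'] root 1 by simp
    then show ?thesis using qf_refl_step[OF i(1), of c] by (simp add: c'_def)
  next
    case 2
    \<comment> \<open>The reflection changes coordinate i only. If the result is nonpositive, the
      other coordinates were 0 already, so the root is a multiple of \<alpha> i and hence \<alpha> i
      itself.\<close>
    have zero: "c j = 0" if "j \<in> {1..l}" "j \<noteq> i" for j
      using 2 less.prems(2) that c'[of j] by (auto intro!: order.antisym dest: bspec[of _ _ j])
    have eq: "icomb c = (\<lambda>h. of_int (c i) * \<alpha> i h)"
    proof
      fix h
      have "icomb c h = (\<Sum>j\<in>{1..l}. if j = i then of_int (c j) * \<alpha> j h else 0)"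
        unfolding comb_def using zero by (intro sum.cong) auto
      then show "icomb c h = of_int (c i) * \<alpha> i h" using i(1) by simp
    qed
    then have "c i = 1 \<or> c i = - 1"
      using int_multiple_root[OF simple_root[OF i(1)] simple_root_norm_nonzero[OF i(1)], of "c i"] less.prems(1) by simp
    then have "icomb c = \<alpha> i" using eq ci(1) by auto
    then have "\<kappa> * of_int (qf c c) = \<kappa> * 2"
      unfolding form_icomb[symmetric] using simple_root_norm[OF i(1)] by simp
    then show ?thesis using \<kappa>_nonzero by (metis mult_cancel_left of_int_eq_numeral_iff)
  qed
qed

section \<open>Identification of the highest root and of the partition\<close>

lemma qf_diff: "qf (\<lambda>i. c i - d i) (\<lambda>i. c i - d i) = qf c c - qf c d - qf d c + qf d d"
proof -
  have "cart_row (\<lambda>i. c i - d i) i = cart_row c i - cart_row d i" for i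
    by (simp add: cart_row_def nbr_sum_def sum_subtractf)
  then show ?thesis
    by (simp add: qf_def left_diff_distrib right_diff_distrib sum_subtractf)
qed

text \<open>The highest root \<open>\<psi>\<close> is \<open>\<theta>\<close>: both have norm 2, and \<open>(\<psi>, \<theta>) \<ge> (\<theta>, \<theta>) = 2\<close> since \<open>\<psi> - \<theta>\<close> is a
  nonnegative combination and \<open>\<theta>\<close> is dominant.\<close>

lemma highest_root_unique:
  assumes \<psi>: "highest_root L H l \<alpha> \<psi>"
    and \<theta>: "icomb \<theta> \<in> roots L H" "\<forall>i\<in>{1..l}. 0 \<le> \<theta> i" "\<forall>i\<in>{1..l}. 0 \<le> cart_row \<theta> i"
  shows "\<psi> = icomb \<theta>"
proof -
  have root: "\<psi> \<in> roots L H" using \<psi> by (simp add: highest_root_def)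
  obtain p where p: "\<psi> = icomb p" using root_icomb[OF root] by blast
  have "nonneg_comb l \<alpha> (\<psi> - icomb \<theta>)" using \<psi> \<theta>(1) by (simp add: highest_root_def)
  then obtain e where e: "\<psi> - icomb \<theta> = icomb e" "\<forall>i\<in>{1..l}. 0 \<le> e i" unfolding nonneg_comb_iff by blast
  have "comb (\<lambda>i. of_int (p i) - of_int (\<theta> i)) = icomb e" using e(1) by (simp add: p comb_diff)
  then have "complex_of_int (p i) - of_int (\<theta> i) = of_int (e i)" if "i \<in> {1..l}" for i
    using comb_eqD that by blast
  then have "complex_of_int (p i - \<theta> i) = of_int (e i)" if "i \<in> {1..l}" for i using that by simp
  then have pe: "p i - \<theta> i = e i" if "i \<in> {1..l}" for i using that unfolding of_int_eq_iff .
  have "\<forall>i\<in>{1..l}. 0 \<le> p i" using pe e(2) \<theta>(2) by (metis add_nonneg_nonneg diff_add_cancel)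
  then have pp: "qf p p = 2" using positive_root_norm root p by simp
  have tt: "qf \<theta> \<theta> = 2" by (rule positive_root_norm[OF \<theta>(1,2)])
  have "qf p \<theta> - qf \<theta> \<theta> = (\<Sum>i\<in>{1..l}. (p i - \<theta> i) * cart_row \<theta> i)"
    by (simp add: qf_def left_diff_distrib sum_subtractf)
  also have "\<dots> \<ge> 0" using pe e(2) \<theta>(3) by (intro sum_nonneg mult_nonneg_nonneg) auto
  \<comment> \<open>The norm of the difference is 2 - 2 (\<psi>, \<theta>) + 2 with (\<psi>,
    \<theta>) \<ge> 2.\<close>
  finally have "qf (\<lambda>i. p i - \<theta> i) (\<lambda>i. p i - \<theta> i) \<le> 0"
    using pp tt qf_sym[of \<theta> p] by (simp add: qf_diff)
  then have "qf (\<lambda>i. p i - \<theta> i) (\<lambda>i. p i - \<theta> i) = 0"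
    using qf_positive_definite(1)[of "\<lambda>i. p i - \<theta> i"] by linarith
  from qf_positive_definite(2)[OF this] have "p i = \<theta> i" if "i \<in> {1..l}" for i using that by fastforce
  then show ?thesis unfolding p by (intro comb_cong) simp
qed

lemma icomb_unit: "i \<in> {1..l} \<Longrightarrow> icomb (unit_vec i) = \<alpha> i"
  using comb_unit[of i] by (simp add: unit_vec_def if_distrib[of of_int] cong: if_cong)

lemma icomb_uminus: "icomb (\<lambda>i. - c i) = - icomb c"
  using comb_uminus[of "\<lambda>i. of_int (c i)"] by simp

lemma alt_steps_root_backwards:
  assumes col: "two_coloring X J1 J2" and "icomb (alt_steps X J1 J2 c k) \<in> roots L H"
  shows "icomb c \<in> roots L H"
  using assms(2)
proof (induction k)
  case (Suc k)
  let ?J = "if even k then J1 else J2"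
  have J: "?J \<subseteq> {1..l}" "\<forall>i\<in>?J. \<forall>j\<in>?J. \<not> dynkin_adjacent X i j"
    using col rank by (auto simp: two_coloring_def)
  have "refl_prod L H \<alpha> ?J (icomb (refl_step X ?J (alt_steps X J1 J2 c k))) \<in> roots L H"
    using Suc.prems by (intro refl_prod_root[OF J(1)]) simp
  then have "icomb (alt_steps X J1 J2 c k) \<in> roots L H"
    by (simp only: refl_prod_comb[OF J] refl_step_of_int refl_step_involutive[OF J(2)])
  then show ?case by (rule Suc.IH)
qed simp

lemma root_partition_two_coloring:
  assumes "root_partition L H l \<alpha> \<psi> I1 I2"
  shows "two_coloring X I1 I2"
proof -
  have *: "\<not> dynkin_adjacent X i j" if "i \<in> {1..l}" "j \<in> {1..l}" "i \<noteq> j \<Longrightarrow> fm (\<alpha> i) (\<alpha> j) = 0" for i j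
    using cartan_entry[OF that(1,2)] that(3) adjacent_irrefl[OF admissible, of i] by (cases "i = j") (auto split: if_splits)
  have part: "I1 \<union> I2 = {1..l}" "I1 \<inter> I2 = {}"
    "\<And>i j. i \<in> I1 \<Longrightarrow> j \<in> I1 \<Longrightarrow> i \<noteq> j \<Longrightarrow> fm (\<alpha> i) (\<alpha> j) = 0"
    "\<And>i j. i \<in> I2 \<Longrightarrow> j \<in> I2 \<Longrightarrow> i \<noteq> j \<Longrightarrow> fm (\<alpha> i) (\<alpha> j) = 0"
    using assms by (simp_all add: root_partition_def)
  have "\<not> dynkin_adjacent X i j" if "i \<in> I1" "j \<in> I1" for i j
    using *[of i j] part(1) part(3)[of i j] that by blast
  moreover have "\<not> dynkin_adjacent X i j" if "i \<in> I2" "j \<in> I2" for i j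
    using *[of i j] part(1) part(4)[of i j] that by blast
  ultimately show ?thesis using part(1,2) unfolding two_coloring_def rank by simp
qed

text \<open>A node a in J1 with (\<alpha> a, \<theta>) \<noteq> 0 cannot lie in I2, since I2 is
  orthogonal to \<psi>. The two colourings then agree at a and, the diagram being connected,
  everywhere.\<close>

lemma highest_root_and_partition:
  assumes D: "coxeter_data X g J1 J2 \<theta> s \<pi>"
    and \<psi>: "highest_root L H l \<alpha> \<psi>" and part: "root_partition L H l \<alpha> \<psi> I1 I2"
  shows "\<psi> = icomb \<theta>" "I1 = J1" "I2 = J2"
proof -
  have col: "two_coloring X J1 J2" and s: "s \<in> {1..l}" "alt_steps X J1 J2 \<theta> (g - 1) = unit_vec s"
    using D unfolding coxeter_data_def rank by blast+
  show eq: "\<psi> = icomb \<theta>"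
  proof (rule highest_root_unique[OF \<psi>])
    show "icomb \<theta> \<in> roots L H"
    proof (rule alt_steps_root_backwards[OF col])
      show "icomb (alt_steps X J1 J2 \<theta> (g - 1)) \<in> roots L H"
        unfolding s(2) icomb_unit[OF s(1)] by (rule simple_root[OF s(1)])
    qed
    show "\<forall>i\<in>{1..l}. 0 \<le> \<theta> i" using D unfolding coxeter_data_def by blast
    have "\<forall>i\<in>{1..l}. nbr_sum X \<theta> i \<le> 2 * \<theta> i" using D unfolding coxeter_data_def rank by blast
    then show "\<forall>i\<in>{1..l}. 0 \<le> cart_row \<theta> i" by (simp add: cart_row_def)
  qed
  obtain a where a: "a \<in> J1" "nbr_sum X \<theta> a \<noteq> 2 * \<theta> a" using D unfolding coxeter_data_def by blast
  have al: "a \<in> {1..l}" using a(1) col unfolding two_coloring_def rank by blast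
  have "cart_row \<theta> a \<noteq> 0" using a(2) by (simp add: cart_row_def)
  then have "fm (\<alpha> a) \<psi> \<noteq> 0"
    using \<kappa>_nonzero by (simp add: eq form_sym[of "\<alpha> a"] form_comb_simple[OF al] cart_row_of_int)
  then have "a \<in> I1" using part al by (auto simp: root_partition_def)
  then show "I1 = J1" "I2 = J2"
    using two_coloring_unique[OF admissible root_partition_two_coloring[OF part] col _ a(1)] by blast+
qed

end

section \<open>The Coxeter element\<close>

context lie_ade
begin

lemma coxeter_element_comb:
  assumes "two_coloring X I1 I2"
  shows "(coxeter_element L H \<alpha> I1 I2 ^^ n) (comb c) = comb ((cox_step X I1 I2 ^^ n) c)"
proof -
  have "I1 \<subseteq> {1..l}" "I2 \<subseteq> {1..l}" "\<forall>i\<in>I1. \<forall>j\<in>I1. \<not> dynkin_adjacent X i j"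
      "\<forall>i\<in>I2. \<forall>j\<in>I2. \<not> dynkin_adjacent X i j"
    using assms unfolding two_coloring_def rank by blast+
  then have step: "coxeter_element L H \<alpha> I1 I2 (comb d) = comb (cox_step X I1 I2 d)" for d
    by (simp add: coxeter_element_def cox_step_def refl_prod_comb)
  show ?thesis by (induction n) (simp_all add: step)
qed

lemma coxeter_element_icomb:
  assumes "two_coloring X I1 I2"
  shows "(coxeter_element L H \<alpha> I1 I2 ^^ n) (icomb c) = icomb ((cox_step X I1 I2 ^^ n) c)"
  unfolding coxeter_element_comb[OF assms] cox_step_of_int ..

lemma dual_comb_supported:
  assumes "\<mu> \<in> cartan_dual L H"
  obtains c where "\<mu> = comb c" "\<And>i. i \<notin> nodes X \<Longrightarrow> c i = 0"
proof (rule that)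
  show "\<mu> = comb (\<lambda>i. if i \<in> nodes X then \<mu> (cw i) else 0)"
    using dual_expand[OF assms] rank comb_cong[of "\<lambda>i. \<mu> (cw i)" "\<lambda>i. if i \<in> nodes X then \<mu> (cw i) else 0"]
    by simp
qed auto

lemma coxeter_element_period:
  assumes D: "coxeter_data X g I1 I2 \<theta> s \<pi>" and "\<mu> \<in> cartan_dual L H"
  shows "(coxeter_element L H \<alpha> I1 I2 ^^ (2 * g)) \<mu> = \<mu>"
proof -
  have col: "two_coloring X I1 I2" using D unfolding coxeter_data_def by blast
  obtain c where c: "\<mu> = comb c" "\<And>i. i \<notin> nodes X \<Longrightarrow> c i = 0"
    using dual_comb_supported[OF assms(2)] by blast
  have "(cox_step X I1 I2 ^^ (2 * g)) c = (cox_step X I1 I2 ^^ g) ((cox_step X I1 I2 ^^ g) c)"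
    by (simp add: mult_2 funpow_add)
  also have "\<dots> = c" by (rule coxeter_data_period[OF D c(2)])
  finally show ?thesis unfolding c(1) coxeter_element_comb[OF col] by simp
qed

text \<open>The least exponent d divides 2g. If d \<noteq> 2g then 2d \<le> 2g, and \<sigma>^d
  fixing \<theta> would bring the alternating sequence back to \<theta> at index 2d, against
  \<open>coxeter_data_no_return\<close>.\<close>

lemma coxeter_number_eq:
  assumes D: "coxeter_data X g I1 I2 \<theta> s \<pi>"
  shows "coxeter_number L H \<alpha> I1 I2 = 2 * g"
proof -
  let ?\<sigma> = "coxeter_element L H \<alpha> I1 I2"
  let ?P = "\<lambda>n. 0 < n \<and> (\<forall>\<mu>\<in>cartan_dual L H. (?\<sigma> ^^ n) \<mu> = \<mu>)"
  have col: "two_coloring X I1 I2" and g: "1 \<le> g" using D unfolding coxeter_data_def by blast+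
  have sub: "I1 \<subseteq> nodes X" "I2 \<subseteq> nodes X" using col unfolding two_coloring_def by blast+
  define d where "d = (LEAST n. ?P n)"
  have P: "?P (2 * g)" using coxeter_element_period[OF D] g by simp
  then have d: "?P d" "d \<le> 2 * g" unfolding d_def by (rule LeastI, rule Least_le)
  have "d = 2 * g"
  proof (rule ccontr)
    assume "d \<noteq> 2 * g"
    have fixed: "(?\<sigma> ^^ (2 * g mod d)) \<mu> = \<mu>" if "\<mu> \<in> cartan_dual L H" for \<mu>
      using funpow_mod_eq[of d ?\<sigma> \<mu> "2 * g"] d(1) P that by simp
    have "2 * g mod d < d" using d(1) by simp
    then have "\<not> ?P (2 * g mod d)" unfolding d_def by (rule not_less_Least)
    then have "2 * g mod d = 0" using fixed by auto
    then obtain q where q: "2 * g = d * q" by auto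
    have "q \<noteq> 0" using q g by (intro notI) simp
    moreover have "q \<noteq> 1" using q \<open>d \<noteq> 2 * g\<close> by (intro notI) simp
    ultimately have "2 \<le> q" by simp
    then have "d * 2 \<le> d * q" by (rule mult_le_mono2)
    then have dg: "2 * d \<le> 2 * g" using q by simp
    have "icomb (alt_steps X I1 I2 \<theta> (2 * d)) = icomb \<theta>"
      unfolding alt_steps_even coxeter_element_icomb[OF col, symmetric] using d(1) comb_dual by blast
    \<comment> \<open>Equal functionals agree in their coordinates at the nodes only; elsewhere no
      step changes anything.\<close>
    then have "alt_steps X I1 I2 \<theta> (2 * d) i = \<theta> i" if "i \<in> nodes X" for i
      using comb_eqD[of _ _ i] that rank by (metis of_int_eq_iff)
    then have "alt_steps X I1 I2 \<theta> (2 * d) = \<theta>"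
      using alt_steps_outside[OF sub] by blast
    then show False using coxeter_data_no_return[OF D, of "2 * d"] dg d(1) by simp
  qed
  then show ?thesis by (simp add: coxeter_number_def d_def)
qed

text \<open>Combine \<sigma>^g \<tau> \<sigma>^g = \<tau> with \<sigma>^(2g) = 1.\<close>

lemma coxeter_half_power_commutes:
  assumes D: "coxeter_data X g I1 I2 \<theta> s \<pi>" and \<mu>: "\<mu> \<in> cartan_dual L H" and J: "J = I1 \<or> J = I2"
  shows "(coxeter_element L H \<alpha> I1 I2 ^^ g) (refl_prod L H \<alpha> J \<mu>)
    = refl_prod L H \<alpha> J ((coxeter_element L H \<alpha> I1 I2 ^^ g) \<mu>)"
proof -
  let ?C = "cox_step X I1 I2 :: (nat \<Rightarrow> complex) \<Rightarrow> nat \<Rightarrow> complex"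
  have col: "two_coloring X I1 I2" using D unfolding coxeter_data_def by blast
  have J': "J \<subseteq> {1..l}" "\<forall>i\<in>J. \<forall>j\<in>J. \<not> dynkin_adjacent X i j"
    using J col unfolding two_coloring_def rank by blast+
  obtain c where c: "\<mu> = comb c" "\<And>i. i \<notin> nodes X \<Longrightarrow> c i = 0"
    using dual_comb_supported[OF \<mu>] by blast
  have per: "(?C ^^ g) ((?C ^^ g) c) = c" by (rule coxeter_data_period[OF D c(2)])
  have "(?C ^^ g) (refl_step X J c) = (?C ^^ g) (refl_step X J ((?C ^^ g) ((?C ^^ g) c)))"
    unfolding per ..
  also have "\<dots> = refl_step X J ((?C ^^ g) c)"
    using J cox_step_conjugation[OF col, of g "(?C ^^ g) c"] by blast
  finally show ?thesis unfolding c(1) refl_prod_comb[OF J'] coxeter_element_comb[OF col] by simp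
qed

text \<open>\<sigma>^g sends \<alpha> j to - \<alpha> (\<pi> j), and \<pi> permutes each colour
  class.\<close>

lemma coxeter_half_power_simple_roots:
  assumes D: "coxeter_data X g I1 I2 \<theta> s \<pi>" and J: "J = I1 \<or> J = I2"
  shows "(coxeter_element L H \<alpha> I1 I2 ^^ g) ` (\<alpha> ` J) = uminus ` (\<alpha> ` J)"
proof -
  have col: "two_coloring X I1 I2" using D unfolding coxeter_data_def by blast
  have sub: "J \<subseteq> nodes X" using J col unfolding two_coloring_def by blast
  have \<pi>: "\<pi> j \<in> nodes X" "\<pi> (\<pi> j) = j" "\<pi> j \<in> I1 \<longleftrightarrow> j \<in> I1"
      "(cox_step X I1 I2 ^^ g) (unit_vec j) = (\<lambda>i. - unit_vec (\<pi> j) i :: int)" if "j \<in> nodes X" for j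
    using D that unfolding coxeter_data_def by blast+
  have \<pi>J: "\<pi> j \<in> J" if "j \<in> J" for j
    using \<pi>(1,3)[of j] that J sub col unfolding two_coloring_def by blast
  have img: "(coxeter_element L H \<alpha> I1 I2 ^^ g) (\<alpha> j) = - \<alpha> (\<pi> j)" if "j \<in> J" for j
  proof -
    have j: "j \<in> nodes X" using that sub by blast
    have jl: "j \<in> {1..l}" "\<pi> j \<in> {1..l}" using j \<pi>(1)[OF j] rank by simp_all
    have "(coxeter_element L H \<alpha> I1 I2 ^^ g) (icomb (unit_vec j)) = icomb (\<lambda>i. - unit_vec (\<pi> j) i)"
      unfolding coxeter_element_icomb[OF col] \<pi>(4)[OF j] ..
    then show ?thesis unfolding icomb_uminus icomb_unit[OF jl(1)] icomb_unit[OF jl(2)] .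
  qed
  have "(coxeter_element L H \<alpha> I1 I2 ^^ g) ` (\<alpha> ` J) = (\<lambda>j. - \<alpha> (\<pi> j)) ` J"
    unfolding image_image using img by (intro image_cong) auto
  also have "\<dots> = uminus ` \<alpha> ` (\<pi> ` J)" by (simp add: image_image)
  also have "\<pi> ` J = J"
  proof
    show "J \<subseteq> \<pi> ` J"
    proof
      fix j assume "j \<in> J"
      then have "j = \<pi> (\<pi> j)" "\<pi> j \<in> J" using \<pi>(2)[of j] \<pi>J sub by auto
      then show "j \<in> \<pi> ` J" by blast
    qed
  qed (use \<pi>J in blast)
  finally show ?thesis .
qed

end

theorem mainTheorem4:
  fixes L :: "'g::ab_group_add lie_structure"
    and H :: "'g set"
    and X :: dynkin_type
    and l h g istar :: nat
    and \<alpha> \<beta> :: "nat \<Rightarrow> 'g \<Rightarrow> complex"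
    and \<psi> :: "'g \<Rightarrow> complex"
    and I1 I2 :: "nat set"
    and \<tau>1 \<tau>2 \<sigma> :: "('g \<Rightarrow> complex) \<Rightarrow> ('g \<Rightarrow> complex)"
  assumes "simple_lie_algebra L"
    and "cartan_subalgebra L H"
    and "admissible_type X"
    and "l = type_rank X"
    and "simple_roots L H l \<alpha>"
    and "has_dynkin_type L H \<alpha> X"
    and "highest_root L H l \<alpha> \<psi>"
    and "root_partition L H l \<alpha> \<psi> I1 I2"
    and "special_node X istar"
  defines "\<tau>1 \<equiv> refl_prod L H \<alpha> I1"
    and "\<tau>2 \<equiv> refl_prod L H \<alpha> I2"
    and "\<sigma> \<equiv> coxeter_element L H \<alpha> I1 I2"
    and "\<beta> \<equiv> signed_simple_root \<alpha> I1"
    and "h \<equiv> coxeter_number L H \<alpha> I1 I2"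
    and "g \<equiv> h div 2"
  shows "same_orbit L H \<sigma> \<psi> (\<beta> istar)
    \<and> (odd g \<longrightarrow> (\<sigma> ^^ ((g - 1) div 2)) \<psi> = \<beta> istar \<and> \<beta> istar = \<alpha> istar)
    \<and> (even g \<longrightarrow> (\<sigma> ^^ (g div 2)) \<psi> = \<beta> istar \<and> \<beta> istar = - \<alpha> istar)
    \<and> (\<forall>\<mu>\<in>cartan_dual L H. (\<sigma> ^^ g) (\<tau>1 \<mu>) = \<tau>1 ((\<sigma> ^^ g) \<mu>))
    \<and> (\<forall>\<mu>\<in>cartan_dual L H. (\<sigma> ^^ g) (\<tau>2 \<mu>) = \<tau>2 ((\<sigma> ^^ g) \<mu>))
    \<and> (\<sigma> ^^ g) ` (\<alpha> ` I1) = uminus ` (\<alpha> ` I1)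
    \<and> (\<sigma> ^^ g) ` (\<alpha> ` I2) = uminus ` (\<alpha> ` I2)
    \<and> (\<sigma> ^^ g) (\<alpha> istar) = - \<alpha> istar
    \<and> same_orbit L H \<sigma> \<psi> (\<alpha> istar)"
proof -
  interpret lie_cartan L H by unfold_locales (fact assms(1,2))+
  have "1 \<le> type_rank X" using assms(3) by (cases X) (auto simp: odd_pos Suc_leI)
  then interpret lie_simple_roots L H l \<alpha> by unfold_locales (use assms(4,5) in auto)
  interpret lie_ade L H l \<alpha> X by unfold_locales (fact assms(3,4,6))+
  obtain g' J1 J2 \<theta> s \<pi> where "coxeter_data X g' J1 J2 \<theta> s \<pi>"
    using coxeter_data_exists[OF assms(3)] by blast
  then have \<psi>: "\<psi> = icomb \<theta>" and D': "coxeter_data X g' I1 I2 \<theta> s \<pi>"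
    using highest_root_and_partition[OF _ assms(7,8)] by simp_all
  have "g = g'" unfolding g_def h_def coxeter_number_eq[OF D'] by simp
  then have D: "coxeter_data X g I1 I2 \<theta> s \<pi>" using D' by simp
  have col: "two_coloring X I1 I2" and g: "1 \<le> g" and istar: "istar = s"
    and s: "s \<in> {1..l}" "s \<in> I1 \<longleftrightarrow> odd g" "alt_steps X I1 I2 \<theta> (g - 1) = unit_vec s"
    using D assms(9) unfolding coxeter_data_def assms(4) by blast+
  have \<psi>_root: "\<psi> \<in> roots L H" using assms(7) by (simp add: highest_root_def)
  have \<alpha>_root: "\<alpha> s \<in> roots L H" "- \<alpha> s \<in> roots L H"
    using simple_root[OF s(1)] root_uminus by blast+
  have \<sigma>_icomb: "(\<sigma> ^^ n) (icomb c) = icomb ((cox_step X I1 I2 ^^ n) c)" for n c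
    unfolding \<sigma>_def by (rule coxeter_element_icomb[OF col])
  have half: "(cox_step X I1 I2 ^^ g) \<theta> = (\<lambda>i. - \<theta> i)"
    using coxeter_data_half_period[OF D] unfolding alt_steps_even .
  have \<beta>: "\<beta> s = (if odd g then \<alpha> s else - \<alpha> s)"
    by (simp add: \<beta>_def signed_simple_root_def s(2))
  have odd_case: "(\<sigma> ^^ ((g - 1) div 2)) \<psi> = \<alpha> s" if "odd g"
  proof -
    have "2 * ((g - 1) div 2) = g - 1" using that by simp
    then have "(cox_step X I1 I2 ^^ ((g - 1) div 2)) \<theta> = unit_vec s"
      using s(3) alt_steps_even[of X I1 I2 \<theta> "(g - 1) div 2"] by simp
    then show ?thesis unfolding \<psi> \<sigma>_icomb by (simp only: icomb_unit[OF s(1)])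
  qed
  \<comment> \<open>One step beyond \<open>unit_vec s\<close> the reversal gives its negative, at
    index g, which is even here and so belongs to a power of \<sigma>.\<close>
  have even_step: "(cox_step X I1 I2 ^^ (g div 2)) \<theta> = (\<lambda>i. - unit_vec s i)" if "even g"
  proof -
    have "alt_steps X I1 I2 \<theta> (g - 1 + 1) = (\<lambda>i. - unit_vec s i)"
      using coxeter_data_reversal[OF D order_refl g] unfolding s(3) .
    moreover have "g - 1 + 1 = 2 * (g div 2)" using g that by simp
    ultimately show ?thesis unfolding alt_steps_even[symmetric] by metis
  qed
  have even_case: "(\<sigma> ^^ (g div 2)) \<psi> = - \<alpha> s" if "even g"
    unfolding \<psi> \<sigma>_icomb even_step[OF that] icomb_uminus icomb_unit[OF s(1)] ..
  \<comment> \<open>Powers of one map commute, so \<sigma>^g, being - 1 on \<theta>, is - 1 on its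
    whole orbit.\<close>
  have comm: "(cox_step X I1 I2 ^^ g) ((cox_step X I1 I2 ^^ n) \<theta>) = (\<lambda>i. - (cox_step X I1 I2 ^^ n) \<theta> i)" for n
  proof -
    have "(cox_step X I1 I2 ^^ g) ((cox_step X I1 I2 ^^ n) \<theta>) = (cox_step X I1 I2 ^^ n) ((cox_step X I1 I2 ^^ g) \<theta>)"
      using fun_cong[OF funpow_add[of g n "cox_step X I1 I2"], of \<theta>]
        fun_cong[OF funpow_add[of n g "cox_step X I1 I2"], of \<theta>] by (simp add: add.commute)
    then show ?thesis unfolding half cox_step_uminus .
  qed
  have neg: "(\<sigma> ^^ g) ((\<sigma> ^^ n) \<psi>) = - (\<sigma> ^^ n) \<psi>" for n
    unfolding \<psi> \<sigma>_icomb comm icomb_uminus ..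
  have odd: "odd g \<longrightarrow> (\<sigma> ^^ ((g - 1) div 2)) \<psi> = \<beta> istar \<and> \<beta> istar = \<alpha> istar"
    and even: "even g \<longrightarrow> (\<sigma> ^^ (g div 2)) \<psi> = \<beta> istar \<and> \<beta> istar = - \<alpha> istar"
    using odd_case even_case unfolding istar \<beta> by simp_all
  have orbit: "same_orbit L H \<sigma> \<psi> \<nu>" if "(\<sigma> ^^ n) \<psi> = \<nu>" "\<nu> \<in> roots L H" for n \<nu>
    using \<psi>_root that unfolding same_orbit_def by blast
  have orbit_\<beta>: "same_orbit L H \<sigma> \<psi> (\<beta> istar)"
  proof (cases "odd g")
    case True
    show ?thesis unfolding istar \<beta> using True by (simp add: orbit[OF odd_case \<alpha>_root(1)])
  next
    case False
    then show ?thesis unfolding istar \<beta> by (simp add: orbit[OF even_case \<alpha>_root(2)])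
  qed
  have orbit_\<alpha>: "same_orbit L H \<sigma> \<psi> (\<alpha> istar)"
  proof (cases "odd g")
    case True
    show ?thesis unfolding istar by (rule orbit[OF odd_case[OF True] \<alpha>_root(1)])
  next
    case False
    then have even: "even g" by simp
    \<comment> \<open>For even g the power g/2 leads to - \<alpha> s; a further \<sigma>^g removes
      the sign.\<close>
    have "(\<sigma> ^^ (g + g div 2)) \<psi> = (\<sigma> ^^ g) ((\<sigma> ^^ (g div 2)) \<psi>)" by (simp add: funpow_add)
    also have "\<dots> = - (\<sigma> ^^ (g div 2)) \<psi>" by (rule neg)
    also have "\<dots> = - (- \<alpha> s)" unfolding even_case[OF even] ..
    also have "\<dots> = \<alpha> s" by (simp add: fun_eq_iff)
    finally have "(\<sigma> ^^ (g + g div 2)) \<psi> = \<alpha> s" .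
    then show ?thesis unfolding istar by (rule orbit[OF _ \<alpha>_root(1)])
  qed
  have flip: "(\<sigma> ^^ g) (\<alpha> istar) = - \<alpha> istar"
  proof (cases "odd g")
    case True
    then show ?thesis unfolding istar using neg[of "(g - 1) div 2"] odd_case by simp
  next
    case False
    \<comment> \<open>- \<alpha> s lies in the orbit of \<psi>, so \<sigma>^g changes its sign;
      linearity transfers this to \<alpha> s.\<close>
    have "(cox_step X I1 I2 ^^ g) (\<lambda>i. - unit_vec s i) = (\<lambda>i. - (- unit_vec s i) :: int)"
      using comm[of "g div 2"] unfolding even_step[OF False[unfolded not_not]] .
    then have "(cox_step X I1 I2 ^^ g) (unit_vec s) = (\<lambda>i. - unit_vec s i :: int)"
      unfolding cox_step_uminus fun_eq_iff by (simp only: neg_equal_iff_equal simp_thms)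
    then show ?thesis
      unfolding istar using \<sigma>_icomb[of g "unit_vec s"] by (simp only: icomb_uminus icomb_unit[OF s(1)])
  qed
  have comm1: "\<forall>\<mu>\<in>cartan_dual L H. (\<sigma> ^^ g) (\<tau>1 \<mu>) = \<tau>1 ((\<sigma> ^^ g) \<mu>)"
    unfolding \<sigma>_def \<tau>1_def using coxeter_half_power_commutes[OF D _ disjI1[OF refl]] by (rule ballI)
  have comm2: "\<forall>\<mu>\<in>cartan_dual L H. (\<sigma> ^^ g) (\<tau>2 \<mu>) = \<tau>2 ((\<sigma> ^^ g) \<mu>)"
    unfolding \<sigma>_def \<tau>2_def using coxeter_half_power_commutes[OF D _ disjI2[OF refl]] by (rule ballI)
  have neg1: "(\<sigma> ^^ g) ` (\<alpha> ` I1) = uminus ` (\<alpha> ` I1)"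
    unfolding \<sigma>_def by (rule coxeter_half_power_simple_roots[OF D disjI1[OF refl]])
  have neg2: "(\<sigma> ^^ g) ` (\<alpha> ` I2) = uminus ` (\<alpha> ` I2)"
    unfolding \<sigma>_def by (rule coxeter_half_power_simple_roots[OF D disjI2[OF refl]])
  show ?thesis
    using orbit_\<beta> odd even comm1 comm2 neg1 neg2 flip orbit_\<alpha> by (intro conjI)
qed

end
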